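(* Consider, for a constant state $u_0=(v_0,w_0)\in\mathcal H$, the admissible weak solution (described in the context) of the Riemann problem in the half space $$\partial_t w-\partial_x v=0,\quad \partial_t v-\partial_x\sigma(w)=0\ \ (t>0,\ x>0),\qquad u(0,x)=u_0\ (x>0),\qquad v(t,0+)=0 .$$ The states and the wave speeds in the solution are Lipschitz continuous functions of the initial state $u_0$. As a consequence, if $u_0'$ and $u_0''$ are two Riemann data for the system in the half space, then the corresponding admissible solutions $u'$ and $u''$ satisfy $$\int_A^B|u'(t,x)-u''(t,x)|\,dx\le O(1)\,\big(B+c_1t-\max(0,A-c_1t)\big)\,|u_0'-u_0''|$$ for all $0<A<B$ and $t\ge0$, where $O(1)$ denotes a constant independent of $A,B,t$.
   Context: Notation: $]a,b[$ is the open interval. Let $k_1>k_3>0$, $w_m>w_M>0$, $c_1=\sqrt{k_1}$, $c_3=\sqrt{k_3}$. $\sigma:]-1,\infty[\to\mathbb R$ is $\sigma(w)=k_1w$ for $-1<w\le w_M$, $\sigma(w)=k_3w$ for $w\ge w_m$, and affine on $[w_M,w_m]$ joining these values continuously. Write $u=(v,w)$, $\mathcal H_1=\{(v,w):v\in\mathbb R,-1<w\le w_M\}$, $\mathcal H_3=\{(v,w):v\in\mathbb R,w\ge w_m\}$, $\mathcal H=\mathcal H_1\cup\mathcal H_3$. Critical values for initiation: two given constants with $\sigma_0/k_1\le w_M^{cr}\le w_M$ and $w_m\le w_m^{cr}\le\sigma_0/k_3$, where $\sigma_0=c_1c_3\sqrt{w_mw_M}$. Entropy dissipation function. $\phi:]-c_3,c_3]\to\mathbb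 R$ is given with: $\phi\in C^2(]-c_3,0[\cup]0,c_3])$ and $\phi(0\pm),\phi'(0\pm)$ exist; $\lim_{V\to c_3^-}\phi=\overline\psi(c_3)$ and $\phi'''(c_3-)$ exists; $\lim_{V\to-c_3^+}\phi=-\infty$; $\phi$ is increasing; $\underline\psi(V)\le\phi(V)\le0$ for $V\in]-c_3,0]$ and $0\le\phi(V)\le\overline\psi(V)$ for $V\in[0,c_3]$, where $\underline\psi(V)=\frac{k_1-k_3}2w_M\big(w_m-\frac{k_1-V^2}{k_3-V^2}w_M\big)$ and $\overline\psi(V)=\frac{k_1-k_3}2w_m\big(w_M-\frac{k_3-V^2}{k_1-V^2}w_m\big)$. If $\phi$ jumps at $0$, then at $V=0$ "$=\phi(0)$" is understood as membership in $[\phi(0-),\phi(0+)]$. The Rankine–Hugoniot relations for a discontinuity of speed $s$ between $u_a$ (left) and $u_b$ (right) are $s(w_b-w_a)+v_b-v_a=0$, $s(v_b-v_a)+\sigma(w_b)-\sigma(w_a)=0$. For a subsonic phase boundary (states in different phases, $|s|\le c_3$) the kinetic relation reads $\frac{k_1-k_3}2(w_Mw_m-w_aw_b)=\phi(s)$ if $u_a\in\mathcal H_1,u_b\in\mathcal H_3$, and $=\phi(-s)$ if $u_a\in\mathcal H_3,u_b\in\mathcal H_1$. The solution (self-similar, in the variable $x/t>0$). Case $u_0\in\mathcal H_3$: let $h_0=w_0+v_0/c_3$. If $h_0\ge w_m^{cr}$: $u=u_*=(0,h_0)$ for $x<c_3t$, $u=u_0$ for $x>c_3t$. If $h_0<w_m^{cr}$: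 $u=u_-$ for $x<Vt$, $u=u_+$ for $Vt<x<c_3t$, $u=u_0$ for $x>c_3t$, where $u_-\in\mathcal H_1$, $v_-=0$, $u_+\in\mathcal H_3$, and $u_-,u_+,V$ are determined by the Rankine–Hugoniot relations along $x=Vt$ and $x=c_3t$ and the kinetic relation along $x=Vt$. Case $u_0\in\mathcal H_1$: let $h_0=w_0+v_0/c_1$. If $h_0\le w_M^{cr}$: $u=u_*=(0,h_0)$ for $x<c_1t$, $u=u_0$ for $x>c_1t$. If $h_0>w_M^{cr}$: $u=u_-$ for $x<Vt$, $u=u_+$ for $Vt<x<c_1t$, $u=u_0$ for $x>c_1t$, where $u_-\in\mathcal H_3$, $v_-=0$, $u_+\in\mathcal H_1$, $V\in]0,c_1[$, and $u_-,u_+,V$ are determined by the Rankine–Hugoniot relations along $x=Vt$ and $x=c_1t$ and the kinetic relation along $x=Vt$. Initial states for which this construction yields no solution with values in $\mathcal H$ are excluded.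
   Formalization: Lipschitz dependence is per kind of solution (with or without phase boundary); O(1) is uniform in the data except for same-phase data on opposite sides of a critical value where phase-boundary speeds stay away from 0 (uniformity fails there; O(1) may then depend on the pair). *)

theory Defs
  imports "HOL-Analysis.Analysis"
begin

text \<open>States are pairs (v, w) of velocity and strain, of type real \<times> real.\<close>

type_synonym state = "real \<times> real"

record bar =
  k1 :: real
  k3 :: real
  wM :: real
  wm :: real
  wMcr :: real  \<comment> \<open>critical strain for initiation out of the low-strain phase\<close>
  wmcr :: real  \<comment> \<open>critical strain for initiation out of the high-strain phase\<close>
  phi :: "real \<Rightarrow> real"

definition c1 :: "bar \<Rightarrow> real" where "c1 M = sqrt (k1 M)"

definition c3 :: "bar \<Rightarrow> real" where "c3 M = sqrt (k3 M)"

definition sigma :: "bar \<Rightarrow> real \<Rightarrow> real" where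
  "sigma M w =
     (if w \<le> wM M then k1 M * w
      else if w \<ge> wm M then k3 M * w
      else k1 M * wM M + (k3 M * wm M - k1 M * wM M) / (wm M - wM M) * (w - wM M))"

definition sigma0 :: "bar \<Rightarrow> real" where
  "sigma0 M = c1 M * c3 M * sqrt (wm M * wM M)"

definition H1 :: "bar \<Rightarrow> state set" where
  "H1 M = {(v, w). -1 < w \<and> w \<le> wM M}"

definition H3 :: "bar \<Rightarrow> state set" where
  "H3 M = {(v, w). wm M \<le> w}"

definition HH :: "bar \<Rightarrow> state set" where "HH M = H1 M \<union> H3 M"

definition psi_lower :: "bar \<Rightarrow> real \<Rightarrow> real" where
  "psi_lower M V = (k1 M - k3 M) / 2 * wM M * (wm M - (k1 M - V\<^sup>2) / (k3 M - V\<^sup>2) * wM M)"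

definition psi_upper :: "bar \<Rightarrow> real \<Rightarrow> real" where
  "psi_upper M V = (k1 M - k3 M) / 2 * wm M * (wM M - (k3 M - V\<^sup>2) / (k1 M - V\<^sup>2) * wm M)"

text \<open>
  In the second and third conjunct p1 and p2 are the first and second derivatives
  of phi on ]-c3,0[ \<union> ]0,c3], one-sided at c3.  As phi is only twice differentiable in general,
  the existence of the third derivative at c3- is the existence of the left derivative of p2 there.
  The two bounds at V = 0 force phi 0 = 0; this value is not used in the kinetic relation below,
  and phi may still jump at 0.
\<close>

definition dissipation_function :: "bar \<Rightarrow> bool" where
  "dissipation_function M \<longleftrightarrow>
     (\<exists>l. (phi M \<longlongrightarrow> l) (at_left 0)) \<and> (\<exists>l. (phi M \<longlongrightarrow> l) (at_right 0)) \<and>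
     (\<exists>p1 p2. let I = {- c3 M<..<0} \<union> {0<..c3 M} in
        (\<forall>V\<in>I. (phi M has_real_derivative p1 V) (at V within I)) \<and>
        (\<forall>V\<in>I. (p1 has_real_derivative p2 V) (at V within I)) \<and>
        continuous_on I p2 \<and>
        (\<exists>l. (p1 \<longlongrightarrow> l) (at_left 0)) \<and> (\<exists>l. (p1 \<longlongrightarrow> l) (at_right 0)) \<and>
        (\<exists>l. (p2 has_real_derivative l) (at (c3 M) within I))) \<and>
     (phi M \<longlongrightarrow> psi_upper M (c3 M)) (at_left (c3 M)) \<and>
     filterlim (phi M) at_bot (at_right (- c3 M)) \<and>
     mono_on {- c3 M<..c3 M} (phi M) \<and>
     (\<forall>V\<in>{- c3 M<..0}. psi_lower M V \<le> phi M V \<and> phi M V \<le> 0) \<and>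
     (\<forall>V\<in>{0..c3 M}. 0 \<le> phi M V \<and> phi M V \<le> psi_upper M V)"

definition admissible_bar :: "bar \<Rightarrow> bool" where
  "admissible_bar M \<longleftrightarrow>
     0 < k3 M \<and> k3 M < k1 M \<and> 0 < wM M \<and> wM M < wm M \<and>
     sigma0 M / k1 M \<le> wMcr M \<and> wMcr M \<le> wM M \<and>
     wm M \<le> wmcr M \<and> wmcr M \<le> sigma0 M / k3 M \<and>
     dissipation_function M"

definition RH :: "bar \<Rightarrow> real \<Rightarrow> state \<Rightarrow> state \<Rightarrow> bool" where
  "RH M s ua ub \<longleftrightarrow>
     s * (snd ub - snd ua) + fst ub - fst ua = 0 \<and>
     s * (fst ub - fst ua) + sigma M (snd ub) - sigma M (snd ua) = 0"

text \<open>
  The relation y = phi s, set-valued at the possible jump 0 and empty outside ]-c3,c3].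
  If phi does not jump at 0, monotonicity makes the interval at 0 the single value phi 0.
\<close>

definition phi_rel :: "bar \<Rightarrow> real \<Rightarrow> real \<Rightarrow> bool" where
  "phi_rel M s y \<longleftrightarrow>
     - c3 M < s \<and> s \<le> c3 M \<and>
     (if s = 0 then Lim (at_left 0) (phi M) \<le> y \<and> y \<le> Lim (at_right 0) (phi M)
      else y = phi M s)"

definition kinetic :: "bar \<Rightarrow> real \<Rightarrow> state \<Rightarrow> state \<Rightarrow> bool" where
  "kinetic M s ua ub \<longleftrightarrow>
     (let y = (k1 M - k3 M) / 2 * (wM M * wm M - snd ua * snd ub) in
      ua \<in> H1 M \<and> ub \<in> H3 M \<and> phi_rel M s y \<or>
      ua \<in> H3 M \<and> ub \<in> H1 M \<and> phi_rel M (- s) y)"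

definition outer_speed :: "bar \<Rightarrow> state \<Rightarrow> real" where
  "outer_speed M u0 = (if u0 \<in> H3 M then c3 M else c1 M)"

definition h0 :: "bar \<Rightarrow> state \<Rightarrow> real" where
  "h0 M u0 = snd u0 + fst u0 / outer_speed M u0"

definition nucleates :: "bar \<Rightarrow> state \<Rightarrow> bool" where
  "nucleates M u0 \<longleftrightarrow>
     u0 \<in> H3 M \<and> h0 M u0 < wmcr M \<or> u0 \<in> H1 M \<and> wMcr M < h0 M u0"

definition u_star :: "bar \<Rightarrow> state \<Rightarrow> state" where
  "u_star M u0 = (0, h0 M u0)"

text \<open>Initial states whose solution consists of the single wave x = outer_speed * t.\<close>

definition elastic_data :: "bar \<Rightarrow> state set" where
  "elastic_data M = {u0 \<in> HH M. \<not> nucleates M u0 \<and> u_star M u0 \<in> HH M}"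

text \<open>
  For data in H3 the bound V \<le> c3 is part of the kinetic relation.  If V = c3 (that is, h0 = 0)
  the sector V * t < x < c3 * t is empty and the conditions do not determine up.
\<close>

definition phase_boundary_states :: "bar \<Rightarrow> state \<Rightarrow> state \<Rightarrow> state \<Rightarrow> real \<Rightarrow> bool" where
  "phase_boundary_states M u0 um up V \<longleftrightarrow>
     nucleates M u0 \<and> fst um = 0 \<and>
     (u0 \<in> H3 M \<and> um \<in> H1 M \<and> up \<in> H3 M \<and> 0 \<le> V \<or>
      u0 \<in> H1 M \<and> um \<in> H3 M \<and> up \<in> H1 M \<and> 0 < V \<and> V < c1 M) \<and>
     RH M V um up \<and> RH M (outer_speed M u0) up u0 \<and> kinetic M V um up"

definition phase_boundary_data :: "bar \<Rightarrow> state set" where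
  "phase_boundary_data M = {u0. \<exists>um up V. phase_boundary_states M u0 um up V}"

text \<open>
  The solution, with arguments t and x.  Its values on the discontinuity lines are left free.
\<close>

definition riemann_solution :: "bar \<Rightarrow> state \<Rightarrow> (real \<Rightarrow> real \<Rightarrow> state) \<Rightarrow> bool" where
  "riemann_solution M u0 u \<longleftrightarrow>
     (u0 \<in> elastic_data M \<and>
      (\<forall>t\<ge>0. \<forall>x>0.
         (x < outer_speed M u0 * t \<longrightarrow> u t x = u_star M u0) \<and>
         (outer_speed M u0 * t < x \<longrightarrow> u t x = u0))) \<or>
     (\<exists>um up V. phase_boundary_states M u0 um up V \<and>
      (\<forall>t\<ge>0. \<forall>x>0.
         (x < V * t \<longrightarrow> u t x = um) \<and>
         (V * t < x \<and> x < outer_speed M u0 * t \<longrightarrow> u t x = up) \<and>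
         (outer_speed M u0 * t < x \<longrightarrow> u t x = u0)))"

text \<open>
  Nucleation out of the phase P is abrupt if the nucleated phase boundaries have speeds bounded
  away from 0.  In that case the solution jumps (in L1) when h0 crosses the critical value of
  that phase, and the two sides of this value cannot be compared by a Lipschitz estimate.
\<close>

definition abrupt_nucleation :: "bar \<Rightarrow> state set \<Rightarrow> bool" where
  "abrupt_nucleation M P \<longleftrightarrow>
     (\<exists>e>0. \<forall>u0\<in>P. \<forall>um up V. phase_boundary_states M u0 um up V \<longrightarrow> e \<le> V)"

definition abruptly_separated :: "bar \<Rightarrow> state \<Rightarrow> state \<Rightarrow> bool" where
  "abruptly_separated M u0' u0'' \<longleftrightarrow>
     (\<exists>P\<in>{H1 M, H3 M}. u0' \<in> P \<and> u0'' \<in> P \<and> abrupt_nucleation M P) \<and>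
     nucleates M u0' \<noteq> nucleates M u0''"

end

theory Submission
  imports Defs
begin

text \<open>
  Eliminating the velocities from the Rankine-Hugoniot relations leaves the invariant \<open>h0\<close> of the datum, the
  strains \<open>z\<close> at the wall and \<open>w\<close> behind the sound wave, and the speed \<open>V\<close>; the strains are explicit rational
  multiples of \<open>h0\<close> depending on \<open>V\<close>, and \<open>h0\<^sup>2 = (z w) F(V)\<close> with an explicit rational \<open>F\<close>. The kinetic relation makes
  \<open>z w\<close> monotone in \<open>V\<close> in the same direction as \<open>F\<close>, so the growth of \<open>F\<close> alone shows that \<open>V\<close> is a Lipschitz
  function of \<open>h0\<close>, whatever the regularity of the dissipation function. Its smoothness is needed only for
  \<open>w\<close> as \<open>V\<close> tends to the sonic speed \<open>c\<^sub>3\<close>, where \<open>w\<^sup>2\<close> is, up to a smooth factor, a difference quotient of it.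

  For two data in the same phase, the solutions differ by \<open>O(|u\<^sub>0' - u\<^sub>0''|)\<close> outside the sector between the two phase
  boundaries, and the width of this sector times the jump there has the same order. For data in
  different phases \<open>|u\<^sub>0' - u\<^sub>0''|\<close> is bounded below, and both solutions are compared with the waves generated
  by the initial velocity alone.
\<close>

section \<open>Lipschitz functions and difference quotients\<close>

text \<open>Uniqueness is never proved separately: every estimate compares two arbitrary solutions
  of the jump conditions, and uniqueness is the case of equal data. Three degenerations shape the
  constants. For data in the high-strain phase the state between the two waves is lost when
  \<open>V\<close> reaches \<open>c3 M\<close>, since its sector is then empty; it is selected only
  below that speed and then extended. For data in the low-strain phase \<open>h0\<close> is
  unbounded and the states grow with it, so an estimate of the speeds must carry the weight
  \<open>h0\<close>; this is why logarithms of the profile are compared there. Finally, if the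
  nucleated speeds stay away from 0, the solution jumps as \<open>h0\<close> crosses the critical
  value. Otherwise there are arbitrarily slow boundaries, and comparison with them bounds a speed by
  the distance of \<open>h0\<close> to the critical value. Pairs on two sides of an abrupt
  nucleation keep an estimate whose constant depends on the pair.\<close>

lemma lipschitz_extend_real:
  fixes f :: "'a::metric_space \<Rightarrow> real"
  assumes f: "L-lipschitz_on S f"
  shows "\<exists>g. L-lipschitz_on UNIV g \<and> (\<forall>x\<in>S. g x = f x)"
proof (cases "S = {}")
  case True
  have "L-lipschitz_on UNIV (\<lambda>x. 0::real)"
    using lipschitz_on_nonneg[OF f] by (intro lipschitz_onI) auto
  then show ?thesis using True by blast
next
  case False
  note L = lipschitz_on_nonneg[OF f]
  \<comment> \<open>McShane's extension: every value \<open>f y\<close> spreads as a cone of slope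
    \<open>L\<close>. The bound \<open>lower\<close>, for any fixed \<open>b\<close> in
    \<open>S\<close>, keeps the infimum finite.\<close>
  define g where "g x = (INF y\<in>S. f y + L * dist x y)" for x
  have lower: "f b - L * dist x b \<le> f y + L * dist x y" if "y \<in> S" "b \<in> S" for x y b
  proof -
    have "f b - f y \<le> L * dist b y"
      using lipschitz_onD[OF f that(2) that(1)] by (simp add: dist_real_def)
    also have "\<dots> \<le> L * (dist x b + dist x y)"
      using L by (intro mult_left_mono) (metis dist_commute dist_triangle)+
    finally show ?thesis by (simp add: algebra_simps)
  qed
  have bdd: "bdd_below ((\<lambda>y. f y + L * dist x y) ` S)" for x
    using False lower by (meson bdd_belowI2 ex_in_conv)
  have *: "g x \<le> g x' + L * dist x x'" for x x'
  proof -
    have "g x - L * dist x x' \<le> g x'"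
      unfolding g_def[of x']
    proof (rule cINF_greatest[OF False])
      fix y assume y: "y \<in> S"
      have "g x \<le> f y + L * dist x y"
        unfolding g_def using bdd y by (rule cINF_lower)
      also have "\<dots> \<le> f y + L * (dist x x' + dist x' y)"
        using L dist_triangle[of x y x'] by (simp add: mult_left_mono)
      finally show "g x - L * dist x x' \<le> f y + L * dist x' y" by (simp add: algebra_simps)
    qed
    then show ?thesis by simp
  qed
  have "L-lipschitz_on UNIV g"
    using L *[of x x' for x x'] by (intro lipschitz_onI) (auto simp: dist_real_def abs_le_iff, (metis add_le_cancel_right add.commute diff_le_eq dist_commute)+)
  moreover have "g x = f x" if "x \<in> S" for x
  proof (rule antisym)
    show "g x \<le> f x" using cINF_lower[OF bdd[of x] that] by (simp add: g_def)
    show "f x \<le> g x" unfolding g_def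
      using lower[OF _ that, of _ x] by (intro cINF_greatest[OF False]) auto
  qed
  ultimately show ?thesis by blast
qed

lemma C1_lipschitz_Icc:
  fixes f f' :: "real \<Rightarrow> real"
  assumes f: "\<And>x. x \<in> {a..b} \<Longrightarrow> (f has_real_derivative f' x) (at x within {a..b})"
    and c: "continuous_on {a..b} f'"
  shows "\<exists>K\<ge>0. \<forall>x\<in>{a..b}. \<forall>y\<in>{a..b}. \<bar>f x - f y\<bar> \<le> K * \<bar>x - y\<bar>"
proof -
  obtain K where K: "K > 0" "\<And>x. x \<in> {a..b} \<Longrightarrow> norm (f' x) \<le> K"
    using compact_imp_bounded[OF compact_continuous_image[OF c]]
    by (auto simp: bounded_pos)
  have "norm (f x - f y) \<le> K * norm (x - y)" if "x \<in> {a..b}" "y \<in> {a..b}" for x y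
    using that K by (intro field_differentiable_bound[of "{a..b}" f f' K x y] f) auto
  then show ?thesis using K by (intro exI[of _ K]) auto
qed

text \<open>Both difference quotients are interpolated by the segments from the two points to the common
  endpoint; this needs only a Lipschitz derivative.\<close>
lemma slope_lipschitz:
  fixes f f' :: "real \<Rightarrow> real"
  assumes f: "\<And>x. x \<in> {a..b} \<Longrightarrow> (f has_real_derivative f' x) (at x within {a..b})"
    and K: "\<And>x y. x \<in> {a..b} \<Longrightarrow> y \<in> {a..b} \<Longrightarrow> \<bar>f' x - f' y\<bar> \<le> K * \<bar>x - y\<bar>" "0 \<le> K"
    and xy: "x \<in> {a..<b}" "y \<in> {a..<b}"
  shows "\<bar>(f b - f x) / (b - x) - (f b - f y) / (b - y)\<bar> \<le> K * \<bar>x - y\<bar>"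
proof -
  define s where "s u t = u + t * (b - u)" for u t :: real
  have s: "s u t \<in> {a..b}" if "u \<in> {a..<b}" "t \<in> {0..1}" for u t
  proof -
    have "t * (b - u) \<le> 1 * (b - u)" using that by (intro mult_right_mono) auto
    then have "s u t \<le> b" by (simp add: s_def)
    moreover have "0 \<le> t * (b - u)" using that by simp
    then have "a \<le> s u t" using that unfolding s_def by (simp add: add_increasing2)
    ultimately show ?thesis by simp
  qed
  have ds: "((\<lambda>t. f (s u t) / (b - u)) has_real_derivative f' (s u t)) (at t within {0..1})"
    if "u \<in> {a..<b}" "t \<in> {0..1}" for u t
  proof -
    have "(s u has_real_derivative (b - u)) (at t within {0..1})"
      unfolding s_def by (auto intro!: derivative_eq_intros)
    moreover have "(f has_real_derivative f' (s u t)) (at (s u t) within s u ` {0..1})"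
      using f[OF s[OF that]] by (rule has_field_derivative_subset) (use s that in auto)
    ultimately have "(f \<circ> s u has_real_derivative f' (s u t) * (b - u)) (at t within {0..1})"
      by (intro DERIV_image_chain)
    from DERIV_cdivide[OF this, of "b - u"] show ?thesis using that by (simp add: o_def)
  qed
  let ?g = "\<lambda>t. f (s x t) / (b - x) - f (s y t) / (b - y)"
  have "norm (?g 1 - ?g 0) \<le> (K * \<bar>x - y\<bar>) * norm (1 - 0 :: real)"
  proof (rule field_differentiable_bound[of "{0..1}" ?g "\<lambda>t. f' (s x t) - f' (s y t)"])
    fix t :: real assume t: "t \<in> {0..1}"
    show "(?g has_real_derivative f' (s x t) - f' (s y t)) (at t within {0..1})"
      using t xy by (intro DERIV_diff ds)
    have "\<bar>f' (s x t) - f' (s y t)\<bar> \<le> K * \<bar>s x t - s y t\<bar>"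
      using s t xy by (intro K) auto
    also have "s x t - s y t = (1 - t) * (x - y)" by (simp add: s_def algebra_simps)
    also have "\<bar>(1 - t) * (x - y)\<bar> \<le> 1 * \<bar>x - y\<bar>"
      unfolding abs_mult using t by (intro mult_right_mono) auto
    finally show "norm (f' (s x t) - f' (s y t)) \<le> K * \<bar>x - y\<bar>"
      using K(2) by (simp add: mult_left_mono)
  qed auto
  moreover have "?g 1 - ?g 0 = (f b - f x) / (b - x) - (f b - f y) / (b - y)"
    by (simp add: s_def diff_divide_distrib)
  ultimately show ?thesis by simp
qed

text \<open>Every L1 estimate of two solutions takes this form: \<open>K\<close> everywhere, and an
  extra \<open>K1\<close> on the sector between \<open>p\<close> and \<open>q\<close>. The finite
  set absorbs the discontinuity points, where the values of the solutions are free.\<close>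

lemma integral_le_step:
  fixes f :: "real \<Rightarrow> real"
  assumes S: "finite S" and AB: "A \<le> B" and K: "0 \<le> K" "0 \<le> K1"
    and f: "\<And>x. x \<in> {A..B} - S \<Longrightarrow> f x \<le> K + (if p < x \<and> x < q then K1 else 0)"
  shows "integral {A..B} f \<le> K * (B - A) + K1 * max 0 (q - p)"
proof (cases "f integrable_on {A..B}")
  case False
  \<comment> \<open>The integral of a non-integrable function is 0 by convention, and the right-hand
    side is nonnegative.\<close>
  then show ?thesis using AB K by (simp add: not_integrable_integral)
next
  case True
  let ?J = "{max A p..min B q}"
  let ?g = "\<lambda>x. K + (if x \<in> ?J then K1 else 0)"
  have J: "((\<lambda>x. if x \<in> ?J then K1 else 0) has_integral K1 * max 0 (min B q - max A p)) {A..B}"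
  proof -
    have "((\<lambda>x. K1) has_integral K1 * max 0 (min B q - max A p)) ?J"
      using has_integral_const_real[of K1 "max A p" "min B q"]
      by (cases "max A p \<le> min B q") (simp_all add: mult.commute max_def)
    then show ?thesis
      by (subst has_integral_restrict) auto
  qed
  have g: "(?g has_integral K * (B - A) + K1 * max 0 (min B q - max A p)) {A..B}"
    using has_integral_add[OF has_integral_const_real[of K A B] J] AB by (simp add: mult.commute)
  \<comment> \<open>At the exceptional points the integrand is replaced by the majorant; the
    integral is the same and the comparison now holds everywhere.\<close>
  have "((\<lambda>x. if x \<in> S then ?g x else f x) has_integral integral {A..B} f) {A..B}"
    using S by (rule has_integral_spike_finite[where f = f]) (use True in auto)
  moreover have "(if x \<in> S then ?g x else f x) \<le> ?g x" if "x \<in> {A..B}" for x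
    using f[of x] that K by (cases "x \<in> S"; cases "p < x \<and> x < q") auto
  ultimately have "integral {A..B} f \<le> K * (B - A) + K1 * max 0 (min B q - max A p)"
    using has_integral_le[OF _ g] by blast
  also have "K1 * max 0 (min B q - max A p) \<le> K1 * max 0 (q - p)"
    using K by (intro mult_left_mono) auto
  finally show ?thesis by simp
qed

lemma norm_Pair_diff_le:
  fixes p q :: state
  shows "norm (p - q) \<le> \<bar>fst p - fst q\<bar> + \<bar>snd p - snd q\<bar>"
  using norm_Pair_le[of "fst p - fst q" "snd p - snd q"] by (simp flip: minus_prod_def)

section \<open>Strains and speeds of phase boundaries\<close>

text \<open>A phase boundary of speed \<open>V\<close> between the strain \<open>z\<close> at the wall and \<open>w\<close>, followed by a sound
  wave of speed \<open>c\<close>; \<open>a\<close> is the squared sound speed of the phase of \<open>z\<close>.\<close>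
definition wave :: "real \<Rightarrow> real \<Rightarrow> real \<Rightarrow> real \<Rightarrow> real \<Rightarrow> real \<Rightarrow> bool" where
  "wave a c h z w V \<longleftrightarrow> z * (a + c * V) = h * c * (c + V) \<and>
     h * c * (a - V\<^sup>2) = w * (c - V) * (a + c * V)"

text \<open>Multiplying the first equation by \<open>a - V\<^sup>2\<close> produces the left side of
  the second. What remains is the jump condition at the phase boundary alone, free of
  \<open>h\<close>.\<close>

lemma wave_ratio:
  assumes "wave a c h z w V" "a + c * V \<noteq> 0"
  shows "z * (a - V\<^sup>2) = w * (c\<^sup>2 - V\<^sup>2)"
proof -
  have "(a + c * V) * (z * (a - V\<^sup>2)) = (a + c * V) * (w * (c\<^sup>2 - V\<^sup>2))"
    using assms unfolding wave_def power2_eq_square by algebra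
  then show ?thesis using assms(2) by simp
qed

text \<open>Product of the two equations. It isolates \<open>z * w\<close>, the only combination of
  the strains that enters the kinetic relation.\<close>

lemma wave_square:
  assumes "wave a c h z w V"
  shows "h\<^sup>2 * (c\<^sup>2 * (c + V) * (a - V\<^sup>2)) = z * w * ((c - V) * (a + c * V)\<^sup>2)"
  using assms unfolding wave_def power2_eq_square by algebra

text \<open>\<open>F\<close> is the factor in \<open>h\<^sup>2 = z * w * F V\<close>. In the
  derivative, up to sign, the numerator is smallest at 0, while in the denominator
  \<open>c + t\<close> is at most \<open>2 * c\<close> and \<open>a - t\<^sup>2\<close> at most
  \<open>a\<close>; this is the origin of the slope
  \<open>(a - c\<^sup>2) / (2 * c ^ 3)\<close>.\<close>

lemma decreasing_profile:
  fixes a c :: real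
  defines "F \<equiv> \<lambda>x. (c - x) * (a + c * x)\<^sup>2 / (c\<^sup>2 * (c + x) * (a - x\<^sup>2))"
  assumes c: "0 < c" "c\<^sup>2 < a" and xy: "0 \<le> x" "x \<le> y" "y \<le> c"
  shows "(a - c\<^sup>2) / (2 * c ^ 3) * (y - x) \<le> F x - F y"
proof -
  let ?m = "(a - c\<^sup>2) / (2 * c ^ 3)"
  have "(\<lambda>t. - F t - ?m * t) x \<le> (\<lambda>t. - F t - ?m * t) y"
  proof (rule DERIV_nonneg_imp_nondecreasing[OF xy(2)])
    fix t assume t: "x \<le> t" "t \<le> y"
    then have t0: "0 \<le> t" "t \<le> c" using xy by auto
    have t2: "t\<^sup>2 \<le> c\<^sup>2" using t0 by (simp add: power_mono)
    have pos: "0 < c + t" "0 < a - t\<^sup>2" using t0 c t2 by linarith+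
    let ?Q = "c\<^sup>2 * (c + t) * (a - t\<^sup>2)"
    let ?F' = "((- (a + c * t)\<^sup>2 + (c - t) * (2 * c * (a + c * t))) * ?Q -
        (c - t) * (a + c * t)\<^sup>2 * (c\<^sup>2 * ((a - t\<^sup>2) - 2 * t * (c + t)))) / ?Q\<^sup>2"
    have "DERIV (\<lambda>x. (c - x) * (a + c * x)\<^sup>2) t :> - (a + c * t)\<^sup>2 + (c - t) * (2 * c * (a + c * t))"
      by (auto intro!: derivative_eq_intros)
    moreover have "DERIV (\<lambda>x. c\<^sup>2 * (c + x) * (a - x\<^sup>2)) t :> c\<^sup>2 * ((a - t\<^sup>2) - 2 * t * (c + t))"
      by (auto intro!: derivative_eq_intros simp: algebra_simps)
    moreover have "?Q \<noteq> 0" using pos c by simp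
    ultimately have d: "DERIV F t :> ?F'"
      unfolding F_def by (auto dest: DERIV_quotient simp: power2_eq_square mult_ac)
    \<comment> \<open>Expanding the numerator exposes the factor \<open>a - c\<^sup>2\<close>, which
      fixes the sign.\<close>
    have "?F' = - (2 * (a - c\<^sup>2) * (c * a + t ^ 3) * (a + c * t) * c\<^sup>2) / ?Q\<^sup>2"
      by (rule arg_cong[where f = "\<lambda>s. s / ?Q\<^sup>2"]) algebra
    also have "\<dots> = - (2 * (a - c\<^sup>2) * ((c * a + t ^ 3) * (a + c * t))) / (c * (c + t) * (a - t\<^sup>2))\<^sup>2"
      using c by (simp add: power_mult_distrib power2_eq_square mult_ac)
    finally have F': "?F' = - (2 * (a - c\<^sup>2) * ((c * a + t ^ 3) * (a + c * t))) / (c * (c + t) * (a - t\<^sup>2))\<^sup>2" .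
    have a: "0 < a" using c by (meson less_trans zero_less_power)
    have "?m = 2 * (a - c\<^sup>2) * (c * a * a) / (c * (2 * c) * a)\<^sup>2"
      using a c by (simp add: field_simps power2_eq_square power3_eq_cube)
    also have "\<dots> \<le> 2 * (a - c\<^sup>2) * ((c * a + t ^ 3) * (a + c * t)) / (c * (c + t) * (a - t\<^sup>2))\<^sup>2"
    proof (rule frac_le)
      show "0 < (c * (c + t) * (a - t\<^sup>2))\<^sup>2" using pos c by simp
      show "(c * (c + t) * (a - t\<^sup>2))\<^sup>2 \<le> (c * (2 * c) * a)\<^sup>2"
        using pos c t0 a by (intro power_mono mult_mono) auto
      show "2 * (a - c\<^sup>2) * (c * a * a) \<le> 2 * (a - c\<^sup>2) * ((c * a + t ^ 3) * (a + c * t))"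
        using a c t0 by (intro mult_left_mono mult_mono) auto
      show "0 \<le> 2 * (a - c\<^sup>2) * ((c * a + t ^ 3) * (a + c * t))"
        using a c t0 by (intro mult_nonneg_nonneg) auto
    qed
    finally have "?m \<le> - ?F'" unfolding F' by simp
    moreover have "DERIV (\<lambda>t. - F t - ?m * t) t :> - ?F' - ?m"
      by (rule DERIV_diff[OF DERIV_minus[OF d] DERIV_cmult_Id])
    ultimately show "\<exists>y. DERIV (\<lambda>t. - F t - ?m * t) t :> y \<and> 0 \<le> y" by force
  qed
  then show ?thesis by (simp add: right_diff_distrib)
qed

text \<open>Up to the constant \<open>2 * ln c\<close>, \<open>S\<close> is the logarithm of the
  profile \<open>F\<close> above. For \<open>a < c\<^sup>2\<close> the profile increases and has a
  pole where \<open>x\<^sup>2 = a\<close>; its relative growth is what an unbounded \<open>h\<close>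
  calls for. The slope comes from the value \<open>c * a\<close> of the variable numerator factor at
  0 and the bounds \<open>c\<^sup>2\<close>, \<open>a + c\<^sup>2\<close> and \<open>a\<close> for
  the factors of the denominator.\<close>

lemma log_increasing_profile:
  fixes a c :: real
  defines "S \<equiv> \<lambda>x. ln (c - x) + 2 * ln (a + c * x) - ln (c + x) - ln (a - x\<^sup>2)"
  assumes c: "0 < c" "0 < a" "a < c\<^sup>2" and xy: "0 \<le> x" "x \<le> y" "y\<^sup>2 < a"
  shows "2 * ((c\<^sup>2 - a) / (c * (a + c\<^sup>2))) * (y - x) \<le> S y - S x"
proof -
  let ?m = "2 * ((c\<^sup>2 - a) / (c * (a + c\<^sup>2)))"
  have "(\<lambda>t. S t - ?m * t) x \<le> (\<lambda>t. S t - ?m * t) y"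
  proof (rule DERIV_nonneg_imp_nondecreasing[OF xy(2)])
    fix t assume t: "x \<le> t" "t \<le> y"
    then have t0: "0 \<le> t" using xy by auto
    have "t\<^sup>2 \<le> y\<^sup>2" using t t0 by (simp add: power_mono)
    then have t2: "t\<^sup>2 < a" using xy by simp
    then have "t < c" using c power2_less_imp_less[of t c] by linarith
    then have pos: "0 < c + t" "0 < a - t\<^sup>2" "0 < c - t" "0 < a + c * t" using t0 c t2
      by (auto intro: add_pos_nonneg)
    let ?S' = "- 1 / (c - t) + 2 * (c / (a + c * t)) - 1 / (c + t) + 2 * t / (a - t\<^sup>2)"
    have d1: "DERIV (\<lambda>x. ln (c - x)) t :> - 1 / (c - t)"
      and d2: "DERIV (\<lambda>x. ln (a + c * x)) t :> c / (a + c * t)"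
      and d3: "DERIV (\<lambda>x. ln (c + x)) t :> 1 / (c + t)"
      and d4: "DERIV (\<lambda>x. ln (a - x\<^sup>2)) t :> - (2 * t) / (a - t\<^sup>2)"
      using pos by (auto intro!: derivative_eq_intros)
    have d: "DERIV S t :> ?S'"
      unfolding S_def
      using DERIV_diff[OF DERIV_diff[OF DERIV_add[OF d1 DERIV_cmult[OF d2, of 2]] d3] d4] by simp
    let ?Q = "(c - t) * (c + t) * (a + c * t) * (a - t\<^sup>2)"
    have "?S' * ?Q = 2 * (c\<^sup>2 - a) * (c * a + t ^ 3)"
    proof -
      have "(- 1 / p + 2 * (c / r) - 1 / q + 2 * t / e) * (p * q * r * e)
          = - (q * r * e) + 2 * c * (p * q * e) - p * r * e + 2 * t * (p * q * r)"
        if "p \<noteq> 0" "q \<noteq> 0" "r \<noteq> 0" "e \<noteq> 0" for p q r e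
        using that by (simp add: field_simps)
      from this[of "c - t" "c + t" "a + c * t" "a - t\<^sup>2"]
      have "?S' * ?Q = - ((c + t) * (a + c * t) * (a - t\<^sup>2)) + 2 * c * ((c - t) * (c + t) * (a - t\<^sup>2))
         - (c - t) * (a + c * t) * (a - t\<^sup>2) + 2 * t * ((c - t) * (c + t) * (a + c * t))"
        using pos by fastforce
      also have "\<dots> = 2 * (c\<^sup>2 - a) * (c * a + t ^ 3)" by algebra
      finally show ?thesis .
    qed
    then have S': "?S' = 2 * (c\<^sup>2 - a) * (c * a + t ^ 3) / ?Q"
      using pos by (simp add: eq_divide_eq)
    have "?m = 2 * (c\<^sup>2 - a) * (c * a) / (c\<^sup>2 * (a + c\<^sup>2) * a)"
    proof -
      have "2 * (d / (c * s)) = 2 * d * (c * a) / (c\<^sup>2 * s * a)" if "s \<noteq> 0" for d s :: real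
        using that c by (simp add: power2_eq_square)
      moreover have "a + c\<^sup>2 \<noteq> 0" using c by linarith
      ultimately show ?thesis by blast
    qed
    also have "\<dots> \<le> 2 * (c\<^sup>2 - a) * (c * a + t ^ 3) / ?Q"
    proof (rule frac_le)
      show "0 < ?Q" using pos by simp
      have "(c - t) * (c + t) \<le> c\<^sup>2" by (simp add: algebra_simps power2_eq_square)
      moreover have "c * t \<le> c\<^sup>2" using \<open>t < c\<close> c by (simp add: power2_eq_square)
      ultimately show "?Q \<le> c\<^sup>2 * (a + c\<^sup>2) * a"
        using pos c by (intro mult_mono) auto
      show "2 * (c\<^sup>2 - a) * (c * a) \<le> 2 * (c\<^sup>2 - a) * (c * a + t ^ 3)"
        using c t0 by (intro mult_left_mono) auto
      show "0 \<le> 2 * (c\<^sup>2 - a) * (c * a + t ^ 3)"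
        using c t0 by (intro mult_nonneg_nonneg) auto
    qed
    finally have "?m \<le> ?S'" unfolding S' by simp
    moreover have "DERIV (\<lambda>t. S t - ?m * t) t :> ?S' - ?m"
      by (rule DERIV_diff[OF d DERIV_cmult_Id])
    ultimately show "\<exists>y. DERIV (\<lambda>t. S t - ?m * t) t :> y \<and> 0 \<le> y" by force
  qed
  then show ?thesis by (simp add: right_diff_distrib)
qed

text \<open>A faster boundary lowers \<open>F\<close> and does not raise \<open>z * w\<close>, so it
  lowers \<open>h\<close>. The difference of the squares of \<open>h1\<close> and \<open>h2\<close>
  is at least \<open>z1 * w1\<close> times the drop of \<open>F\<close>, and since \<open>z1\<close>
  is itself a multiple of \<open>h1\<close>, the factor \<open>h1\<close> cancels: the constant does
  not degenerate as \<open>h1\<close> tends to 0.\<close>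

lemma slow_wave_speed:
  assumes c: "0 < c" "c\<^sup>2 < a" and b: "0 < b"
  shows "\<exists>K\<ge>0. \<forall>h1 z1 w1 V1 h2 z2 w2 V2.
    wave a c h1 z1 w1 V1 \<and> wave a c h2 z2 w2 V2 \<and> 0 \<le> V1 \<and> V1 < V2 \<and> V2 \<le> c \<and>
    b \<le> w1 \<and> 0 \<le> h1 \<and> 0 \<le> h2 \<and> z2 * w2 \<le> z1 * w1 \<longrightarrow> V2 - V1 \<le> K * (h1 - h2)"
proof -
  have a: "0 < a" using c by (meson less_trans zero_less_power)
  define m where "m = (a - c\<^sup>2) / (2 * c ^ 3)"
  define q where "q = c\<^sup>2 / (a + c\<^sup>2)"
  have m: "0 < m" using c by (simp add: m_def)
  have q: "0 < q" using c a by (simp add: q_def add_pos_pos)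
  have "V2 - V1 \<le> 2 / (b * q * m) * (h1 - h2)"
    if w: "wave a c h1 z1 w1 V1" "wave a c h2 z2 w2 V2" and V: "0 \<le> V1" "V1 < V2" "V2 \<le> c"
      and h: "b \<le> w1" "0 \<le> h1" "0 \<le> h2" "z2 * w2 \<le> z1 * w1" for h1 z1 w1 V1 h2 z2 w2 V2
  proof -
    define F where "F = (\<lambda>x. (c - x) * (a + c * x)\<^sup>2 / (c\<^sup>2 * (c + x) * (a - x\<^sup>2)))"
    have den: "0 < c\<^sup>2 * (c + x) * (a - x\<^sup>2)" if "0 \<le> x" "x \<le> c" for x
    proof -
      have "x\<^sup>2 \<le> c\<^sup>2" using that by (intro power_mono) auto
      then have "0 < a - x\<^sup>2" using c by linarith
      then show ?thesis using c that by (intro mult_pos_pos) auto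
    qed
    have sq: "h\<^sup>2 = z * w * F x" if "wave a c h z w x" "0 \<le> x" "x \<le> c" for h z w x
      using wave_square[OF that(1)] den[OF that(2,3)] by (simp add: F_def field_simps)
    have F2: "0 \<le> F V2" using den[of V2] V a c by (simp add: F_def)
    have z1: "z1 = h1 * (c * (c + V1) / (a + c * V1))"
      using w(1) a c V by (simp add: wave_def field_simps add_pos_nonneg[THEN less_imp_neq[symmetric]])
    \<comment> \<open>Numerator at its minimum, \<open>V1 = 0\<close>, and denominator at its
      maximum, \<open>V1 = c\<close>.\<close>
    have q1: "q \<le> c * (c + V1) / (a + c * V1)"
      unfolding q_def using a c V
      by (intro frac_le) (auto simp: power2_eq_square add_pos_nonneg)
    have "h1 \<noteq> 0"
    proof
      assume "h1 = 0"
      then have "w1 * (c - V1) * (a + c * V1) = 0" using w(1) by (simp add: wave_def)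
      then show False using h b V a c by (auto simp: add_pos_nonneg[THEN less_imp_neq[symmetric]])
    qed
    then have h1: "0 < h1" using h by simp
    have "h1 * (b * q) \<le> h1 * (w1 * (c * (c + V1) / (a + c * V1)))"
      using h1 q q1 b h by (intro mult_left_mono mult_mono) auto
    also have "\<dots> = z1 * w1" by (simp add: z1)
    finally have G: "h1 * (b * q) \<le> z1 * w1" .
    have "m * (V2 - V1) \<le> F V1 - F V2"
      using decreasing_profile[OF c V(1) less_imp_le[OF V(2)] V(3)] unfolding F_def m_def .
    then have "h1 * (b * q) * (m * (V2 - V1)) \<le> z1 * w1 * (F V1 - F V2)"
      using h1 b q m V by (intro mult_mono[OF G]) (auto intro: order_trans[OF _ G])
    also have "\<dots> \<le> z1 * w1 * F V1 - z2 * w2 * F V2"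
      using mult_right_mono[OF h(4) F2] by (simp add: right_diff_distrib)
    also have "\<dots> = (h1 + h2) * (h1 - h2)"
      using sq[OF w(1)] sq[OF w(2)] V by (simp add: power2_eq_square algebra_simps)
    finally have *: "h1 * (b * q) * (m * (V2 - V1)) \<le> (h1 + h2) * (h1 - h2)" .
    have "0 < h1 * (b * q) * (m * (V2 - V1))" using h1 b q m V by simp
    then have "0 < (h1 + h2) * (h1 - h2)" using * by simp
    then have h12: "h2 < h1" using h h1 by (simp add: zero_less_mult_iff)
    \<comment> \<open>The order \<open>h2 < h1\<close> produces the factor \<open>h1\<close> that
      cancels against the lower bound \<open>G\<close>.\<close>
    then have "(h1 + h2) * (h1 - h2) \<le> 2 * h1 * (h1 - h2)" by (intro mult_right_mono) auto
    then have "h1 * ((b * q) * (m * (V2 - V1))) \<le> h1 * (2 * (h1 - h2))" using * by (simp add: algebra_simps)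
    then have "(b * q * m) * (V2 - V1) \<le> 2 * (h1 - h2)" using h1 by (simp add: mult.assoc)
    then show ?thesis using b q m by (simp add: field_simps)
  qed
  then show ?thesis using b q m by (intro exI[of _ "2 / (b * q * m)"]) auto
qed

text \<open>Here \<open>h\<close> is unbounded; thanks to the factor \<open>h1\<close> the strains, which are \<open>h\<close> times Lipschitz
  functions of \<open>V\<close>, are still Lipschitz in \<open>h\<close>.\<close>
lemma fast_wave_speed:
  assumes c: "0 < c" "0 < a" "a < c\<^sup>2"
  shows "\<exists>K\<ge>0. \<forall>h1 z1 w1 V1 h2 z2 w2 V2.
    wave a c h1 z1 w1 V1 \<and> wave a c h2 z2 w2 V2 \<and> 0 \<le> V1 \<and> V1 \<le> V2 \<and> V2\<^sup>2 < a \<and>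
    0 < h1 \<and> 0 < h2 \<and> 0 < z1 * w1 \<and> z1 * w1 \<le> z2 * w2 \<longrightarrow> h1 * (V2 - V1) \<le> K * (h2 - h1)"
proof -
  define m where "m = (c\<^sup>2 - a) / (c * (a + c\<^sup>2))"
  have m: "0 < m" using c by (auto simp: m_def intro!: divide_pos_pos mult_pos_pos add_pos_pos)
  have "h1 * (V2 - V1) \<le> 1 / m * (h2 - h1)"
    if w: "wave a c h1 z1 w1 V1" "wave a c h2 z2 w2 V2" and V: "0 \<le> V1" "V1 \<le> V2" "V2\<^sup>2 < a"
      and h: "0 < h1" "0 < h2" "0 < z1 * w1" "z1 * w1 \<le> z2 * w2" for h1 z1 w1 V1 h2 z2 w2 V2
  proof -
    define S where "S = (\<lambda>x. ln (c - x) + 2 * ln (a + c * x) - ln (c + x) - ln (a - x\<^sup>2))"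
    have l: "2 * ln h = ln (z * w) + S x - 2 * ln c"
      if "wave a c h z w x" "0 \<le> x" "x\<^sup>2 < a" "0 < h" "0 < z * w" for h z w x
    proof -
      have "x < c" using that c power2_less_imp_less[of x c] by linarith
      then have p: "0 < c - x" "0 < c + x" "0 < a - x\<^sup>2" "0 < a + c * x" using that c
        by (auto intro: add_pos_nonneg)
      have "ln (h\<^sup>2 * (c\<^sup>2 * (c + x) * (a - x\<^sup>2))) = ln ((z * w) * ((c - x) * (a + c * x)\<^sup>2))"
        using wave_square[OF that(1)] by simp
      moreover have "ln (h\<^sup>2 * (c\<^sup>2 * (c + x) * (a - x\<^sup>2))) = 2 * ln h + (2 * ln c + ln (c + x) + ln (a - x\<^sup>2))"
        using that p c by (simp add: ln_mult_pos ln_realpow)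
      moreover have "ln ((z * w) * ((c - x) * (a + c * x)\<^sup>2)) = ln (z * w) + (ln (c - x) + 2 * ln (a + c * x))"
        using that(5) p c by (subst ln_mult_pos) (simp_all add: ln_mult_pos ln_realpow)
      ultimately show ?thesis by (simp add: S_def)
    qed
    have V1: "V1\<^sup>2 < a" using power_mono[OF V(2,1), of 2] V(3) by simp
    have "ln (z1 * w1) \<le> ln (z2 * w2)" using h by (intro ln_mono) auto
    moreover have "2 * (m * (V2 - V1)) \<le> S V2 - S V1"
      using log_increasing_profile[OF c V] unfolding S_def m_def mult.assoc .
    ultimately have "m * (V2 - V1) \<le> ln h2 - ln h1"
      using l[OF w(1) V(1) V1 h(1) h(3)] l[OF w(2) _ V(3) h(2)] V h by linarith
    also have "\<dots> = ln (h2 / h1)" using h by (simp add: ln_div)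
    \<comment> \<open>\<open>ln x \<le> x - 1\<close> turns the gap of the logarithms back into
      \<open>h2 - h1\<close> and leaves the weight \<open>h1\<close> on the speeds.\<close>
    also have "\<dots> \<le> h2 / h1 - 1" using h by (intro ln_le_minus_one) auto
    finally have "h1 * (m * (V2 - V1)) \<le> h1 * (h2 / h1 - 1)" using h by (intro mult_left_mono) auto
    also have "\<dots> = h2 - h1" using h by (simp add: field_simps)
    finally show ?thesis using m by (simp add: field_simps)
  qed
  then show ?thesis using m by (intro exI[of _ "1 / m"]) auto
qed

section \<open>Reduction of the jump conditions\<close>

text \<open>Datum in the high-strain phase, low-strain phase at the wall. Here \<open>h\<close> is
  confined to a bounded interval, but the sonic case \<open>V = c3 M\<close> is included; there the
  second equation of \<open>wave\<close> no longer involves \<open>w\<close> and forces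
  \<open>h = 0\<close>.\<close>

definition slow_wave :: "bar \<Rightarrow> real \<Rightarrow> real \<Rightarrow> real \<Rightarrow> real \<Rightarrow> bool" where
  "slow_wave M h z w V \<longleftrightarrow> wave (k1 M) (c3 M) h z w V \<and> 0 \<le> V \<and> V \<le> c3 M \<and>
     wm M \<le> w \<and> 0 \<le> h \<and> h < wmcr M \<and> 0 \<le> z \<and> z \<le> wM M \<and>
     phi_rel M V ((k1 M - k3 M) / 2 * (wM M * wm M - z * w))"

text \<open>Datum in the low-strain phase. Positive speed puts \<open>- V\<close> strictly between
  \<open>- c3 M\<close> and 0, where the kinetic relation is single-valued; \<open>h\<close> has no
  upper bound.\<close>

definition fast_wave :: "bar \<Rightarrow> real \<Rightarrow> real \<Rightarrow> real \<Rightarrow> real \<Rightarrow> bool" where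
  "fast_wave M h z w V \<longleftrightarrow> wave (k3 M) (c1 M) h z w V \<and> 0 < V \<and> V < c3 M \<and>
     0 < w \<and> w \<le> wM M \<and> wm M \<le> z \<and> wMcr M < h \<and>
     phi M (- V) = (k1 M - k3 M) / 2 * (wM M * wm M - z * w)"

lemma H1_iff: "u \<in> H1 M \<longleftrightarrow> - 1 < snd u \<and> snd u \<le> wM M"
  by (cases u) (simp add: H1_def)

lemma H3_iff: "u \<in> H3 M \<longleftrightarrow> wm M \<le> snd u"
  by (cases u) (simp add: H3_def)

locale bar_model =
  fixes M :: bar
  assumes admissible: "admissible_bar M"
begin

lemma k_pos: "0 < k3 M" "k3 M < k1 M" "0 < k1 M"
  using admissible by (auto simp: admissible_bar_def)

lemma strain_pos: "0 < wM M" "wM M < wm M" "0 < wm M"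
  using admissible by (auto simp: admissible_bar_def)

lemma c_sq: "(c1 M)\<^sup>2 = k1 M" "(c3 M)\<^sup>2 = k3 M"
  using k_pos by (simp_all add: c1_def c3_def)

lemma c_pos: "0 < c3 M" "c3 M < c1 M" "0 < c1 M" "(c3 M)\<^sup>2 < k1 M" "k3 M < (c1 M)\<^sup>2"
  unfolding c_sq using k_pos by (simp_all add: c1_def c3_def)

lemma crit: "0 < wMcr M" "wMcr M \<le> wM M" "wm M \<le> wmcr M"
proof -
  have "0 < sigma0 M" unfolding sigma0_def using c_pos strain_pos by simp
  then have "0 < sigma0 M / k1 M" using k_pos by simp
  then show "0 < wMcr M" "wMcr M \<le> wM M" "wm M \<le> wmcr M"
    using admissible by (auto simp: admissible_bar_def)
qed

lemma dissipation: "dissipation_function M"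
  using admissible by (simp add: admissible_bar_def)

lemma phi_mono: "- c3 M < x \<Longrightarrow> x \<le> y \<Longrightarrow> y \<le> c3 M \<Longrightarrow> phi M x \<le> phi M y"
proof -
  assume *: "- c3 M < x" "x \<le> y" "y \<le> c3 M"
  have "mono_on {- c3 M<..c3 M} (phi M)"
    using dissipation unfolding dissipation_function_def by blast
  from mono_onD[OF this, of x y] show ?thesis using * by simp
qed

lemma phi_nonpos: "- c3 M < x \<Longrightarrow> x \<le> 0 \<Longrightarrow> phi M x \<le> 0"
  using dissipation unfolding dissipation_function_def by simp

text \<open>At \<open>V1 = 0\<close> the value \<open>y1\<close> is only known to be at most the
  right limit of \<open>phi M\<close> at 0; monotonicity keeps this limit below
  \<open>phi M V2\<close>.\<close>

lemma phi_rel_mono: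
  assumes "phi_rel M V1 y1" "phi_rel M V2 y2" "0 \<le> V1" "V1 < V2"
  shows "y1 \<le> y2"
proof (cases "V1 = 0")
  case True
  obtain l where l: "(phi M \<longlongrightarrow> l) (at_right 0)"
    using dissipation unfolding dissipation_function_def by blast
  have y: "y1 \<le> l" "y2 = phi M V2" "V2 \<le> c3 M"
    using assms True tendsto_Lim[OF _ l] by (auto simp: phi_rel_def)
  have "\<forall>\<^sub>F x in at_right 0. phi M x \<le> phi M V2"
    using eventually_at_right_real[of 0 V2] assms
    by (auto elim!: eventually_mono intro!: phi_mono y simp: True) (use c_pos in linarith)
  from tendsto_upperbound[OF l this] show ?thesis using y by simp
next
  case False
  then show ?thesis using assms phi_mono[of V1 V2] by (auto simp: phi_rel_def)
qed

text \<open>The interval avoids the possible jump at 0 and reaches the sonic speed, up to which the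
  second derivative is continuous. This prepares the difference quotient of \<open>phi M\<close> at
  \<open>c3 M\<close>.\<close>

lemma phi_derivative_lipschitz:
  obtains p K where "0 \<le> K"
    "\<And>x. x \<in> {c3 M / 2..c3 M} \<Longrightarrow> (phi M has_real_derivative p x) (at x within {c3 M / 2..c3 M})"
    "\<And>x y. x \<in> {c3 M / 2..c3 M} \<Longrightarrow> y \<in> {c3 M / 2..c3 M} \<Longrightarrow> \<bar>p x - p y\<bar> \<le> K * \<bar>x - y\<bar>"
proof -
  let ?I = "{- c3 M<..<0} \<union> {0<..c3 M}" and ?J = "{c3 M / 2..c3 M}"
  have J: "?J \<subseteq> ?I" using c_pos by auto
  obtain p1 p2 where p: "\<forall>V\<in>?I. (phi M has_real_derivative p1 V) (at V within ?I)"
    "\<forall>V\<in>?I. (p1 has_real_derivative p2 V) (at V within ?I)" "continuous_on ?I p2"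
    using dissipation unfolding dissipation_function_def Let_def by blast
  have "\<exists>K\<ge>0. \<forall>x\<in>?J. \<forall>y\<in>?J. \<bar>p1 x - p1 y\<bar> \<le> K * \<bar>x - y\<bar>"
    using p J by (intro C1_lipschitz_Icc[of _ _ _ p2])
      (auto intro: has_field_derivative_subset continuous_on_subset)
  then obtain K where "0 \<le> K" "\<And>x y. x \<in> ?J \<Longrightarrow> y \<in> ?J \<Longrightarrow> \<bar>p1 x - p1 y\<bar> \<le> K * \<bar>x - y\<bar>"
    by blast
  then show ?thesis using p J that[of K p1] by (blast intro: has_field_derivative_subset)
qed

text \<open>Differentiability at \<open>c3 M\<close> makes \<open>phi M\<close> left continuous
  there, so its value is the prescribed limit. The kinetic relation thereby becomes
  \<open>phi M (c3 M) - phi M V = (k1 M - k3 M) / 2 * (z * w)\<close>, a difference that vanishes at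
  the sonic speed.\<close>

lemma phi_c3: "phi M (c3 M) = (k1 M - k3 M) / 2 * (wM M * wm M)"
proof -
  let ?J = "{c3 M / 2..c3 M}"
  obtain p K where p: "\<And>x. x \<in> ?J \<Longrightarrow> (phi M has_real_derivative p x) (at x within ?J)"
    using phi_derivative_lipschitz by metis
  have J: "c3 M \<in> ?J" using c_pos by simp
  have "continuous (at (c3 M) within ?J) (phi M)"
    using p[OF J] by (rule DERIV_continuous)
  moreover have "at (c3 M) within ?J = at_left (c3 M)"
    using at_within_Icc_at_left[of "c3 M / 2" "c3 M"] c_pos by simp
  ultimately have "(phi M \<longlongrightarrow> phi M (c3 M)) (at_left (c3 M))"
    by (simp add: continuous_within)
  moreover have "(phi M \<longlongrightarrow> psi_upper M (c3 M)) (at_left (c3 M))"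
    using dissipation unfolding dissipation_function_def by blast
  ultimately have "phi M (c3 M) = psi_upper M (c3 M)"
    by (rule tendsto_unique[rotated]) simp
  then show ?thesis by (simp add: psi_upper_def c_sq)
qed

lemma sigma_low: "w \<le> wM M \<Longrightarrow> sigma M w = k1 M * w"
  by (simp add: sigma_def)

lemma sigma_high: "wm M \<le> w \<Longrightarrow> sigma M w = k3 M * w"
  using strain_pos by (simp add: sigma_def)

lemma H_disjoint: "u \<in> H1 M \<Longrightarrow> u \<notin> H3 M"
  using strain_pos by (auto simp: H1_iff H3_iff)

lemma outer_speed_simps: "u \<in> H3 M \<Longrightarrow> outer_speed M u = c3 M" "u \<in> H1 M \<Longrightarrow> outer_speed M u = c1 M"
  using H_disjoint by (auto simp: outer_speed_def)

text \<open>The domain of \<open>phi M\<close> yields \<open>V \<le> c3 M\<close>, which makes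
  \<open>k1 M - V\<^sup>2\<close> positive and allows the cancellations. Signs then propagate:
  \<open>e1\<close> gives \<open>h\<close> nonnegative, and \<open>e3\<close> does the same for the
  wall strain.\<close>

lemma slow_wave_of_states:
  assumes p: "phase_boundary_states M u0 um up V" and u0: "u0 \<in> H3 M"
  shows "slow_wave M (h0 M u0) (snd um) (snd up) V" "fst um = 0"
    "fst up = c3 M * (h0 M u0 - snd up)"
proof -
  let ?c = "c3 M" and ?a = "k1 M" and ?h = "h0 M u0"
  have n: "u0 \<notin> H1 M" using u0 H_disjoint by blast
  have um: "fst um = 0" "um \<in> H1 M" and up: "up \<in> H3 M" and V: "0 \<le> V"
    and rh: "RH M V um up" "RH M ?c up u0" and kin: "kinetic M V um up" and nuc: "?h < wmcr M"
    using p u0 n by (auto simp: phase_boundary_states_def outer_speed_simps nucleates_def)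
  show "fst um = 0" by fact
  have strain: "- 1 < snd um" "snd um \<le> wM M" "wm M \<le> snd up" "wm M \<le> snd u0"
    using um up u0 by (auto simp: H1_iff H3_iff)
  have "up \<notin> H1 M" using up H_disjoint by blast
  then have phi: "phi_rel M V ((k1 M - k3 M) / 2 * (wM M * wm M - snd um * snd up))"
    using kin by (auto simp: kinetic_def Let_def)
  then have V: "0 \<le> V" "V \<le> ?c" using V by (auto simp: phi_rel_def)
  have h: "?h * ?c = snd u0 * ?c + fst u0"
    using c_pos by (simp add: h0_def outer_speed_simps u0 field_simps)
  have r: "V * (snd up - snd um) + fst up = 0" "V * fst up + k3 M * snd up - ?a * snd um = 0"
    "?c * (snd u0 - snd up) + fst u0 - fst up = 0"
    using rh um strain by (auto simp: RH_def sigma_low sigma_high)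
  show up': "fst up = ?c * (?h - snd up)" using r(3) h by (simp add: algebra_simps)
  have V2: "V\<^sup>2 \<le> ?c\<^sup>2" using V by (intro power_mono) auto
  then have d: "0 < ?a - V\<^sup>2" using c_pos by linarith
  have d: "0 < ?a - V\<^sup>2" "0 < ?a + ?c * V" "0 \<le> ?c * V" using d c_pos V k_pos
    by (auto intro: add_pos_nonneg)
  have e1: "?h * ?c * (?a - V\<^sup>2) = snd up * (?c - V) * (?a + ?c * V)"
    using r(1,2) up' c_sq(2) by algebra
  have e2: "(?a - V\<^sup>2) * snd um = (k3 M - V\<^sup>2) * snd up" using r(1,2) by algebra
  have "(?a - V\<^sup>2) * (snd um * (?a + ?c * V)) = (?a - V\<^sup>2) * (?h * ?c * (?c + V))"
    using e1 e2 c_sq(2) by algebra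
  then have e3: "snd um * (?a + ?c * V) = ?h * ?c * (?c + V)" using d by simp
  have "0 \<le> ?h * ?c * (?a - V\<^sup>2)"
    unfolding e1 using strain strain_pos V d by (intro mult_nonneg_nonneg) auto
  then have h0: "0 \<le> ?h" using c_pos d by (simp add: zero_le_mult_iff)
  then have "0 \<le> snd um * (?a + ?c * V)" unfolding e3 using c_pos V by simp
  then have "0 \<le> snd um" using d by (simp add: zero_le_mult_iff)
  then show "slow_wave M ?h (snd um) (snd up) V"
    using e1 e3 V strain h0 nuc phi by (simp add: slow_wave_def wave_def)
qed

text \<open>The kinetic relation is taken at \<open>- V\<close>, whose domain yields
  \<open>V < c3 M\<close>, sharper than \<open>V < c1 M\<close>. So \<open>k3 M - V\<^sup>2\<close>
  stays positive, and \<open>e2\<close> carries the sign of the wall strain over to the other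
  one.\<close>

lemma fast_wave_of_states:
  assumes p: "phase_boundary_states M u0 um up V" and u0: "u0 \<in> H1 M"
  shows "fast_wave M (h0 M u0) (snd um) (snd up) V" "fst um = 0"
    "fst up = c1 M * (h0 M u0 - snd up)"
proof -
  let ?c = "c1 M" and ?a = "k3 M" and ?h = "h0 M u0"
  have n: "u0 \<notin> H3 M" using u0 H_disjoint by blast
  have um: "fst um = 0" "um \<in> H3 M" and up: "up \<in> H1 M" and V: "0 < V"
    and rh: "RH M V um up" "RH M ?c up u0" and kin: "kinetic M V um up" and nuc: "wMcr M < ?h"
    using p u0 n by (auto simp: phase_boundary_states_def outer_speed_simps nucleates_def)
  show "fst um = 0" by fact
  have strain: "wm M \<le> snd um" "- 1 < snd up" "snd up \<le> wM M" "snd u0 \<le> wM M"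
    using um up u0 by (auto simp: H1_iff H3_iff)
  have "um \<notin> H1 M" using strain strain_pos by (auto simp: H1_iff)
  then have phi: "phi_rel M (- V) ((k1 M - k3 M) / 2 * (wM M * wm M - snd um * snd up))"
    using kin by (auto simp: kinetic_def Let_def)
  then have V: "0 < V" "V < c3 M" and
    phi: "phi M (- V) = (k1 M - k3 M) / 2 * (wM M * wm M - snd um * snd up)"
    using V by (auto simp: phi_rel_def)
  have h: "?h * ?c = snd u0 * ?c + fst u0"
    using c_pos by (simp add: h0_def outer_speed_simps u0 field_simps)
  have r: "V * (snd up - snd um) + fst up = 0" "V * fst up + k1 M * snd up - ?a * snd um = 0"
    "?c * (snd u0 - snd up) + fst u0 - fst up = 0"
    using rh um strain by (auto simp: RH_def sigma_low sigma_high)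
  show up': "fst up = ?c * (?h - snd up)" using r(3) h by (simp add: algebra_simps)
  have "V\<^sup>2 < (c3 M)\<^sup>2" using V by (intro power_strict_mono) auto
  then have d: "0 < ?a - V\<^sup>2" "0 < k1 M - V\<^sup>2" using c_sq k_pos by auto
  have e1: "?h * ?c * (?a - V\<^sup>2) = snd up * (?c - V) * (?a + ?c * V)"
    using r(1,2) up' c_sq(1) by algebra
  have e2: "(?a - V\<^sup>2) * snd um = (k1 M - V\<^sup>2) * snd up" using r(1,2) by algebra
  have "(?a - V\<^sup>2) * (snd um * (?a + ?c * V)) = (?a - V\<^sup>2) * (?h * ?c * (?c + V))"
    using e1 e2 c_sq(1) by algebra
  then have e3: "snd um * (?a + ?c * V) = ?h * ?c * (?c + V)" using d by simp
  have "0 < (?a - V\<^sup>2) * snd um" using d strain strain_pos by simp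
  then have "0 < snd up" unfolding e2 using d by (simp add: zero_less_mult_iff)
  then show "fast_wave M ?h (snd um) (snd up) V"
    using e1 e3 V strain nuc phi by (simp add: fast_wave_def wave_def)
qed

end

section \<open>Rational factors of the strains as functions of the speed\<close>

lemma quotient_lipschitz_Icc:
  fixes n d :: "real \<Rightarrow> real"
  assumes "\<And>x. x \<in> {a..b} \<Longrightarrow> (n has_real_derivative n' x) (at x)" "continuous_on {a..b} n'"
    and "\<And>x. x \<in> {a..b} \<Longrightarrow> (d has_real_derivative d' x) (at x)" "continuous_on {a..b} d'"
    and d0: "\<And>x. x \<in> {a..b} \<Longrightarrow> d x \<noteq> 0"
  shows "\<exists>K\<ge>0. (\<forall>x\<in>{a..b}. \<bar>n x / d x\<bar> \<le> K) \<and>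
    (\<forall>x\<in>{a..b}. \<forall>y\<in>{a..b}. \<bar>n x / d x - n y / d y\<bar> \<le> K * \<bar>x - y\<bar>)"
proof -
  have c: "continuous_on {a..b} n" "continuous_on {a..b} d"
    using DERIV_isCont[OF assms(1)] DERIV_isCont[OF assms(3)]
    by (simp_all add: continuous_at_imp_continuous_on)
  let ?f' = "\<lambda>x. (n' x * d x - n x * d' x) / (d x * d x)"
  have "\<exists>K\<ge>0. \<forall>x\<in>{a..b}. \<forall>y\<in>{a..b}. \<bar>n x / d x - n y / d y\<bar> \<le> K * \<bar>x - y\<bar>"
  proof (rule C1_lipschitz_Icc[where f' = ?f'])
    show "((\<lambda>x. n x / d x) has_real_derivative ?f' x) (at x within {a..b})" if "x \<in> {a..b}" for x
      using DERIV_divide[OF has_field_derivative_at_within[OF assms(1)[OF that]]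
          has_field_derivative_at_within[OF assms(3)[OF that]] d0[OF that]] .
    show "continuous_on {a..b} ?f'"
      using assms c by (intro continuous_intros) auto
  qed
  then obtain K where K: "0 \<le> K" "\<forall>x\<in>{a..b}. \<forall>y\<in>{a..b}. \<bar>n x / d x - n y / d y\<bar> \<le> K * \<bar>x - y\<bar>"
    by blast
  have "continuous_on {a..b} (\<lambda>x. n x / d x)"
    using d0 c by (intro continuous_intros) auto
  then have "bounded ((\<lambda>x. n x / d x) ` {a..b})"
    by (intro compact_imp_bounded compact_continuous_image) auto
  then obtain B where B: "0 < B" "\<And>x. x \<in> {a..b} \<Longrightarrow> \<bar>n x / d x\<bar> \<le> B"
    by (auto simp: bounded_pos)
  have "\<bar>n x / d x - n y / d y\<bar> \<le> (B + K) * \<bar>x - y\<bar>" if "x \<in> {a..b}" "y \<in> {a..b}" for x y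
    by (rule order_trans[OF K(2)[rule_format, OF that] mult_right_mono]) (use B in auto)
  moreover have "\<bar>n x / d x\<bar> \<le> B + K" if "x \<in> {a..b}" for x
    using B(2)[OF that] K(1) by simp
  ultimately show ?thesis using B(1) K(1) by (intro exI[of _ "B + K"]) auto
qed

text \<open>Solving \<open>wave\<close> for \<open>z\<close> gives \<open>h\<close> times this
  factor, which is regular up to the sonic speed.\<close>

lemma wall_strain_factor_lipschitz:
  fixes a c l u :: real
  assumes "\<And>x. x \<in> {l..u} \<Longrightarrow> a + c * x \<noteq> 0"
  shows "\<exists>K\<ge>0. (\<forall>x\<in>{l..u}. \<bar>c * (c + x) / (a + c * x)\<bar> \<le> K) \<and>
    (\<forall>x\<in>{l..u}. \<forall>y\<in>{l..u}. \<bar>c * (c + x) / (a + c * x) - c * (c + y) / (a + c * y)\<bar> \<le> K * \<bar>x - y\<bar>)"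
  by (rule quotient_lipschitz_Icc[where n' = "\<lambda>x. c" and d' = "\<lambda>x. c"])
    (use assms in \<open>auto intro!: derivative_eq_intros\<close>)

text \<open>Solving \<open>wave\<close> for \<open>w\<close> gives \<open>h\<close> times this
  factor. Its pole at \<open>x = c\<close> is out of reach for fast waves, since
  \<open>V < c3 M < c1 M\<close>, but forces another formula for slow waves near the sonic
  speed.\<close>

lemma front_strain_factor_lipschitz:
  fixes a c l u :: real
  assumes "\<And>x. x \<in> {l..u} \<Longrightarrow> a + c * x \<noteq> 0" "\<And>x. x \<in> {l..u} \<Longrightarrow> c - x \<noteq> 0"
  shows "\<exists>K\<ge>0. (\<forall>x\<in>{l..u}. \<bar>c * (a - x\<^sup>2) / ((c - x) * (a + c * x))\<bar> \<le> K) \<and>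
    (\<forall>x\<in>{l..u}. \<forall>y\<in>{l..u}. \<bar>c * (a - x\<^sup>2) / ((c - x) * (a + c * x)) -
      c * (a - y\<^sup>2) / ((c - y) * (a + c * y))\<bar> \<le> K * \<bar>x - y\<bar>)"
proof (rule quotient_lipschitz_Icc[where n' = "\<lambda>x. - (2 * c * x)" and d' = "\<lambda>x. (c - x) * c - (a + c * x)"])
  show "continuous_on {l..u} (\<lambda>x. - (2 * c * x))" "continuous_on {l..u} (\<lambda>x. (c - x) * c - (a + c * x))"
    by (intro continuous_intros)+
qed (use assms in \<open>auto intro!: derivative_eq_intros\<close>)

text \<open>The regular part of \<open>w / z = (a - V\<^sup>2) / (c\<^sup>2 - V\<^sup>2)\<close>
  once the factor \<open>c - V\<close> is split off.\<close>

lemma strain_ratio_lipschitz: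
  fixes a c l u :: real
  assumes "\<And>x. x \<in> {l..u} \<Longrightarrow> c + x \<noteq> 0"
  shows "\<exists>K\<ge>0. (\<forall>x\<in>{l..u}. \<bar>(a - x\<^sup>2) / (c + x)\<bar> \<le> K) \<and>
    (\<forall>x\<in>{l..u}. \<forall>y\<in>{l..u}. \<bar>(a - x\<^sup>2) / (c + x) - (a - y\<^sup>2) / (c + y)\<bar> \<le> K * \<bar>x - y\<bar>)"
proof (rule quotient_lipschitz_Icc[where n' = "\<lambda>x. - (2 * x)" and d' = "\<lambda>x. 1"])
  show "continuous_on {l..u} (\<lambda>x::real. - (2 * x))" "continuous_on {l..u} (\<lambda>x::real. 1::real)"
    by (intro continuous_intros)+
qed (use assms in \<open>auto intro!: derivative_eq_intros\<close>)

text \<open>The split puts \<open>h1\<close> only next to \<open>e1 - e2\<close>, where a weighted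
  speed estimate compensates its growth.\<close>

lemma product_difference_le:
  fixes h1 h2 e1 e2 :: real
  assumes "\<bar>e2\<bar> \<le> B" "\<bar>h1\<bar> * \<bar>e1 - e2\<bar> \<le> C * \<bar>h1 - h2\<bar>"
  shows "\<bar>h1 * e1 - h2 * e2\<bar> \<le> (B + C) * \<bar>h1 - h2\<bar>"
proof -
  have "h1 * e1 - h2 * e2 = h1 * (e1 - e2) + e2 * (h1 - h2)" by (simp add: algebra_simps)
  then have "\<bar>h1 * e1 - h2 * e2\<bar> \<le> \<bar>h1\<bar> * \<bar>e1 - e2\<bar> + \<bar>e2\<bar> * \<bar>h1 - h2\<bar>"
    by (metis abs_mult abs_triangle_ineq)
  also have "\<bar>e2\<bar> * \<bar>h1 - h2\<bar> \<le> B * \<bar>h1 - h2\<bar>" using assms by (intro mult_right_mono) auto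
  finally show ?thesis using assms by (simp add: algebra_simps)
qed

section \<open>Lipschitz dependence of speeds and strains on the invariant\<close>

context bar_model
begin

lemma slow_speed:
  "\<exists>K\<ge>0. \<forall>h1 z1 w1 V1 h2 z2 w2 V2. slow_wave M h1 z1 w1 V1 \<and> slow_wave M h2 z2 w2 V2 \<and> V1 < V2
    \<longrightarrow> V2 - V1 \<le> K * (h1 - h2)"
proof -
  obtain K where K: "0 \<le> K" "\<And>h1 z1 w1 V1 h2 z2 w2 V2.
    wave (k1 M) (c3 M) h1 z1 w1 V1 \<and> wave (k1 M) (c3 M) h2 z2 w2 V2 \<and> 0 \<le> V1 \<and> V1 < V2 \<and> V2 \<le> c3 M \<and>
    wm M \<le> w1 \<and> 0 \<le> h1 \<and> 0 \<le> h2 \<and> z2 * w2 \<le> z1 * w1 \<longrightarrow> V2 - V1 \<le> K * (h1 - h2)"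
    using slow_wave_speed[OF c_pos(1,4) strain_pos(3)] by blast
  have "V2 - V1 \<le> K * (h1 - h2)" if s: "slow_wave M h1 z1 w1 V1" "slow_wave M h2 z2 w2 V2" "V1 < V2"
    for h1 z1 w1 V1 h2 z2 w2 V2
  proof -
    have "(k1 M - k3 M) / 2 * (wM M * wm M - z1 * w1) \<le> (k1 M - k3 M) / 2 * (wM M * wm M - z2 * w2)"
      by (rule phi_rel_mono[OF _ _ _ s(3)]) (use s in \<open>unfold slow_wave_def, blast+\<close>)
    then have "z2 * w2 \<le> z1 * w1" using k_pos by (simp add: mult_le_cancel_left)
    then show ?thesis using s by (intro K(2)[rule_format, of h1 z1 w1 V1 h2 z2 w2 V2]) (auto simp: slow_wave_def)
  qed
  then show ?thesis using K(1) by blast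
qed

text \<open>With \<open>phi M\<close> evaluated at \<open>- V\<close>, the faster boundary has the
  larger \<open>z * w\<close>. As \<open>phi M\<close> is nonpositive there, \<open>z * w\<close> is
  at least \<open>wM M * wm M\<close>, so its logarithm makes sense.\<close>

lemma fast_speed:
  "\<exists>K\<ge>0. \<forall>h1 z1 w1 V1 h2 z2 w2 V2. fast_wave M h1 z1 w1 V1 \<and> fast_wave M h2 z2 w2 V2 \<and> V1 \<le> V2
    \<longrightarrow> h1 * (V2 - V1) \<le> K * (h2 - h1)"
proof -
  obtain K where K: "0 \<le> K" "\<And>h1 z1 w1 V1 h2 z2 w2 V2.
    wave (k3 M) (c1 M) h1 z1 w1 V1 \<and> wave (k3 M) (c1 M) h2 z2 w2 V2 \<and> 0 \<le> V1 \<and> V1 \<le> V2 \<and> V2\<^sup>2 < k3 M \<and>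
    0 < h1 \<and> 0 < h2 \<and> 0 < z1 * w1 \<and> z1 * w1 \<le> z2 * w2 \<longrightarrow> h1 * (V2 - V1) \<le> K * (h2 - h1)"
    using fast_wave_speed[OF c_pos(3) k_pos(1) c_pos(5)] by blast
  have "h1 * (V2 - V1) \<le> K * (h2 - h1)"
    if s: "fast_wave M h1 z1 w1 V1" "fast_wave M h2 z2 w2 V2" "V1 \<le> V2" for h1 z1 w1 V1 h2 z2 w2 V2
  proof -
    have "phi M (- V2) \<le> phi M (- V1)"
      using s by (intro phi_mono) (auto simp: fast_wave_def)
    moreover have "phi M (- V1) = (k1 M - k3 M) / 2 * (wM M * wm M - z1 * w1)"
      "phi M (- V2) = (k1 M - k3 M) / 2 * (wM M * wm M - z2 * w2)"
      using s unfolding fast_wave_def by blast+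
    ultimately have "(k1 M - k3 M) / 2 * (wM M * wm M - z2 * w2) \<le> (k1 M - k3 M) / 2 * (wM M * wm M - z1 * w1)"
      by simp
    then have G: "z1 * w1 \<le> z2 * w2" using k_pos by (simp add: mult_le_cancel_left)
    have "phi M (- V1) \<le> 0" using s by (intro phi_nonpos) (auto simp: fast_wave_def)
    moreover have "phi M (- V1) = (k1 M - k3 M) / 2 * (wM M * wm M - z1 * w1)"
      using s unfolding fast_wave_def by blast
    ultimately have "wM M * wm M \<le> z1 * w1" using k_pos by (simp add: mult_le_0_iff)
    moreover have "0 < wM M * wm M" using strain_pos by simp
    ultimately have "0 < z1 * w1" by linarith
    moreover have "V2\<^sup>2 < (c3 M)\<^sup>2" using s by (intro power_strict_mono) (auto simp: fast_wave_def)
    ultimately show ?thesis using s G crit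
      by (intro K(2)[rule_format, of h1 z1 w1 V1 h2 z2 w2 V2]) (auto simp: fast_wave_def c_sq)
  qed
  then show ?thesis using K(1) by blast
qed

text \<open>The first part describes large \<open>h\<close>: the bound on \<open>w\<close> forces
  \<open>h * (c3 M - V)\<close> to stay bounded, so \<open>V\<close> tends to \<open>c3 M\<close>
  and \<open>z\<close> stays within bounded distance of \<open>h\<close> times its factor at
  \<open>c3 M\<close>. In the second part the weight \<open>h1\<close> of the speed estimate pays
  for the growth of the strains.\<close>

lemma fast_states:
  "\<exists>K\<ge>0. (\<forall>h z w V. fast_wave M h z w V \<longrightarrow>
      z \<le> K * h \<and> h * (c3 M - V) \<le> K \<and> \<bar>z - h * c1 M / c3 M\<bar> \<le> K) \<and>
    (\<forall>h1 z1 w1 V1 h2 z2 w2 V2. fast_wave M h1 z1 w1 V1 \<and> fast_wave M h2 z2 w2 V2 \<longrightarrow>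
      \<bar>V1 - V2\<bar> \<le> K * \<bar>h1 - h2\<bar> \<and> \<bar>z1 - z2\<bar> \<le> K * \<bar>h1 - h2\<bar> \<and> \<bar>w1 - w2\<bar> \<le> K * \<bar>h1 - h2\<bar>)"
proof -
  let ?c = "c1 M" and ?a = "k3 M"
  obtain K where K: "0 \<le> K" "\<And>h1 z1 w1 V1 h2 z2 w2 V2. fast_wave M h1 z1 w1 V1 \<Longrightarrow>
    fast_wave M h2 z2 w2 V2 \<Longrightarrow> V1 \<le> V2 \<Longrightarrow> h1 * (V2 - V1) \<le> K * (h2 - h1)"
    using fast_speed by blast
  define q where "q = (\<lambda>x. ?c * (?c + x) / (?a + ?c * x))"
  define r where "r = (\<lambda>x. ?c * (?a - x\<^sup>2) / ((?c - x) * (?a + ?c * x)))"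
  have den: "0 < ?a + ?c * x" "0 < ?c - x" if "x \<in> {0..c3 M}" for x
    using that c_pos k_pos by (auto intro: add_pos_nonneg)
  have "\<exists>K\<ge>0. (\<forall>x\<in>{0..c3 M}. \<bar>q x\<bar> \<le> K) \<and> (\<forall>x\<in>{0..c3 M}. \<forall>y\<in>{0..c3 M}. \<bar>q x - q y\<bar> \<le> K * \<bar>x - y\<bar>)"
    unfolding q_def by (rule wall_strain_factor_lipschitz) (use den in fastforce)
  then obtain Q where Q: "0 \<le> Q" "\<And>x. x \<in> {0..c3 M} \<Longrightarrow> \<bar>q x\<bar> \<le> Q"
    "\<And>x y. x \<in> {0..c3 M} \<Longrightarrow> y \<in> {0..c3 M} \<Longrightarrow> \<bar>q x - q y\<bar> \<le> Q * \<bar>x - y\<bar>"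
    by blast
  have "\<exists>K\<ge>0. (\<forall>x\<in>{0..c3 M}. \<bar>r x\<bar> \<le> K) \<and> (\<forall>x\<in>{0..c3 M}. \<forall>y\<in>{0..c3 M}. \<bar>r x - r y\<bar> \<le> K * \<bar>x - y\<bar>)"
    unfolding r_def by (rule front_strain_factor_lipschitz) (use den in fastforce)+
  then obtain R where R: "0 \<le> R" "\<And>x. x \<in> {0..c3 M} \<Longrightarrow> \<bar>r x\<bar> \<le> R"
    "\<And>x y. x \<in> {0..c3 M} \<Longrightarrow> y \<in> {0..c3 M} \<Longrightarrow> \<bar>r x - r y\<bar> \<le> R * \<bar>x - y\<bar>"
    by blast
  have w: "z = h * q V" "w = h * r V" "V \<in> {0..c3 M}" "wMcr M < h" "0 < h" if "fast_wave M h z w V" for h z w V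
  proof -
    show V: "V \<in> {0..c3 M}" and "wMcr M < h" "0 < h" using that crit by (auto simp: fast_wave_def)
    show "z = h * q V" "w = h * r V"
      using that den[OF V] by (auto simp: fast_wave_def wave_def q_def r_def eq_divide_eq mult_ac)
  qed
  \<comment> \<open>Read off from the second equation of \<open>wave\<close>, with
    \<open>w \<le> wM M\<close>, \<open>V < c3 M\<close> in the factors on its right and
    \<open>c3 M + V\<close> bounded below by \<open>c3 M\<close> on its left.\<close>
  define B where "B = wM M * (?a + ?c * c3 M) / c3 M"
  have B: "h * (c3 M - V) \<le> B" if f: "fast_wave M h z w V" for h z w V
  proof -
    have V: "0 < V" "V < c3 M" "0 < w" "w \<le> wM M" using f by (auto simp: fast_wave_def)
    have "?c * (h * (c3 M - V) * c3 M) \<le> ?c * (h * (c3 M - V) * (c3 M + V))"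
      using V w(5)[OF f] c_pos by (intro mult_left_mono) auto
    also have "\<dots> = h * ?c * (?a - V\<^sup>2)"
      unfolding c_sq(2)[symmetric] by (simp add: algebra_simps power2_eq_square)
    also have "\<dots> = w * (?c - V) * (?a + ?c * V)" using f by (simp add: fast_wave_def wave_def)
    also have "\<dots> \<le> wM M * ?c * (?a + ?c * c3 M)"
      using V c_pos k_pos strain_pos by (intro mult_mono mult_nonneg_nonneg) (auto simp: less_imp_le)
    finally have "?c * (h * (c3 M - V) * c3 M) \<le> ?c * (wM M * (?a + ?c * c3 M))" by (simp add: mult_ac)
    then have "h * (c3 M - V) * c3 M \<le> wM M * (?a + ?c * c3 M)" using c_pos by simp
    then show ?thesis using c_pos by (simp add: B_def pos_le_divide_eq)
  qed
  have B0: "0 \<le> B" using strain_pos k_pos c_pos by (simp add: B_def)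
  have qc: "q (c3 M) = ?c / c3 M"
  proof -
    have "?a + ?c * c3 M = c3 M * (?c + c3 M)"
      unfolding c_sq(2)[symmetric] by (simp add: algebra_simps power2_eq_square)
    moreover have "?c + c3 M \<noteq> 0" using c_pos by simp
    ultimately show ?thesis by (simp add: q_def)
  qed
  have s: "z \<le> Q * h \<and> h * (c3 M - V) \<le> B \<and> \<bar>z - h * ?c / c3 M\<bar> \<le> Q * B" if f: "fast_wave M h z w V" for h z w V
  proof (intro conjI B[OF f])
    note w = w[OF f]
    have "h * q V \<le> h * Q" using Q(2)[OF w(3)] w(5) by (intro mult_left_mono) auto
    then show "z \<le> Q * h" using w(1) by (simp add: mult.commute)
    have "\<bar>z - h * ?c / c3 M\<bar> = h * \<bar>q V - q (c3 M)\<bar>"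
      using w by (simp add: qc abs_mult_pos' right_diff_distrib)
    also have "\<dots> \<le> h * (Q * \<bar>V - c3 M\<bar>)" using w c_pos by (intro mult_left_mono Q) auto
    also have "\<dots> = Q * (h * (c3 M - V))" using w by simp
    also have "\<dots> \<le> Q * B" using B[OF f] Q by (intro mult_left_mono)
    finally show "\<bar>z - h * ?c / c3 M\<bar> \<le> Q * B" .
  qed
  have l: "\<bar>V1 - V2\<bar> \<le> K / wMcr M * \<bar>h1 - h2\<bar> \<and> \<bar>z1 - z2\<bar> \<le> (Q + Q * K) * \<bar>h1 - h2\<bar> \<and> \<bar>w1 - w2\<bar> \<le> (R + R * K) * \<bar>h1 - h2\<bar>"
    if f: "fast_wave M h1 z1 w1 V1" "fast_wave M h2 z2 w2 V2" "V1 \<le> V2" for h1 z1 w1 V1 h2 z2 w2 V2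
  proof -
    note w1 = w[OF f(1)] and w2 = w[OF f(2)]
    \<comment> \<open>The weighted form controls the strains; \<open>wMcr M < h1\<close> turns it
      into a plain estimate of the speeds.\<close>
    have *: "h1 * \<bar>V1 - V2\<bar> \<le> K * \<bar>h1 - h2\<bar>"
      using K(2)[OF f] f(3) K(1) mult_left_mono[OF abs_ge_self[of "h2 - h1"] K(1)] by (simp add: abs_minus_commute)
    have "wMcr M * \<bar>V1 - V2\<bar> \<le> h1 * \<bar>V1 - V2\<bar>" using w1 by (intro mult_right_mono) auto
    then have a: "\<bar>V1 - V2\<bar> \<le> K / wMcr M * \<bar>h1 - h2\<bar>" using * crit by (simp add: field_simps)
    have "\<bar>h1\<bar> * \<bar>q V1 - q V2\<bar> \<le> h1 * (Q * \<bar>V1 - V2\<bar>)"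
      using Q(3)[OF w1(3) w2(3)] w1 by (simp add: mult_left_mono)
    also have "\<dots> \<le> Q * K * \<bar>h1 - h2\<bar>"
      using mult_left_mono[OF * Q(1)] by (simp add: mult_ac)
    finally have b: "\<bar>z1 - z2\<bar> \<le> (Q + Q * K) * \<bar>h1 - h2\<bar>"
      unfolding w1(1) w2(1) using Q(2)[OF w2(3)] by (intro product_difference_le)
    have "\<bar>h1\<bar> * \<bar>r V1 - r V2\<bar> \<le> h1 * (R * \<bar>V1 - V2\<bar>)"
      using R(3)[OF w1(3) w2(3)] w1 by (simp add: mult_left_mono)
    also have "\<dots> \<le> R * K * \<bar>h1 - h2\<bar>"
      using mult_left_mono[OF * R(1)] by (simp add: mult_ac)
    finally have "\<bar>w1 - w2\<bar> \<le> (R + R * K) * \<bar>h1 - h2\<bar>"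
      unfolding w1(2) w2(2) using R(2)[OF w2(3)] by (intro product_difference_le)
    with a b show ?thesis by blast
  qed
  define C where "C = Q + B + Q * B + K / wMcr M + (Q + Q * K) + (R + R * K)"
  have C: "0 \<le> C" "Q \<le> C" "B \<le> C" "Q * B \<le> C" "K / wMcr M \<le> C" "Q + Q * K \<le> C" "R + R * K \<le> C"
    using K(1) Q(1) R(1) B0 crit by (simp_all add: C_def)
  have l': "\<bar>V1 - V2\<bar> \<le> C * \<bar>h1 - h2\<bar> \<and> \<bar>z1 - z2\<bar> \<le> C * \<bar>h1 - h2\<bar> \<and> \<bar>w1 - w2\<bar> \<le> C * \<bar>h1 - h2\<bar>"
    if f: "fast_wave M h1 z1 w1 V1" "fast_wave M h2 z2 w2 V2" "V1 \<le> V2" for h1 z1 w1 V1 h2 z2 w2 V2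
    using l[OF f] C(5-7) by (meson abs_ge_zero mult_right_mono order_trans)
  have "\<bar>V1 - V2\<bar> \<le> C * \<bar>h1 - h2\<bar> \<and> \<bar>z1 - z2\<bar> \<le> C * \<bar>h1 - h2\<bar> \<and> \<bar>w1 - w2\<bar> \<le> C * \<bar>h1 - h2\<bar>"
    if f: "fast_wave M h1 z1 w1 V1" "fast_wave M h2 z2 w2 V2" for h1 z1 w1 V1 h2 z2 w2 V2
    using l'[OF f] l'[OF f(2,1)] by (cases "V1 \<le> V2") (auto simp: abs_minus_commute)
  moreover have "z \<le> C * h \<and> h * (c3 M - V) \<le> C \<and> \<bar>z - h * ?c / c3 M\<bar> \<le> C" if f: "fast_wave M h z w V" for h z w V
    using s[OF f] C mult_right_mono[OF C(2), of h] w(5)[OF f] by linarith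
  ultimately show ?thesis using C(1) by blast
qed

text \<open>In the formula \<open>h\<close> times the front factor, \<open>h\<close> and
  \<open>c3 M - V\<close> vanish together at the sonic speed, so Lipschitz bounds for speed and
  \<open>h\<close> say nothing about \<open>w\<close> there. The kinetic relation supplies a second
  expression, for \<open>w\<^sup>2\<close>, that stays regular.\<close>

lemma slow_states:
  "\<exists>K\<ge>0. (\<forall>h z w V. slow_wave M h z w V \<and> V < c3 M \<longrightarrow> w \<le> K) \<and>
    (\<forall>h1 z1 w1 V1 h2 z2 w2 V2. slow_wave M h1 z1 w1 V1 \<and> slow_wave M h2 z2 w2 V2 \<longrightarrow>
      \<bar>V1 - V2\<bar> \<le> K * \<bar>h1 - h2\<bar> \<and> \<bar>z1 - z2\<bar> \<le> K * \<bar>h1 - h2\<bar> \<and>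
      (V1 < c3 M \<and> V2 < c3 M \<longrightarrow> \<bar>w1 - w2\<bar> \<le> K * \<bar>h1 - h2\<bar>))"
proof -
  let ?c = "c3 M" and ?a = "k1 M" and ?D = "k1 M - k3 M"
  obtain K where K: "0 \<le> K" "\<And>h1 z1 w1 V1 h2 z2 w2 V2. slow_wave M h1 z1 w1 V1 \<Longrightarrow>
    slow_wave M h2 z2 w2 V2 \<Longrightarrow> V1 < V2 \<Longrightarrow> V2 - V1 \<le> K * (h1 - h2)"
    using slow_speed by blast
  have KV: "\<bar>V1 - V2\<bar> \<le> K * \<bar>h1 - h2\<bar>"
    if s: "slow_wave M h1 z1 w1 V1" "slow_wave M h2 z2 w2 V2" for h1 z1 w1 V1 h2 z2 w2 V2
  proof -
    have "K * (h1 - h2) \<le> K * \<bar>h1 - h2\<bar>" "K * (h2 - h1) \<le> K * \<bar>h1 - h2\<bar>" "0 \<le> K * \<bar>h1 - h2\<bar>"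
      using K(1) by (auto intro!: mult_left_mono)
    then show ?thesis using K(2)[OF s] K(2)[OF s(2,1)] by linarith
  qed
  define q where "q = (\<lambda>x. ?c * (?c + x) / (?a + ?c * x))"
  define e where "e = (\<lambda>x. ?c * (?a - x\<^sup>2) / ((?c - x) * (?a + ?c * x)))"
  define r where "r = (\<lambda>x. (?a - x\<^sup>2) / (?c + x))"
  have den: "0 < ?a + ?c * x" "0 < ?c + x" if "x \<in> {0..?c}" for x
    using that c_pos k_pos by (auto intro: add_pos_nonneg)
  have "\<exists>K\<ge>0. (\<forall>x\<in>{0..?c}. \<bar>q x\<bar> \<le> K) \<and> (\<forall>x\<in>{0..?c}. \<forall>y\<in>{0..?c}. \<bar>q x - q y\<bar> \<le> K * \<bar>x - y\<bar>)"
    unfolding q_def by (rule wall_strain_factor_lipschitz) (use den in fastforce)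
  then obtain Q where Q: "0 \<le> Q" "\<And>x. x \<in> {0..?c} \<Longrightarrow> \<bar>q x\<bar> \<le> Q"
    "\<And>x y. x \<in> {0..?c} \<Longrightarrow> y \<in> {0..?c} \<Longrightarrow> \<bar>q x - q y\<bar> \<le> Q * \<bar>x - y\<bar>"
    by blast
  \<comment> \<open>The intervals overlap in length \<open>c3 M / 4\<close>, so two speeds lie in a
    common one or differ by at least that much.\<close>
  let ?I = "{0..3 * ?c / 4}" and ?J = "{?c / 2..?c}"
  have denI: "?a + ?c * x \<noteq> 0" "?c - x \<noteq> 0" if "x \<in> ?I" for x
    using that c_pos den[of x] by auto
  have "\<exists>K\<ge>0. (\<forall>x\<in>?I. \<bar>e x\<bar> \<le> K) \<and> (\<forall>x\<in>?I. \<forall>y\<in>?I. \<bar>e x - e y\<bar> \<le> K * \<bar>x - y\<bar>)"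
    unfolding e_def by (rule front_strain_factor_lipschitz) (use denI in blast)+
  then obtain E where E: "0 \<le> E" "\<And>x. x \<in> ?I \<Longrightarrow> \<bar>e x\<bar> \<le> E"
    "\<And>x y. x \<in> ?I \<Longrightarrow> y \<in> ?I \<Longrightarrow> \<bar>e x - e y\<bar> \<le> E * \<bar>x - y\<bar>"
    by blast
  have denJ: "?c + x \<noteq> 0" if "x \<in> ?J" for x
    using that c_pos by auto
  have "\<exists>K\<ge>0. (\<forall>x\<in>?J. \<bar>r x\<bar> \<le> K) \<and> (\<forall>x\<in>?J. \<forall>y\<in>?J. \<bar>r x - r y\<bar> \<le> K * \<bar>x - y\<bar>)"
    unfolding r_def by (rule strain_ratio_lipschitz) (use denJ in blast)
  then obtain R where R: "0 \<le> R" "\<And>x. x \<in> ?J \<Longrightarrow> \<bar>r x\<bar> \<le> R"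
    "\<And>x y. x \<in> ?J \<Longrightarrow> y \<in> ?J \<Longrightarrow> \<bar>r x - r y\<bar> \<le> R * \<bar>x - y\<bar>"
    by blast
  define sl where "sl = (\<lambda>x. (phi M ?c - phi M x) / (?c - x))"
  obtain p P where P: "0 \<le> P" "\<And>x. x \<in> ?J \<Longrightarrow> (phi M has_real_derivative p x) (at x within ?J)"
    "\<And>x y. x \<in> ?J \<Longrightarrow> y \<in> ?J \<Longrightarrow> \<bar>p x - p y\<bar> \<le> P * \<bar>x - y\<bar>"
    by (rule phi_derivative_lipschitz, rule that)
  have sl: "\<bar>sl x - sl y\<bar> \<le> P * \<bar>x - y\<bar>" if "x \<in> {?c / 2..<?c}" "y \<in> {?c / 2..<?c}" for x y
    unfolding sl_def
    by (rule slope_lipschitz[where f = "phi M" and f' = p and a = "?c / 2" and b = ?c])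
      (use P that in simp_all)
  define T where "T = \<bar>sl (?c / 2)\<bar> + P * ?c"
  have T: "\<bar>sl x\<bar> \<le> T" if x: "x \<in> {?c / 2..<?c}" for x
  proof -
    have "\<bar>sl x - sl (?c / 2)\<bar> \<le> P * \<bar>x - ?c / 2\<bar>" using x c_pos by (intro sl) auto
    also have "\<dots> \<le> P * ?c" using x P c_pos by (intro mult_left_mono) auto
    finally show ?thesis by (simp add: T_def)
  qed
  have T0: "0 \<le> T" using P c_pos by (simp add: T_def)
  have w: "V \<in> {0..?c}" "z = h * q V" "V \<in> ?I \<Longrightarrow> w = h * e V" "0 < w" "wm M \<le> w" "0 \<le> h" "h < wmcr M"
    "V \<in> {?c / 2..<?c} \<Longrightarrow> w\<^sup>2 = 2 / ?D * (sl V * r V)" if s: "slow_wave M h z w V" for h z w V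
  proof -
    show V: "V \<in> {0..?c}" "wm M \<le> w" "0 < w" "0 \<le> h" "h < wmcr M" using s strain_pos by (auto simp: slow_wave_def)
    have wv: "z * (?a + ?c * V) = h * ?c * (?c + V)" "h * ?c * (?a - V\<^sup>2) = w * (?c - V) * (?a + ?c * V)"
      using s by (auto simp: slow_wave_def wave_def)
    show "z = h * q V" using wv(1) den[OF V(1)] by (simp add: q_def eq_divide_eq mult_ac)
    show "w = h * e V" if "V \<in> ?I" using wv(2) denI[OF that] by (simp add: e_def eq_divide_eq mult_ac)
    show "w\<^sup>2 = 2 / ?D * (sl V * r V)" if "V \<in> {?c / 2..<?c}"
    proof -
      have V0: "0 < V" "V < ?c" using that c_pos by auto
      then have pv: "phi M V = ?D / 2 * (wM M * wm M - z * w)" using s by (simp add: slow_wave_def phi_rel_def)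
      \<comment> \<open>This zero at the sonic speed meets the factor \<open>c3 M - V\<close> in the
        denominator of \<open>w / z\<close>; their quotient is the slope
        \<open>sl V\<close>.\<close>
      have g: "phi M ?c - phi M V = ?D / 2 * (z * w)" unfolding phi_c3 pv by (simp add: right_diff_distrib)
      have "wave ?a ?c h z w V" using s by (simp add: slow_wave_def)
      then have ra: "z * (?a - V\<^sup>2) = w * (?c\<^sup>2 - V\<^sup>2)"
        by (rule wave_ratio) (use den[OF V(1)] in simp)
      have "w\<^sup>2 * ((?c - V) * (?c + V)) = (w * (?c\<^sup>2 - V\<^sup>2)) * w" by (simp add: power2_eq_square algebra_simps)
      also have "\<dots> = z * w * (?a - V\<^sup>2)" unfolding ra[symmetric] by simp
      finally have "w\<^sup>2 = z * w * (?a - V\<^sup>2) / ((?c - V) * (?c + V))" using V0 by (simp add: eq_divide_eq)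
      also have "\<dots> = 2 / ?D * (sl V * r V)"
      proof -
        have "G * x / (s * y) = 2 / d * (d / 2 * G / s * (x / y))" if "d \<noteq> 0" for d G s x y :: real
          using that by simp
        then show ?thesis using k_pos by (simp add: sl_def r_def g del: times_divide_eq_left times_divide_eq_right)
      qed
      finally show ?thesis .
    qed
  qed
  define B where "B = wmcr M * E + (1 + 2 / ?D * (T * R))"
  have B1: "w \<le> B" if s: "slow_wave M h z w V" "V < ?c" for h z w V
  proof (cases "V \<in> ?I")
    case True
    have "w = h * e V" by (rule w(3)[OF s(1) True])
    also have "\<dots> \<le> h * E"
      using E(2)[OF True] w(6)[OF s(1)] by (intro mult_left_mono) auto
    also have "\<dots> \<le> wmcr M * E"
      using E(1) w(7)[OF s(1)] by (intro mult_right_mono) auto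
    finally have "w \<le> wmcr M * E" .
    moreover have "0 \<le> 1 + 2 / ?D * (T * R)" using T0 R(1) k_pos by simp
    ultimately show ?thesis by (simp add: B_def)
  next
    case False
    then have V: "V \<in> {?c / 2..<?c}" using w(1)[OF s(1)] s(2) c_pos by auto
    have "sl V * r V \<le> \<bar>sl V\<bar> * \<bar>r V\<bar>" by (metis abs_ge_self abs_mult)
    also have "\<dots> \<le> T * R" using T[OF V] R V T0 by (intro mult_mono) auto
    finally have "w\<^sup>2 \<le> 2 / ?D * (T * R)"
      unfolding w(8)[OF s(1) V] using k_pos by (intro mult_left_mono) auto
    moreover have "w \<le> 1 + w\<^sup>2"
    proof -
      have "0 \<le> (w - 1)\<^sup>2" by simp
      then have "2 * w \<le> 1 + w\<^sup>2" by (simp add: power2_diff)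
      then show ?thesis using w(4)[OF s(1)] by linarith
    qed
    moreover have "0 \<le> wmcr M * E" using crit strain_pos E(1) by simp
    ultimately show ?thesis by (simp add: B_def)
  qed
  have B0: "0 \<le> B" using T0 R(1) E(1) k_pos crit strain_pos by (simp add: B_def)
  define W where "W = E + wmcr M * E * K + 2 / ?D * (T * R + P * R) / wm M * K + 4 / ?c * B * K"
  have Ks: "0 \<le> E" "0 \<le> wmcr M * E * K" "0 \<le> 2 / ?D * (T * R + P * R) / wm M * K" "0 \<le> 4 / ?c * B * K"
    using E(1) K(1) T0 R(1) P(1) B0 k_pos strain_pos c_pos crit by simp_all
  have W: "\<bar>w1 - w2\<bar> \<le> W * \<bar>h1 - h2\<bar>"
    if s: "slow_wave M h1 z1 w1 V1" "slow_wave M h2 z2 w2 V2" and V: "V1 < ?c" "V2 < ?c"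
    for h1 z1 w1 V1 h2 z2 w2 V2
  proof -
    note w1 = w[OF s(1)] and w2 = w[OF s(2)] and KV = KV[OF s]
    have tr: "\<bar>w1 - w2\<bar> \<le> W * \<bar>h1 - h2\<bar>" if "\<bar>w1 - w2\<bar> \<le> X * \<bar>h1 - h2\<bar>" "X \<le> W" for X
      using that by (meson abs_ge_zero mult_right_mono order_trans)
    consider "V1 \<in> ?I" "V2 \<in> ?I" | "V1 \<in> {?c / 2..<?c}" "V2 \<in> {?c / 2..<?c}" | "?c / 4 \<le> \<bar>V1 - V2\<bar>"
      using w1(1) w2(1) V c_pos by fastforce
    then show ?thesis
    proof cases
      case 1
      have "\<bar>h1\<bar> * \<bar>e V1 - e V2\<bar> \<le> wmcr M * (E * \<bar>V1 - V2\<bar>)"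
        using E(1) E(3)[OF 1] w1(6,7) by (intro mult_mono) auto
      also have "\<dots> \<le> wmcr M * (E * (K * \<bar>h1 - h2\<bar>))"
        using E(1) KV w1(6,7) by (intro mult_left_mono) auto
      also have "\<dots> = wmcr M * E * K * \<bar>h1 - h2\<bar>" by simp
      finally have "\<bar>w1 - w2\<bar> \<le> (E + wmcr M * E * K) * \<bar>h1 - h2\<bar>"
        unfolding w1(3)[OF 1(1)] w2(3)[OF 1(2)] by (rule product_difference_le[OF E(2)[OF 1(2)]])
      then show ?thesis by (rule tr) (use Ks in \<open>simp add: W_def\<close>)
    next
      case 2
      have "sl V1 * r V1 - sl V2 * r V2 = sl V1 * (r V1 - r V2) + r V2 * (sl V1 - sl V2)"
        by (simp add: algebra_simps)
      then have "\<bar>sl V1 * r V1 - sl V2 * r V2\<bar> \<le> \<bar>sl V1\<bar> * \<bar>r V1 - r V2\<bar> + \<bar>r V2\<bar> * \<bar>sl V1 - sl V2\<bar>"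
        by (metis abs_mult abs_triangle_ineq)
      also have "\<dots> \<le> T * (R * \<bar>V1 - V2\<bar>) + R * (P * \<bar>V1 - V2\<bar>)"
      proof (rule add_mono)
        have J: "V1 \<in> ?J" "V2 \<in> ?J" using 2 by simp_all
        show "\<bar>sl V1\<bar> * \<bar>r V1 - r V2\<bar> \<le> T * (R * \<bar>V1 - V2\<bar>)"
          by (rule mult_mono[OF T[OF 2(1)] R(3)[OF J] T0 abs_ge_zero])
        show "\<bar>r V2\<bar> * \<bar>sl V1 - sl V2\<bar> \<le> R * (P * \<bar>V1 - V2\<bar>)"
          by (rule mult_mono[OF R(2)[OF J(2)] sl[OF 2] R(1) abs_ge_zero])
      qed
      also have "\<dots> = (T * R + P * R) * \<bar>V1 - V2\<bar>" by (simp add: algebra_simps)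
      also have "\<dots> \<le> (T * R + P * R) * (K * \<bar>h1 - h2\<bar>)"
        using T0 R(1) P(1) KV by (intro mult_left_mono) auto
      finally have d: "\<bar>sl V1 * r V1 - sl V2 * r V2\<bar> \<le> (T * R + P * R) * (K * \<bar>h1 - h2\<bar>)" .
      \<comment> \<open>Passing from squares to strains costs the factor \<open>w1 + w2\<close>,
        which the high-strain phase bounds below by \<open>wm M\<close>.\<close>
      have "wm M * \<bar>w1 - w2\<bar> \<le> (w1 + w2) * \<bar>w1 - w2\<bar>"
        using w1(4,5) w2(4,5) by (intro mult_right_mono) auto
      also have "\<dots> = \<bar>w1\<^sup>2 - w2\<^sup>2\<bar>"
        using w1(4) w2(4) by (simp add: square_diff_square_factored power2_eq_square abs_mult)
      also have "\<dots> = 2 / ?D * \<bar>sl V1 * r V1 - sl V2 * r V2\<bar>"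
        unfolding w1(8)[OF 2(1)] w2(8)[OF 2(2)] right_diff_distrib[symmetric] abs_mult[of "2 / ?D"]
        using k_pos by simp
      also have "\<dots> \<le> 2 / ?D * ((T * R + P * R) * (K * \<bar>h1 - h2\<bar>))"
        using d k_pos by (intro mult_left_mono) auto
      finally have "\<bar>w1 - w2\<bar> \<le> 2 / ?D * ((T * R + P * R) * (K * \<bar>h1 - h2\<bar>)) / wm M"
        using strain_pos(3) by (metis mult.commute pos_le_divide_eq)
      also have "\<dots> = 2 / ?D * (T * R + P * R) / wm M * K * \<bar>h1 - h2\<bar>" by simp
      finally have "\<bar>w1 - w2\<bar> \<le> 2 / ?D * (T * R + P * R) / wm M * K * \<bar>h1 - h2\<bar>" .
      then show ?thesis by (rule tr) (use Ks in \<open>simp add: W_def\<close>)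
    next
      case 3
      \<comment> \<open>Speeds this far apart force a jump of \<open>h\<close> of fixed size, so
        boundedness of the strains suffices.\<close>
      have "1 \<le> 4 / ?c * x" if "?c / 4 \<le> x" for x
        using that c_pos by (simp add: field_simps)
      from mult_left_mono[OF this[OF 3] B0]
      have "\<bar>w1 - w2\<bar> \<le> B * (4 / ?c * \<bar>V1 - V2\<bar>)"
        using B1[OF s(1) V(1)] B1[OF s(2) V(2)] w1(4) w2(4) by linarith
      also have "\<dots> \<le> B * (4 / ?c * (K * \<bar>h1 - h2\<bar>))"
        using B0 c_pos KV by (intro mult_left_mono) auto
      also have "\<dots> = 4 / ?c * B * K * \<bar>h1 - h2\<bar>" by simp
      finally have "\<bar>w1 - w2\<bar> \<le> 4 / ?c * B * K * \<bar>h1 - h2\<bar>" .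
      then show ?thesis by (rule tr) (use Ks in \<open>simp add: W_def\<close>)
    qed
  qed
  have Z: "\<bar>z1 - z2\<bar> \<le> (Q + wmcr M * Q * K) * \<bar>h1 - h2\<bar>"
    if s: "slow_wave M h1 z1 w1 V1" "slow_wave M h2 z2 w2 V2" for h1 z1 w1 V1 h2 z2 w2 V2
  proof -
    note w1 = w[OF s(1)] and w2 = w[OF s(2)] and KV = KV[OF s]
    have "\<bar>h1\<bar> * \<bar>q V1 - q V2\<bar> \<le> wmcr M * (Q * \<bar>V1 - V2\<bar>)"
    proof (rule mult_mono[OF _ Q(3)[OF w1(1) w2(1)] _ abs_ge_zero])
      show "\<bar>h1\<bar> \<le> wmcr M" "0 \<le> wmcr M" using w1(6,7) by linarith+
    qed
    also have "\<dots> \<le> wmcr M * (Q * (K * \<bar>h1 - h2\<bar>))"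
      using Q(1) KV w1(6,7) by (intro mult_left_mono) auto
    also have "\<dots> = wmcr M * Q * K * \<bar>h1 - h2\<bar>" by simp
    finally show ?thesis
      unfolding w1(2) w2(2) by (rule product_difference_le[OF Q(2)[OF w2(1)]])
  qed
  define C where "C = B + K + W + (Q + wmcr M * Q * K)"
  have W0: "0 \<le> W" using Ks by (simp add: W_def)
  have C: "0 \<le> C" "B \<le> C" "K \<le> C" "W \<le> C" "Q + wmcr M * Q * K \<le> C"
    using B0 K(1) W0 Q(1) crit strain_pos by (simp_all add: C_def)
  show ?thesis
  proof (intro exI[of _ C] conjI allI impI; (elim conjE)?)
    show "0 \<le> C" by fact
    show "w \<le> C" if "slow_wave M h z w V" "V < ?c" for h z w V using B1[OF that] C by simp
    fix h1 z1 w1 V1 h2 z2 w2 V2 assume s: "slow_wave M h1 z1 w1 V1" "slow_wave M h2 z2 w2 V2"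
    show "\<bar>V1 - V2\<bar> \<le> C * \<bar>h1 - h2\<bar>" "\<bar>z1 - z2\<bar> \<le> C * \<bar>h1 - h2\<bar>"
      using order_trans[OF KV[OF s] mult_right_mono[OF C(3)]] order_trans[OF Z[OF s] mult_right_mono[OF C(5)]]
      by simp_all
    show "\<bar>w1 - w2\<bar> \<le> C * \<bar>h1 - h2\<bar>" if "V1 < ?c" "V2 < ?c"
      using order_trans[OF W[OF s that] mult_right_mono[OF C(4)]] by simp
  qed
qed

end

section \<open>Dependence of states and speeds on the datum\<close>

text \<open>For \<open>x = x'\<close> the hypothesis makes \<open>y\<close> unique, so choice has no
  freedom.\<close>

lemma lipschitz_selection:
  fixes R :: "'a::metric_space \<Rightarrow> 'b::metric_space \<Rightarrow> bool"
  assumes K: "0 \<le> K" and R: "\<And>x y x' y'. R x y \<Longrightarrow> R x' y' \<Longrightarrow> dist y y' \<le> K * dist x x'"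
  shows "\<exists>f. K-lipschitz_on {x. \<exists>y. R x y} f \<and> (\<forall>x y. R x y \<longrightarrow> y = f x)"
proof (intro exI conjI allI impI)
  let ?f = "\<lambda>x. SOME y. R x y"
  show "K-lipschitz_on {x. \<exists>y. R x y} ?f"
    using K by (intro lipschitz_onI) (auto intro!: R someI_ex[of "R _"])
  show "y = ?f x" if "R x y" for x y
    using R[OF that someI[of "R x", OF that]] by simp
qed

context bar_model
begin

lemma low_strain_bound: "u \<in> H1 M \<Longrightarrow> \<bar>snd u\<bar> \<le> 1 + wM M"
  using strain_pos by (auto simp: H1_iff)

text \<open>The strain gap between the phases. It turns every constant into a multiple of the
  distance of the data and underlies all estimates across phases.\<close>

lemma phase_distance:
  assumes "u \<in> H1 M" "u' \<in> H3 M"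
  shows "1 \<le> norm (u - u') / (wm M - wM M)"
proof -
  have "snd u \<le> wM M" "wm M \<le> snd u'" using assms by (auto simp: H1_iff H3_iff)
  then have "wm M - wM M \<le> \<bar>snd (u - u')\<bar>" unfolding snd_diff by linarith
  also have "\<dots> \<le> norm (u - u')" by (metis norm_snd_le prod.collapse real_norm_def)
  finally show ?thesis using strain_pos by simp
qed

lemma state_diff_le: "\<bar>fst u - fst u'\<bar> \<le> norm (u - u')" "\<bar>snd u - snd u'\<bar> \<le> norm (u - u')" for u u' :: state
  using norm_fst_le[of "fst u - fst u'" "snd u - snd u'"] norm_snd_le[of "snd u - snd u'" "fst u - fst u'"]
  by (simp_all add: minus_prod_def)

text \<open>A Lipschitz constant of \<open>h0\<close> inside either phase, since both outer speeds
  are at least \<open>c3 M\<close>.\<close>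

definition h0_const :: real where "h0_const = 1 + 1 / c3 M"

lemma h0_const_pos: "0 < h0_const" "1 \<le> h0_const"
  using c_pos by (simp_all add: h0_const_def add_pos_pos)

lemma h0_lipschitz:
  assumes "outer_speed M u = outer_speed M u'"
  shows "\<bar>h0 M u - h0 M u'\<bar> \<le> h0_const * norm (u - u')"
proof -
  let ?s = "outer_speed M u"
  have s: "c3 M \<le> ?s" using c_pos by (simp add: outer_speed_def)
  have "h0 M u - h0 M u' = (snd u - snd u') + (fst u - fst u') / ?s"
    using assms by (simp add: h0_def diff_divide_distrib)
  also have "\<bar>\<dots>\<bar> \<le> \<bar>snd u - snd u'\<bar> + \<bar>fst u - fst u'\<bar> / ?s"
    using s c_pos abs_triangle_ineq[of "snd u - snd u'" "(fst u - fst u') / ?s"] by simp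
  also have "\<dots> \<le> norm (u - u') + norm (u - u') / c3 M"
    using s c_pos state_diff_le[of u u'] by (intro add_mono frac_le) auto
  finally show ?thesis by (simp add: h0_const_def algebra_simps)
qed

lemma h0_high: "u \<in> H3 M \<Longrightarrow> fst u = c3 M * (h0 M u - snd u)"
  using c_pos by (simp add: h0_def outer_speed_simps)

lemma h0_low: "u \<in> H1 M \<Longrightarrow> fst u = c1 M * (h0 M u - snd u)"
  using c_pos by (simp add: h0_def outer_speed_simps)

lemma phase_lipschitz:
  fixes f :: "state \<Rightarrow> 'b::metric_space"
  assumes S: "S \<subseteq> HH M" and K: "0 \<le> K"
    and same: "\<And>u u'. u \<in> S \<Longrightarrow> u' \<in> S \<Longrightarrow> outer_speed M u = outer_speed M u' \<Longrightarrow> dist (f u) (f u') \<le> K * norm (u - u')"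
    and cross: "\<And>u u'. u \<in> S \<Longrightarrow> u' \<in> S \<Longrightarrow> u \<in> H1 M \<Longrightarrow> u' \<in> H3 M \<Longrightarrow> dist (f u) (f u') \<le> K * norm (u - u')"
  shows "K-lipschitz_on S f"
proof (rule lipschitz_onI[OF _ K])
  fix u u' assume u: "u \<in> S" "u' \<in> S"
  then have "u \<in> H1 M \<or> u \<in> H3 M" "u' \<in> H1 M \<or> u' \<in> H3 M" using S by (auto simp: HH_def)
  then show "dist (f u) (f u') \<le> K * dist u u'"
    using same[OF u] cross[OF u] cross[OF u(2,1)]
    by (auto simp: dist_norm outer_speed_simps dist_commute norm_minus_commute)
qed

lemma outer_speed_lipschitz: "\<exists>L. L-lipschitz_on (HH M) (outer_speed M)"
proof -
  have "((c1 M - c3 M) / (wm M - wM M))-lipschitz_on (HH M) (outer_speed M)"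
  proof (rule phase_lipschitz[OF order_refl])
    fix u u' assume "u \<in> H1 M" "u' \<in> H3 M"
    then show "dist (outer_speed M u) (outer_speed M u') \<le> (c1 M - c3 M) / (wm M - wM M) * norm (u - u')"
      using mult_left_mono[OF phase_distance[of u u'], of "c1 M - c3 M"] c_pos
      by (simp add: dist_real_def outer_speed_simps)
  qed (use c_pos strain_pos in auto)
  then show ?thesis by blast
qed

text \<open>The strain of \<open>u\<close> is bounded, so that of \<open>u'\<close> is at most a
  constant plus the distance, and the strain gap absorbs the constant. A bound on the velocity of
  \<open>u\<close> extends this to \<open>h0 M u'\<close>.\<close>

lemma cross_bounds:
  assumes u: "u \<in> H1 M" "u' \<in> H3 M"
  shows "\<bar>snd u'\<bar> \<le> ((1 + wM M) / (wm M - wM M) + 1) * norm (u - u')"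
    and "\<bar>fst u\<bar> \<le> B \<Longrightarrow> 0 \<le> B \<Longrightarrow>
      \<bar>h0 M u'\<bar> \<le> ((1 + wM M + B / c3 M) / (wm M - wM M) + h0_const) * norm (u - u')"
proof -
  let ?n = "norm (u - u')" and ?d = "wm M - wM M"
  have n: "x / ?d * ?n \<ge> x" if "0 \<le> x" for x
    using mult_left_mono[OF phase_distance[OF u] that] by simp
  have w: "\<bar>snd u'\<bar> \<le> 1 + wM M + ?n"
    using low_strain_bound[OF u(1)] state_diff_le(2)[of u u'] by linarith
  also have "\<dots> \<le> ((1 + wM M) / ?d + 1) * ?n"
    using n[of "1 + wM M"] strain_pos by (simp add: distrib_right)
  finally show "\<bar>snd u'\<bar> \<le> ((1 + wM M) / (wm M - wM M) + 1) * ?n" .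
  assume B: "\<bar>fst u\<bar> \<le> B" "0 \<le> B"
  have v: "\<bar>fst u'\<bar> \<le> B + ?n" using state_diff_le(1)[of u u'] B by linarith
  have "\<bar>h0 M u'\<bar> \<le> \<bar>snd u'\<bar> + \<bar>fst u'\<bar> / c3 M"
    using c_pos u abs_triangle_ineq[of "snd u'" "fst u' / c3 M"] by (simp add: h0_def outer_speed_simps)
  also have "\<dots> \<le> (1 + wM M + ?n) + (B + ?n) / c3 M"
    using w v c_pos by (intro add_mono divide_right_mono) auto
  also have "\<dots> = (1 + wM M + B / c3 M) + h0_const * ?n"
    by (simp add: h0_const_def add_divide_distrib distrib_right)
  also have "\<dots> \<le> ((1 + wM M + B / c3 M) / ?d + h0_const) * ?n"
    using n[of "1 + wM M + B / c3 M"] strain_pos B c_pos by (simp add: distrib_right)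
  finally show "\<bar>h0 M u'\<bar> \<le> ((1 + wM M + B / c3 M) / (wm M - wM M) + h0_const) * ?n" .
qed

text \<open>Without nucleation \<open>h0\<close> is at most \<open>wM M\<close>, so
  \<open>u_star\<close> can only lie in the low-strain phase and \<open>h0\<close> exceeds -1.
  Bounds on \<open>h0\<close> and on the strain bound the velocity.\<close>

lemma elastic_low_bounds:
  assumes "u \<in> elastic_data M" "u \<in> H1 M"
  shows "\<bar>h0 M u\<bar> \<le> 1 + wM M" "\<bar>fst u\<bar> \<le> 2 * c1 M * (1 + wM M)"
proof -
  have "h0 M u \<le> wMcr M" "u_star M u \<in> HH M" using assms by (auto simp: elastic_data_def nucleates_def)
  then show h: "\<bar>h0 M u\<bar> \<le> 1 + wM M"
    using crit strain_pos by (auto simp: HH_def H1_iff H3_iff u_star_def)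
  have "\<bar>fst u\<bar> = c1 M * \<bar>h0 M u - snd u\<bar>"
    unfolding h0_low[OF assms(2)] using c_pos by (simp add: abs_mult)
  also have "\<dots> \<le> c1 M * (2 * (1 + wM M))"
    using h low_strain_bound[OF assms(2)] c_pos by (intro mult_left_mono) auto
  finally show "\<bar>fst u\<bar> \<le> 2 * c1 M * (1 + wM M)" by (simp add: algebra_simps)
qed

lemma u_star_lipschitz: "\<exists>L. L-lipschitz_on (elastic_data M) (u_star M)"
proof -
  define B where "B = 2 * c1 M * (1 + wM M)"
  define K where "K = (1 + wM M) / (wm M - wM M) + ((1 + wM M + B / c3 M) / (wm M - wM M) + h0_const)"
  have B: "0 \<le> B" using c_pos strain_pos by (simp add: B_def)
  have K: "h0_const \<le> K" "0 \<le> K"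
    using B c_pos strain_pos h0_const_pos by (simp_all add: K_def)
  have d: "dist (u_star M u) (u_star M u') = \<bar>h0 M u - h0 M u'\<bar>" for u u'
    by (simp add: u_star_def dist_norm)
  have "K-lipschitz_on (elastic_data M) (u_star M)"
  proof (rule phase_lipschitz[OF _ K(2)])
    show "elastic_data M \<subseteq> HH M" by (auto simp: elastic_data_def)
  next
    fix u u' assume "outer_speed M u = outer_speed M u'"
    from h0_lipschitz[OF this] mult_right_mono[OF K(1), of "norm (u - u')"]
    show "dist (u_star M u) (u_star M u') \<le> K * norm (u - u')" unfolding d by simp
  next
    fix u u' assume u: "u \<in> elastic_data M" "u \<in> H1 M" "u' \<in> H3 M"
    have "1 + wM M \<le> (1 + wM M) / (wm M - wM M) * norm (u - u')"
      using mult_left_mono[OF phase_distance[OF u(2,3)], of "1 + wM M"] strain_pos by simp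
    then show "dist (u_star M u) (u_star M u') \<le> K * norm (u - u')"
      using elastic_low_bounds[OF u(1,2)] cross_bounds(2)[OF u(2,3) _ B]
      unfolding B_def[symmetric] d K_def by (simp add: distrib_right)
  qed
  then show ?thesis by blast
qed

lemma phase_boundary_cases:
  assumes "phase_boundary_states M u0 um up V"
  obtains "u0 \<in> H1 M" | "u0 \<in> H3 M"
  using assms by (auto simp: phase_boundary_states_def)

lemma outgoing_state_diff_le:
  fixes p q :: state
  assumes "fst p = c * (h - w)" "fst q = c * (h' - w')" "snd p = w" "snd q = w'" "0 \<le> c"
    and "\<bar>w - w'\<bar> \<le> K * \<bar>h - h'\<bar>"
  shows "norm (p - q) \<le> (c + c * K + K) * \<bar>h - h'\<bar>"
proof -
  have "fst p - fst q = c * ((h - h') - (w - w'))" using assms by (simp add: algebra_simps)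
  then have "\<bar>fst p - fst q\<bar> \<le> c * (\<bar>h - h'\<bar> + \<bar>w - w'\<bar>)"
    using assms(5) by (simp add: abs_mult mult_left_mono abs_triangle_ineq4)
  also have "\<dots> \<le> c * (\<bar>h - h'\<bar> + K * \<bar>h - h'\<bar>)"
    using assms by (intro mult_left_mono add_left_mono)
  finally show ?thesis
    using norm_Pair_diff_le[of p q] assms by (simp add: algebra_simps)
qed

text \<open>From the high-strain phase all nucleated states are bounded. From the low-strain phase
  they grow linearly with \<open>h0\<close>, while \<open>c3 M - V\<close> decays like
  \<open>1 / h0\<close>.\<close>

lemma phase_boundary_bounds:
  "\<exists>K\<ge>0.
    (\<forall>u0 um up V. phase_boundary_states M u0 um up V \<and> u0 \<in> H3 M \<longrightarrow> 0 \<le> V \<and> V \<le> c3 M \<and>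
      0 \<le> h0 M u0 \<and> h0 M u0 \<le> K \<and> norm um \<le> K \<and> (V < c3 M \<longrightarrow> norm up \<le> K)) \<and>
    (\<forall>u0 um up V. phase_boundary_states M u0 um up V \<and> u0 \<in> H1 M \<longrightarrow> 0 \<le> V \<and> V < c3 M \<and>
      wMcr M < h0 M u0 \<and> norm um \<le> K * h0 M u0 \<and> norm up \<le> K * h0 M u0 \<and>
      \<bar>snd up\<bar> \<le> wM M \<and> fst um = 0 \<and> fst up = c1 M * (h0 M u0 - snd up) \<and>
      h0 M u0 * (c3 M - V) \<le> K \<and> \<bar>snd um - h0 M u0 * c1 M / c3 M\<bar> \<le> K)"
proof -
  obtain B where B: "0 \<le> B" "\<And>h z w V. slow_wave M h z w V \<Longrightarrow> V < c3 M \<Longrightarrow> w \<le> B"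
    using slow_states by blast
  obtain C where C: "0 \<le> C" "\<And>h z w V. fast_wave M h z w V \<Longrightarrow>
      z \<le> C * h \<and> h * (c3 M - V) \<le> C \<and> \<bar>z - h * c1 M / c3 M\<bar> \<le> C"
    using fast_states by blast
  define K where "K = wmcr M + wM M + (c3 M * (wmcr M + B) + B) + C + (c1 M + (c1 M * wM M + wM M) / wMcr M)"
  have K: "0 \<le> K" "wmcr M \<le> K" "wM M \<le> K" "c3 M * (wmcr M + B) + B \<le> K" "C \<le> K"
    "c1 M + (c1 M * wM M + wM M) / wMcr M \<le> K"
    using B(1) C(1) c_pos strain_pos crit by (simp_all add: K_def)
  show ?thesis
  proof (intro exI[of _ K] conjI[OF K(1)] conjI allI impI; elim conjE)
    fix u0 um up V assume p: "phase_boundary_states M u0 um up V" and u0: "u0 \<in> H3 M"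
    note s = slow_wave_of_states[OF p u0]
    have b: "0 \<le> V" "V \<le> c3 M" "wm M \<le> snd up" "0 \<le> h0 M u0" "h0 M u0 < wmcr M" "0 \<le> snd um" "snd um \<le> wM M"
      using s(1) by (auto simp: slow_wave_def)
    show "0 \<le> V" "V \<le> c3 M" "0 \<le> h0 M u0" "h0 M u0 \<le> K" using b K by auto
    show "norm um \<le> K" using norm_Pair_diff_le[of um 0] s(2) b K by simp
    show "norm up \<le> K" if "V < c3 M"
    proof -
      have w: "snd up \<le> B" by (rule B(2)[OF s(1) that])
      have "\<bar>fst up\<bar> = c3 M * \<bar>h0 M u0 - snd up\<bar>" unfolding s(3) using c_pos by (simp add: abs_mult)
      also have "\<dots> \<le> c3 M * (wmcr M + B)"
        using b w strain_pos B(1) c_pos by (intro mult_left_mono) auto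
      finally show ?thesis using norm_Pair_diff_le[of up 0] b w strain_pos K by simp
    qed
  next
    fix u0 um up V assume p: "phase_boundary_states M u0 um up V" and u0: "u0 \<in> H1 M"
    note s = fast_wave_of_states[OF p u0]
    have b: "0 < V" "V < c3 M" "0 < snd up" "snd up \<le> wM M" "wm M \<le> snd um" "wMcr M < h0 M u0"
      using s(1) by (auto simp: fast_wave_def)
    note c = C(2)[OF s(1)]
    show "0 \<le> V" "V < c3 M" "wMcr M < h0 M u0" "\<bar>snd up\<bar> \<le> wM M" "fst um = 0"
      "fst up = c1 M * (h0 M u0 - snd up)" "h0 M u0 * (c3 M - V) \<le> K"
      "\<bar>snd um - h0 M u0 * c1 M / c3 M\<bar> \<le> K" using b c K s by auto
    have h: "0 < h0 M u0" using b crit by simp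
    have "norm um \<le> C * h0 M u0" using norm_Pair_diff_le[of um 0] s(2) b strain_pos c by simp
    also have "\<dots> \<le> K * h0 M u0" using K h by (intro mult_right_mono) auto
    finally show "norm um \<le> K * h0 M u0" .
    have "\<bar>fst up\<bar> = c1 M * \<bar>h0 M u0 - snd up\<bar>" unfolding s(3) using c_pos by (simp add: abs_mult)
    then have up: "norm up \<le> c1 M * \<bar>h0 M u0 - snd up\<bar> + wM M" using norm_Pair_diff_le[of up 0] b by simp
    have "c1 M * \<bar>h0 M u0 - snd up\<bar> \<le> c1 M * (h0 M u0 + wM M)"
      using b h c_pos by (intro mult_left_mono) auto
    with up have "norm up \<le> c1 M * h0 M u0 + (c1 M * wM M + wM M)" by (simp add: distrib_left)
    \<comment> \<open>Nucleation keeps \<open>h0\<close> above \<open>wMcr M\<close>, so a constant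
      is a multiple of \<open>h0\<close>.\<close>
    also have "c1 M * wM M + wM M \<le> (c1 M * wM M + wM M) / wMcr M * h0 M u0"
    proof -
      have "(c1 M * wM M + wM M) / wMcr M * wMcr M \<le> (c1 M * wM M + wM M) / wMcr M * h0 M u0"
        using b crit c_pos strain_pos by (intro mult_left_mono) auto
      then show ?thesis using crit by simp
    qed
    also have "c1 M * h0 M u0 + (c1 M * wM M + wM M) / wMcr M * h0 M u0
        = (c1 M + (c1 M * wM M + wM M) / wMcr M) * h0 M u0" by (simp add: distrib_right)
    also have "\<dots> \<le> K * h0 M u0" using K h by (intro mult_right_mono) auto
    finally show "norm up \<le> K * h0 M u0" by simp
  qed
qed

text \<open>Within a phase everything depends on \<open>h0\<close> only. Across phases no continuity
  is at stake: it suffices that states and speeds are themselves of the order of the distance of the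
  data.\<close>

lemma phase_boundary_lipschitz:
  "\<exists>K\<ge>0. \<forall>u um up V u' um' up' V'. phase_boundary_states M u um up V \<and> phase_boundary_states M u' um' up' V' \<longrightarrow>
    norm (um - um') \<le> K * norm (u - u') \<and> \<bar>V - V'\<bar> \<le> K * norm (u - u') \<and>
    (V < outer_speed M u \<and> V' < outer_speed M u' \<longrightarrow> norm (up - up') \<le> K * norm (u - u'))"
proof -
  obtain S where S: "0 \<le> S" "\<And>h1 z1 w1 V1 h2 z2 w2 V2. slow_wave M h1 z1 w1 V1 \<Longrightarrow> slow_wave M h2 z2 w2 V2 \<Longrightarrow>
      \<bar>V1 - V2\<bar> \<le> S * \<bar>h1 - h2\<bar> \<and> \<bar>z1 - z2\<bar> \<le> S * \<bar>h1 - h2\<bar> \<and>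
      (V1 < c3 M \<and> V2 < c3 M \<longrightarrow> \<bar>w1 - w2\<bar> \<le> S * \<bar>h1 - h2\<bar>)"
    using slow_states by meson
  obtain F where F: "0 \<le> F" "\<And>h1 z1 w1 V1 h2 z2 w2 V2. fast_wave M h1 z1 w1 V1 \<Longrightarrow> fast_wave M h2 z2 w2 V2 \<Longrightarrow>
      \<bar>V1 - V2\<bar> \<le> F * \<bar>h1 - h2\<bar> \<and> \<bar>z1 - z2\<bar> \<le> F * \<bar>h1 - h2\<bar> \<and> \<bar>w1 - w2\<bar> \<le> F * \<bar>h1 - h2\<bar>"
    using fast_states by meson
  obtain B where B0: "0 \<le> B"
    and Bh: "\<forall>u0 um up V. phase_boundary_states M u0 um up V \<and> u0 \<in> H3 M \<longrightarrow> 0 \<le> V \<and> V \<le> c3 M \<and>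
      0 \<le> h0 M u0 \<and> h0 M u0 \<le> B \<and> norm um \<le> B \<and> (V < c3 M \<longrightarrow> norm up \<le> B)"
    and Bl: "\<forall>u0 um up V. phase_boundary_states M u0 um up V \<and> u0 \<in> H1 M \<longrightarrow> 0 \<le> V \<and> V < c3 M \<and>
      wMcr M < h0 M u0 \<and> norm um \<le> B * h0 M u0 \<and> norm up \<le> B * h0 M u0 \<and>
      \<bar>snd up\<bar> \<le> wM M \<and> fst um = 0 \<and> fst up = c1 M * (h0 M u0 - snd up) \<and>
      h0 M u0 * (c3 M - V) \<le> B \<and> \<bar>snd um - h0 M u0 * c1 M / c3 M\<bar> \<le> B"
    using phase_boundary_bounds by (elim exE conjE) (rule that)
  let ?d = "wm M - wM M"
  define G where "G = (1 + wM M) / ?d + 1"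
  define E where "E = (1 + wM M + c3 M * B / c1 M) / ?d + (c3 M * G + 1) / c1 M"
  have G: "0 \<le> G" using strain_pos by (simp add: G_def)
  have E: "0 \<le> E" using strain_pos c_pos B0 G by (simp add: E_def)
  define K where "K = (S + (c3 M + c3 M * S + S)) * h0_const + (F + (c1 M + c1 M * F + F)) * h0_const
      + (B * E + B / ?d) + c3 M / ?d"
  define K1 where "K1 = (S + (c3 M + c3 M * S + S)) * h0_const"
  define K2 where "K2 = (F + (c1 M + c1 M * F + F)) * h0_const"
  have K0: "0 \<le> K1" "0 \<le> K2" "0 \<le> B * E + B / ?d" "0 \<le> c3 M / ?d"
    using S(1) F(1) c_pos h0_const_pos B0 E strain_pos by (simp_all add: K1_def K2_def)
  then have K: "0 \<le> K" "K1 \<le> K" "K2 \<le> K" "B * E + B / ?d \<le> K" "c3 M / ?d \<le> K"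
    unfolding K_def K1_def[symmetric] K2_def[symmetric] by linarith+
  have up_le: "x \<le> K * n" if "x \<le> X * \<bar>h\<bar>" "X * h0_const \<le> K" "\<bar>h\<bar> \<le> h0_const * n" "0 \<le> X" "0 \<le> n" for x X h n
  proof -
    have "x \<le> X * (h0_const * n)" using that(1) mult_left_mono[OF that(3,4)] by linarith
    also have "\<dots> \<le> K * n" using mult_right_mono[OF that(2,5)] by (simp add: mult.assoc)
    finally show ?thesis .
  qed
  have high: "norm (um - um') \<le> K * norm (u - u') \<and> \<bar>V - V'\<bar> \<le> K * norm (u - u') \<and>
    (V < outer_speed M u \<and> V' < outer_speed M u' \<longrightarrow> norm (up - up') \<le> K * norm (u - u'))"
    if p: "phase_boundary_states M u um up V" "phase_boundary_states M u' um' up' V'"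
      and u: "u \<in> H3 M" "u' \<in> H3 M" for u um up V u' um' up' V'
  proof -
    note s = slow_wave_of_states[OF p(1) u(1)] and s' = slow_wave_of_states[OF p(2) u(2)]
    note l = S(2)[OF s(1) s'(1)]
    have h: "\<bar>h0 M u - h0 M u'\<bar> \<le> h0_const * norm (u - u')"
      using u by (intro h0_lipschitz) (simp add: outer_speed_simps)
    have X: "S * h0_const \<le> K" "(c3 M + c3 M * S + S) * h0_const \<le> K"
      using K(2) S(1) c_pos h0_const_pos unfolding K1_def distrib_right[of S]
      by (smt (verit) mult_nonneg_nonneg)+
    have "norm (um - um') \<le> S * \<bar>h0 M u - h0 M u'\<bar>"
      using norm_Pair_diff_le[of um um'] l s(2) s'(2) by simp
    moreover have "norm (up - up') \<le> (c3 M + c3 M * S + S) * \<bar>h0 M u - h0 M u'\<bar>" if "V < c3 M" "V' < c3 M"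
      using l that c_pos by (intro outgoing_state_diff_le[OF s(3) s'(3)]) auto
    ultimately show ?thesis
      using l S(1) c_pos u by (auto simp: outer_speed_simps intro: up_le[OF _ X(1) h] up_le[OF _ X(2) h])
  qed
  have low: "norm (um - um') \<le> K * norm (u - u') \<and> \<bar>V - V'\<bar> \<le> K * norm (u - u') \<and>
    (V < outer_speed M u \<and> V' < outer_speed M u' \<longrightarrow> norm (up - up') \<le> K * norm (u - u'))"
    if p: "phase_boundary_states M u um up V" "phase_boundary_states M u' um' up' V'"
      and u: "u \<in> H1 M" "u' \<in> H1 M" for u um up V u' um' up' V'
  proof -
    note s = fast_wave_of_states[OF p(1) u(1)] and s' = fast_wave_of_states[OF p(2) u(2)]
    note l = F(2)[OF s(1) s'(1)]
    have h: "\<bar>h0 M u - h0 M u'\<bar> \<le> h0_const * norm (u - u')"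
      using u by (intro h0_lipschitz) (simp add: outer_speed_simps)
    have X: "F * h0_const \<le> K" "(c1 M + c1 M * F + F) * h0_const \<le> K"
      using K(3) F(1) c_pos h0_const_pos unfolding K2_def distrib_right[of F]
      by (smt (verit) mult_nonneg_nonneg)+
    have "norm (um - um') \<le> F * \<bar>h0 M u - h0 M u'\<bar>"
      using norm_Pair_diff_le[of um um'] l s(2) s'(2) by simp
    moreover have "norm (up - up') \<le> (c1 M + c1 M * F + F) * \<bar>h0 M u - h0 M u'\<bar>"
      using l c_pos by (intro outgoing_state_diff_le[OF s(3) s'(3)]) auto
    ultimately show ?thesis
      using l F(1) c_pos u by (auto intro: up_le[OF _ X(1) h] up_le[OF _ X(2) h])
  qed
  have cross: "norm (um - um') \<le> K * norm (u - u') \<and> \<bar>V - V'\<bar> \<le> K * norm (u - u') \<and>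
    (V < outer_speed M u \<and> V' < outer_speed M u' \<longrightarrow> norm (up - up') \<le> K * norm (u - u'))"
    if p: "phase_boundary_states M u um up V" "phase_boundary_states M u' um' up' V'"
      and u: "u \<in> H1 M" "u' \<in> H3 M" for u um up V u' um' up' V'
  proof -
    let ?n = "norm (u - u')"
    note b = Bl[rule_format, OF conjI[OF p(1) u(1)]] and b' = Bh[rule_format, OF conjI[OF p(2) u(2)]]
    have n: "x \<le> x / ?d * ?n" if "0 \<le> x" for x
      using mult_left_mono[OF phase_distance[OF u] that] by simp
    have w': "\<bar>snd u'\<bar> \<le> G * ?n" using cross_bounds(1)[OF u] by (simp add: G_def)
    \<comment> \<open>A nucleating \<open>u'\<close> has bounded \<open>h0\<close>, so its strain
      controls its velocity, and both are of the order of the distance. Hence so is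
      \<open>h0 M u\<close>, the quantity without an a priori bound.\<close>
    have "\<bar>fst u'\<bar> = c3 M * \<bar>h0 M u' - snd u'\<bar>"
      unfolding h0_high[OF u(2)] using c_pos by (simp add: abs_mult)
    also have "\<dots> \<le> c3 M * (B + G * ?n)" using b' w' c_pos by (intro mult_left_mono) auto
    finally have "\<bar>fst u\<bar> \<le> c3 M * (B + G * ?n) + ?n" using state_diff_le(1)[of u u'] by linarith
    then have "\<bar>fst u\<bar> / c1 M \<le> (c3 M * (B + G * ?n) + ?n) / c1 M" using c_pos by (simp add: divide_right_mono)
    moreover have "h0 M u \<le> \<bar>snd u\<bar> + \<bar>fst u\<bar> / c1 M"
      using c_pos u by (simp add: h0_def outer_speed_simps add_mono divide_right_mono)
    ultimately have "h0 M u \<le> 1 + wM M + (c3 M * (B + G * ?n) + ?n) / c1 M"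
      using low_strain_bound[OF u(1)] by linarith
    also have "\<dots> = (1 + wM M + c3 M * B / c1 M) + (c3 M * G + 1) / c1 M * ?n"
      using c_pos by (simp add: field_simps)
    also have "\<dots> \<le> E * ?n"
      using n[of "1 + wM M + c3 M * B / c1 M"] strain_pos c_pos B0 by (simp add: E_def distrib_right)
    finally have h: "B * h0 M u \<le> B * E * ?n" using mult_left_mono[OF _ B0] by (simp add: mult.assoc)
    have sum: "B * h0 M u + B \<le> K * ?n"
    proof -
      have "B * h0 M u + B \<le> (B * E + B / ?d) * ?n" using h n[OF B0] by (simp add: distrib_right)
      also have "\<dots> \<le> K * ?n" using K by (intro mult_right_mono) auto
      finally show ?thesis .
    qed
    have "norm (um - um') \<le> K * ?n" using norm_triangle_ineq4[of um um'] b b' sum by linarith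
    moreover have "norm (up - up') \<le> K * ?n" if "V' < c3 M"
      using norm_triangle_ineq4[of up up'] b b' sum that by linarith
    moreover have "\<bar>V - V'\<bar> \<le> c3 M" using b b' by linarith
    then have "\<bar>V - V'\<bar> \<le> K * ?n"
      using n[of "c3 M"] c_pos mult_right_mono[OF K(5) norm_ge_zero[of "u - u'"]] by linarith
    ultimately show ?thesis using u by (simp add: outer_speed_simps)
  qed
  show ?thesis
  proof (intro exI[of _ K] conjI[OF K(1)] allI impI; elim conjE)
    fix u um up V u' um' up' V'
    assume p: "phase_boundary_states M u um up V" "phase_boundary_states M u' um' up' V'"
    show "norm (um - um') \<le> K * norm (u - u') \<and> \<bar>V - V'\<bar> \<le> K * norm (u - u') \<and>
      (V < outer_speed M u \<and> V' < outer_speed M u' \<longrightarrow> norm (up - up') \<le> K * norm (u - u'))"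
    proof -
      have "u \<in> H1 M \<or> u \<in> H3 M" "u' \<in> H1 M \<or> u' \<in> H3 M"
        using p by (auto simp: phase_boundary_states_def)
      then show ?thesis
        using high[OF p] low[OF p] cross[OF p] cross[OF p(2,1)]
        by (elim disjE) (simp_all add: norm_minus_commute abs_minus_commute)
    qed
  qed
qed

lemma phase_boundary_selection:
  "\<exists>L Um Up Vs.
    L-lipschitz_on (phase_boundary_data M) (Um :: state \<Rightarrow> state) \<and>
    L-lipschitz_on (phase_boundary_data M) (Up :: state \<Rightarrow> state) \<and>
    L-lipschitz_on (phase_boundary_data M) (Vs :: state \<Rightarrow> real) \<and>
    (\<forall>u0 um up V. phase_boundary_states M u0 um up V \<longrightarrow>
      um = Um u0 \<and> V = Vs u0 \<and> (V < outer_speed M u0 \<longrightarrow> up = Up u0))"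
proof -
  obtain K where K: "0 \<le> K" "\<And>u um up V u' um' up' V'. phase_boundary_states M u um up V \<Longrightarrow>
    phase_boundary_states M u' um' up' V' \<Longrightarrow>
    norm (um - um') \<le> K * norm (u - u') \<and> \<bar>V - V'\<bar> \<le> K * norm (u - u') \<and>
    (V < outer_speed M u \<and> V' < outer_speed M u' \<longrightarrow> norm (up - up') \<le> K * norm (u - u'))"
    using phase_boundary_lipschitz by meson
  let ?D = "phase_boundary_data M"
  have "\<exists>f. K-lipschitz_on {u. \<exists>um. \<exists>up V. phase_boundary_states M u um up V} f \<and>
      (\<forall>u um. (\<exists>up V. phase_boundary_states M u um up V) \<longrightarrow> um = f u)"
    by (rule lipschitz_selection[OF K(1)]) (use K(2) in \<open>fastforce simp: dist_norm\<close>)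
  then obtain Um where Um: "K-lipschitz_on ?D Um" "\<And>u um up V. phase_boundary_states M u um up V \<Longrightarrow> um = Um u"
    unfolding phase_boundary_data_def by blast
  have "\<exists>f. K-lipschitz_on {u. \<exists>V. \<exists>um up. phase_boundary_states M u um up V} f \<and>
      (\<forall>u V. (\<exists>um up. phase_boundary_states M u um up V) \<longrightarrow> V = f u)"
    by (rule lipschitz_selection[OF K(1)]) (use K(2) in \<open>fastforce simp: dist_norm\<close>)
  moreover have "{u. \<exists>V. \<exists>um up. phase_boundary_states M u um up V} = ?D"
    unfolding phase_boundary_data_def by blast
  ultimately obtain Vs where Vs: "K-lipschitz_on ?D Vs" "\<And>u um up V. phase_boundary_states M u um up V \<Longrightarrow> V = Vs u"
    by metis
  \<comment> \<open>\<open>up\<close> is unique only if its sector is nonempty; it is selected for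
    these data, and the two components are extended to all others.\<close>
  let ?R = "\<lambda>u up. \<exists>um V. phase_boundary_states M u um up V \<and> V < outer_speed M u"
  have "\<exists>f. K-lipschitz_on {u. \<exists>up. ?R u up} f \<and> (\<forall>u up. ?R u up \<longrightarrow> up = f u)"
    by (rule lipschitz_selection[OF K(1)]) (use K(2) in \<open>fastforce simp: dist_norm\<close>)
  then obtain f where f: "K-lipschitz_on {u. \<exists>up. ?R u up} f" "\<And>u up. ?R u up \<Longrightarrow> up = f u"
    by blast
  have "K-lipschitz_on {u. \<exists>up. ?R u up} (\<lambda>u. fst (f u))"
    by (rule lipschitz_onI[OF _ K(1)], rule order_trans[OF dist_fst_le lipschitz_onD[OF f(1)]])
  then obtain g1 where g1: "K-lipschitz_on UNIV g1" "\<And>u. \<exists>up. ?R u up \<Longrightarrow> g1 u = fst (f u)"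
    by (auto dest: lipschitz_extend_real)
  have "K-lipschitz_on {u. \<exists>up. ?R u up} (\<lambda>u. snd (f u))"
    by (rule lipschitz_onI[OF _ K(1)], rule order_trans[OF dist_snd_le lipschitz_onD[OF f(1)]])
  then obtain g2 where g2: "K-lipschitz_on UNIV g2" "\<And>u. \<exists>up. ?R u up \<Longrightarrow> g2 u = snd (f u)"
    by (auto dest: lipschitz_extend_real)
  let ?L = "sqrt (K\<^sup>2 + K\<^sup>2)"
  have "?L-lipschitz_on ?D (\<lambda>u. (g1 u, g2 u))"
    by (intro lipschitz_on_Pair lipschitz_on_subset[OF g1(1)] lipschitz_on_subset[OF g2(1)] subset_UNIV)
  moreover have "K \<le> ?L" using K(1) by (intro real_le_rsqrt) simp
  moreover have "up = (g1 u, g2 u)" if "phase_boundary_states M u um up V" "V < outer_speed M u" for u um up V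
  proof -
    have "\<exists>up. ?R u up" "?R u up" using that by blast+
    then show ?thesis using f(2)[of u up] g1(2)[of u] g2(2)[of u] by simp
  qed
  ultimately show ?thesis
    using Um Vs by (intro exI[of _ ?L] exI[of _ Um] exI[of _ "\<lambda>u. (g1 u, g2 u)"] exI[of _ Vs])
      (auto intro: lipschitz_on_mono)
qed

end

section \<open>Stability of the solutions\<close>

definition profile :: "(real \<Rightarrow> real \<Rightarrow> state) \<Rightarrow> state \<Rightarrow> state \<Rightarrow> state \<Rightarrow> real \<Rightarrow> real \<Rightarrow> bool" where
  "profile u um up u0 V s \<longleftrightarrow> (\<forall>t\<ge>0. \<forall>x>0.
     (x < V * t \<longrightarrow> u t x = um) \<and> (V * t < x \<and> x < s * t \<longrightarrow> u t x = up) \<and> (s * t < x \<longrightarrow> u t x = u0))"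

text \<open>The single-wave solution has a fictitious boundary of speed 0, whose inner state is arbitrary.\<close>
lemma riemann_solution_cases:
  assumes "riemann_solution M u0 u"
  obtains "u0 \<in> elastic_data M" "\<And>um. profile u um (u_star M u0) u0 0 (outer_speed M u0)"
  | um up V where "phase_boundary_states M u0 um up V" "profile u um up u0 V (outer_speed M u0)"
proof -
  from assms consider
    "u0 \<in> elastic_data M" "\<forall>t\<ge>0. \<forall>x>0. (x < outer_speed M u0 * t \<longrightarrow> u t x = u_star M u0) \<and>
         (outer_speed M u0 * t < x \<longrightarrow> u t x = u0)"
    | um up V where "phase_boundary_states M u0 um up V" "profile u um up u0 V (outer_speed M u0)"
    unfolding riemann_solution_def profile_def by blast
  then show ?thesis
  proof cases
    case 1
    then show ?thesis by (intro that(1)) (auto simp: profile_def)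
  next
    case 2
    then show ?thesis by (rule that(2))
  qed
qed

text \<open>The sound waves share the speed \<open>s\<close>, so states of different kind face each
  other only between \<open>V * t\<close> and \<open>V' * t\<close>. The width of this sector is of
  order \<open>t\<close>, which the summand \<open>c * t\<close> in the enlarged interval length
  pays for.\<close>

lemma profile_stability:
  assumes p: "profile u um up u0 V s" "profile u' um' up' u0' V' s" and V: "V \<le> V'" "V' \<le> s"
    and K: "norm (um - um') \<le> K" "V' < s \<Longrightarrow> norm (up - up') \<le> K" "norm (u0 - u0') \<le> K"
      "V < V' \<Longrightarrow> norm (up - um') * (V' - V) \<le> K"
    and c: "0 < c" and A: "0 < A" "A < B" "0 \<le> t"
  shows "integral {A..B} (\<lambda>x. norm (u t x - u' t x)) \<le> (K + K / c) * (B + c * t - max 0 (A - c * t))"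
proof -
  let ?X = "B + c * t - max 0 (A - c * t)"
  have ct: "0 \<le> c * t" using c A by simp
  then have X: "B - A \<le> ?X" "c * t \<le> ?X" using A by auto
  have K0: "0 \<le> K" using K(1) norm_ge_zero order_trans by blast
  have "integral {A..B} (\<lambda>x. norm (u t x - u' t x))
      \<le> K * (B - A) + norm (up - um') * max 0 (V' * t - V * t)"
  proof (rule integral_le_step[where S = "{V * t, V' * t, s * t}"])
    fix x assume x: "x \<in> {A..B} - {V * t, V' * t, s * t}"
    then have x0: "0 < x" using A by simp
    note u = p(1)[unfolded profile_def, rule_format, OF A(3) x0]
      and u' = p(2)[unfolded profile_def, rule_format, OF A(3) x0]
    have VV: "V * t \<le> V' * t" using V A by (simp add: mult_right_mono)
    consider "x < V * t" | "V * t < x" "x < V' * t" "x < s * t" | "V * t < x" "x < V' * t" "s * t < x"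
      | "V' * t < x" "x < s * t" | "V' * t < x" "s * t < x"
      using x by fastforce
    then show "norm (u t x - u' t x) \<le> K + (if V * t < x \<and> x < V' * t then norm (up - um') else 0)"
    proof cases
      case 1
      then show ?thesis using u u' VV K(1) by simp
    next
      case 2
      then show ?thesis using u u' K0 by simp
    next
      case 3
      \<comment> \<open>Here the outer state of \<open>u\<close> would meet \<open>um'\<close>; the
        region is empty because \<open>V' \<le> s\<close>.\<close>
      moreover have "V' * t \<le> s * t" using V A by (simp add: mult_right_mono)
      ultimately show ?thesis by simp
    next
      case 4
      then have "V' < s" using A by (meson less_trans mult_right_less_imp_less)
      then show ?thesis using 4 u u' VV K(2) by simp
    next
      case 5
      then show ?thesis using u u' VV K(3) by simp
    qed
  qed (use A K0 in auto)
  also have "max 0 (V' * t - V * t) = (V' - V) * t"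
    using V A by (simp add: left_diff_distrib mult_right_mono)
  also have "norm (up - um') * ((V' - V) * t) \<le> K / c * (c * t)"
  proof (cases "V < V'")
    case True
    have "norm (up - um') * (V' - V) * t \<le> K * t" using K(4)[OF True] A by (intro mult_right_mono)
    then show ?thesis using c by simp
  next
    case False
    then show ?thesis using V K0 A by simp
  qed
  also have "K * (B - A) + K / c * (c * t) \<le> K * ?X + K / c * ?X"
    using X K0 c by (intro add_mono mult_left_mono) auto
  finally show ?thesis by (simp add: distrib_right)
qed


section \<open>Onset of nucleation and stability within one phase\<close>

context bar_model
begin

text \<open>Compare with a nucleated boundary of nearly vanishing speed: its \<open>h0\<close> is
  below \<open>wmcr M\<close>, so the speed estimate bounds \<open>V\<close> by the distance of
  \<open>h0 M u\<close> to the critical value.\<close>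

lemma nonabrupt_high:
  "\<exists>K\<ge>0. \<not> abrupt_nucleation M (H3 M) \<longrightarrow>
    (\<forall>u um up V. phase_boundary_states M u um up V \<and> u \<in> H3 M \<longrightarrow> V \<le> K * (wmcr M - h0 M u))"
proof -
  obtain K where K: "0 \<le> K" and K2: "\<And>h1 z1 w1 V1 h2 z2 w2 V2. slow_wave M h1 z1 w1 V1 \<Longrightarrow>
    slow_wave M h2 z2 w2 V2 \<Longrightarrow> V1 < V2 \<Longrightarrow> V2 - V1 \<le> K * (h1 - h2)"
    using slow_speed by meson
  have "V \<le> K * (wmcr M - h0 M u)"
    if n: "\<not> abrupt_nucleation M (H3 M)" and p: "phase_boundary_states M u um up V" "u \<in> H3 M" for u um up V
  proof (rule ccontr)
    assume "\<not> V \<le> K * (wmcr M - h0 M u)"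
    then have e: "0 < V - K * (wmcr M - h0 M u)" by simp
    obtain u' um' up' V' where p': "u' \<in> H3 M" "phase_boundary_states M u' um' up' V'"
      and V': "V' < V - K * (wmcr M - h0 M u)"
      using n e unfolding abrupt_nucleation_def by (meson not_le)
    note s = slow_wave_of_states(1)[OF p] and s' = slow_wave_of_states(1)[OF p'(2,1)]
    have "h0 M u \<le> wmcr M" "h0 M u' \<le> wmcr M" using s s' by (auto simp: slow_wave_def)
    then have "K * (h0 M u' - h0 M u) \<le> K * (wmcr M - h0 M u)" "0 \<le> K * (wmcr M - h0 M u)"
      using K by (auto intro: mult_left_mono)
    then show False using K2[OF s' s] V' by linarith
  qed
  then show ?thesis using K by blast
qed

text \<open>The same comparison with slow boundaries, but for \<open>V * h0 M u\<close>, since the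
  nucleated states grow with \<open>h0\<close>.\<close>

lemma nonabrupt_low:
  "\<exists>K\<ge>0. \<not> abrupt_nucleation M (H1 M) \<longrightarrow>
    (\<forall>u um up V. phase_boundary_states M u um up V \<and> u \<in> H1 M \<longrightarrow> V * h0 M u \<le> K * (h0 M u - wMcr M))"
proof -
  obtain K where K: "0 \<le> K" and K2: "\<And>h1 z1 w1 V1 h2 z2 w2 V2. fast_wave M h1 z1 w1 V1 \<Longrightarrow>
    fast_wave M h2 z2 w2 V2 \<Longrightarrow> V1 \<le> V2 \<Longrightarrow> h1 * (V2 - V1) \<le> K * (h2 - h1)"
    using fast_speed by meson
  have "V * h0 M u \<le> (c3 M + K) * (h0 M u - wMcr M)"
    if n: "\<not> abrupt_nucleation M (H1 M)" and p: "phase_boundary_states M u um up V" "u \<in> H1 M" for u um up V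
  proof -
    note s = fast_wave_of_states(1)[OF p]
    have V: "0 < V" "V < c3 M" and h: "wMcr M < h0 M u" using s by (auto simp: fast_wave_def)
    have "V \<le> K * (h0 M u - wMcr M) / wMcr M"
    proof (rule ccontr)
      let ?r = "K * (h0 M u - wMcr M) / wMcr M"
      assume "\<not> V \<le> ?r"
      then have e: "0 < V - ?r" by simp
      obtain u' um' up' V' where p': "u' \<in> H1 M" "phase_boundary_states M u' um' up' V'"
        and V': "V' < V - ?r"
        using n e unfolding abrupt_nucleation_def by (meson not_le)
      note s' = fast_wave_of_states(1)[OF p'(2,1)]
      have h': "wMcr M < h0 M u'" using s' by (auto simp: fast_wave_def)
      have "0 \<le> ?r" using K h crit by simp
      then have VV: "V' \<le> V" using V' by simp
      have "wMcr M * (V - V') \<le> h0 M u' * (V - V')" using h' VV by (intro mult_right_mono) auto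
      also have "\<dots> \<le> K * (h0 M u - h0 M u')" by (rule K2[OF s' s VV])
      also have "\<dots> \<le> K * (h0 M u - wMcr M)" using K h' by (intro mult_left_mono) auto
      finally have "V - V' \<le> ?r" using crit by (simp add: pos_le_divide_eq mult.commute)
      then show False using V' by simp
    qed
    then have "V * wMcr M \<le> K * (h0 M u - wMcr M)" using crit by (simp add: pos_le_divide_eq)
    \<comment> \<open>The weight \<open>h0 M u\<close> is split into \<open>wMcr M\<close>, covered
      by the comparison, and the excess, covered by \<open>V < c3 M\<close>.\<close>
    moreover have "V * (h0 M u - wMcr M) \<le> c3 M * (h0 M u - wMcr M)"
      using V h by (intro mult_right_mono) auto
    ultimately show ?thesis by (simp add: algebra_simps)
  qed
  moreover have "0 \<le> c3 M + K" using K c_pos by simp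
  ultimately show ?thesis by blast
qed

text \<open>Since the wall velocity is 0, the jump condition makes the velocity of \<open>up\<close>
  at most \<open>V\<close> times the strain jump. The sound wave relation then brings the strain of
  \<open>up\<close> close to \<open>h\<close>, so a slow boundary leaves \<open>up\<close> close to
  the elastic state \<open>(0, h)\<close>.\<close>

lemma onset_estimate:
  assumes p: "phase_boundary_states M u um up V" and c: "fst up = c * (h - snd up)" "0 < c"
    and D: "\<bar>h' - h\<bar> \<le> D" and Q: "V * norm um \<le> Q" "V * norm up \<le> Q"
  shows "norm ((0, h') - up) \<le> D + 2 * Q * (1 + 1 / c)"
proof -
  have V: "0 \<le> V" and "fst up = - V * (snd up - snd um)"
    using p by (auto simp: phase_boundary_states_def RH_def algebra_simps)
  then have "\<bar>fst up\<bar> = V * \<bar>snd up - snd um\<bar>" by (simp add: abs_mult)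
  also have "\<dots> \<le> V * (norm up + norm um)"
    using state_diff_le(2)[of up um] norm_triangle_ineq4[of up um] V by (intro mult_left_mono) auto
  finally have v: "\<bar>fst up\<bar> \<le> 2 * Q" using Q by (simp add: distrib_left)
  have "c * \<bar>h - snd up\<bar> \<le> 2 * Q" using v c by (simp add: abs_mult)
  then have "\<bar>h - snd up\<bar> \<le> 2 * Q / c" using c(2) by (simp add: pos_le_divide_eq mult.commute)
  then show ?thesis
    using norm_Pair_diff_le[of "(0, h')" up] v D by (simp add: distrib_left)
qed

text \<open>The two data lie on opposite sides of the critical value, so the distance of
  \<open>h0 M u2\<close> to it is at most \<open>\<bar>h0 M u1 - h0 M u2\<bar>\<close>. The bounds
  without abruptness then make \<open>V\<close> times the size of the states of the order of the
  distance of the data.\<close>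

lemma nucleation_onset:
  "\<exists>C\<ge>0. \<forall>u1 u2 um up V. u1 \<in> elastic_data M \<and> phase_boundary_states M u2 um up V \<and>
    outer_speed M u1 = outer_speed M u2 \<and> \<not> abruptly_separated M u1 u2 \<longrightarrow>
    (V < outer_speed M u2 \<longrightarrow> norm (u_star M u1 - up) \<le> C * norm (u1 - u2)) \<and>
    norm (u_star M u1 - um) * V \<le> C * norm (u1 - u2)"
proof -
  obtain B where B0: "0 \<le> B"
    and Bh: "\<forall>u0 um up V. phase_boundary_states M u0 um up V \<and> u0 \<in> H3 M \<longrightarrow> 0 \<le> V \<and> V \<le> c3 M \<and>
      0 \<le> h0 M u0 \<and> h0 M u0 \<le> B \<and> norm um \<le> B \<and> (V < c3 M \<longrightarrow> norm up \<le> B)"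
    and Bl: "\<forall>u0 um up V. phase_boundary_states M u0 um up V \<and> u0 \<in> H1 M \<longrightarrow> 0 \<le> V \<and> V < c3 M \<and>
      wMcr M < h0 M u0 \<and> norm um \<le> B * h0 M u0 \<and> norm up \<le> B * h0 M u0 \<and>
      \<bar>snd up\<bar> \<le> wM M \<and> fst um = 0 \<and> fst up = c1 M * (h0 M u0 - snd up) \<and>
      h0 M u0 * (c3 M - V) \<le> B \<and> \<bar>snd um - h0 M u0 * c1 M / c3 M\<bar> \<le> B"
    using phase_boundary_bounds by (elim exE conjE) (rule that)
  obtain S where S: "0 \<le> S" and S2: "\<And>u um up V. \<not> abrupt_nucleation M (H3 M) \<Longrightarrow>
    phase_boundary_states M u um up V \<Longrightarrow> u \<in> H3 M \<Longrightarrow> V \<le> S * (wmcr M - h0 M u)"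
    using nonabrupt_high by meson
  obtain F where F: "0 \<le> F" and F2: "\<And>u um up V. \<not> abrupt_nucleation M (H1 M) \<Longrightarrow>
    phase_boundary_states M u um up V \<Longrightarrow> u \<in> H1 M \<Longrightarrow> V * h0 M u \<le> F * (h0 M u - wMcr M)"
    using nonabrupt_low by meson
  let ?H = h0_const
  define Q where "Q = B * (S * ?H) + B * (F * ?H) + (1 + wM M) / wMcr M * (F * ?H)"
  have Q0: "0 \<le> B * (S * ?H)" "0 \<le> B * (F * ?H)" "0 \<le> (1 + wM M) / wMcr M * (F * ?H)"
    using B0 S F h0_const_pos strain_pos crit by simp_all
  then have Q: "B * (S * ?H) \<le> Q" "B * (F * ?H) \<le> Q" "(1 + wM M) / wMcr M * (F * ?H) \<le> Q" "0 \<le> Q"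
    by (simp_all add: Q_def)
  define C where "C = ?H + 2 * Q * (1 + 1 / c3 M) + ?H * c3 M + 2 * Q"
  have C: "0 \<le> C" "?H + 2 * Q * (1 + 1 / c3 M) \<le> C" "?H * c3 M + 2 * Q \<le> C"
    using Q(4) h0_const_pos c_pos by (simp_all add: C_def)
  have main: "(V < outer_speed M u2 \<longrightarrow> norm (u_star M u1 - up) \<le> C * norm (u1 - u2)) \<and>
      norm (u_star M u1 - um) * V \<le> C * norm (u1 - u2)"
    if u1: "u1 \<in> elastic_data M" and p: "phase_boundary_states M u2 um up V"
      and o: "outer_speed M u1 = outer_speed M u2" and na: "\<not> abruptly_separated M u1 u2" for u1 u2 um up V
  proof -
    let ?n = "norm (u1 - u2)"
    have dh: "\<bar>h0 M u1 - h0 M u2\<bar> \<le> ?H * ?n" by (rule h0_lipschitz[OF o])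
    have nuc: "nucleates M u1 \<noteq> nucleates M u2"
      using u1 p by (auto simp: elastic_data_def phase_boundary_states_def)
    have both: "u1 \<in> H3 M \<and> u2 \<in> H3 M \<or> u1 \<in> H1 M \<and> u2 \<in> H1 M"
    proof -
      have "u1 \<in> H1 M \<or> u1 \<in> H3 M" "u2 \<in> H1 M \<or> u2 \<in> H3 M"
        using u1 p by (auto simp: elastic_data_def HH_def phase_boundary_states_def)
      then show ?thesis using o c_pos(2) by (auto simp: outer_speed_simps)
    qed
    have QC: "a + b \<le> C * ?n" if "a \<le> X * ?n" "b \<le> Y * ?n" "X + Y \<le> C" for a b X Y
      using that(1,2) mult_right_mono[OF that(3) norm_ge_zero[of "u1 - u2"]] by (simp add: distrib_right)
    have fin: ?thesis
      if V: "0 \<le> V" "V \<le> c3 M" and c: "fst up = c * (h0 M u2 - snd up)" "c3 M \<le> c"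
        and um: "V * norm um \<le> Q * ?n" and up: "V < outer_speed M u2 \<Longrightarrow> V * norm up \<le> Q * ?n"
        and h1: "\<bar>h0 M u1\<bar> * V \<le> ?H * c3 M * ?n + Q * ?n" for c
    proof -
      have c0: "0 < c" using c c_pos by simp
      have "norm (u_star M u1 - up) \<le> C * ?n" if "V < outer_speed M u2"
      proof -
        have "norm (u_star M u1 - up) \<le> ?H * ?n + 2 * (Q * ?n) * (1 + 1 / c)"
          unfolding u_star_def by (rule onset_estimate[OF p c(1) c0 dh um up[OF that]])
        also have "2 * (Q * ?n) * (1 + 1 / c) \<le> 2 * (Q * ?n) * (1 + 1 / c3 M)"
          using c Q(4) c_pos by (intro mult_left_mono add_left_mono frac_le) auto
        finally have "norm (u_star M u1 - up) \<le> (?H + 2 * Q * (1 + 1 / c3 M)) * ?n"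
          by (simp add: algebra_simps)
        also have "\<dots> \<le> C * ?n" using C by (intro mult_right_mono) auto
        finally show ?thesis .
      qed
      moreover have "norm (u_star M u1 - um) * V \<le> C * ?n"
      proof -
        have "norm (u_star M u1 - um) \<le> \<bar>h0 M u1\<bar> + norm um"
          using norm_triangle_ineq4[of "u_star M u1" um] by (simp add: u_star_def)
        then have "norm (u_star M u1 - um) * V \<le> (\<bar>h0 M u1\<bar> + norm um) * V"
          by (rule mult_right_mono[OF _ V(1)])
        also have "\<dots> = \<bar>h0 M u1\<bar> * V + V * norm um" by (simp add: distrib_right)
        also have "\<dots> \<le> (?H * c3 M + 2 * Q) * ?n" using um h1 by (simp add: distrib_right)
        also have "\<dots> \<le> C * ?n" using C by (intro mult_right_mono) auto
        finally show ?thesis .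
      qed
      ultimately show ?thesis by blast
    qed
    from both show ?thesis
    proof
      assume u: "u1 \<in> H3 M \<and> u2 \<in> H3 M"
      then have "\<not> abrupt_nucleation M (H3 M)" using na nuc by (auto simp: abruptly_separated_def)
      note V = S2[OF this p] and b = Bh[rule_format, OF conjI[OF p conjunct2[OF u]]]
      have h1: "wmcr M \<le> h0 M u1" using u1 u by (auto simp: elastic_data_def nucleates_def)
      have "V \<le> S * (wmcr M - h0 M u2)" using V u by blast
      also have "\<dots> \<le> S * (?H * ?n)" using S dh h1 by (intro mult_left_mono) auto
      finally have "V * B \<le> S * (?H * ?n) * B" using B0 by (intro mult_right_mono)
      also have "\<dots> = (B * (S * ?H)) * ?n" by (simp add: mult_ac)
      also have "\<dots> \<le> Q * ?n" using Q by (intro mult_right_mono) auto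
      finally have VB: "V * B \<le> Q * ?n" .
      show ?thesis
      proof (rule fin)
        show "0 \<le> V" "V \<le> c3 M" using b by auto
        show "fst up = c3 M * (h0 M u2 - snd up)" using slow_wave_of_states(3)[OF p] u by blast
        show "c3 M \<le> c3 M" by simp
        show "V * norm um \<le> Q * ?n" using VB b mult_left_mono[of "norm um" B V] by linarith
        show "V * norm up \<le> Q * ?n" if "V < outer_speed M u2"
          using VB b that u mult_left_mono[of "norm up" B V] by (simp add: outer_speed_simps)
        have "\<bar>h0 M u1\<bar> * V \<le> (\<bar>h0 M u1 - h0 M u2\<bar> + B) * V"
          using b by (intro mult_right_mono) auto
        also have "\<dots> = \<bar>h0 M u1 - h0 M u2\<bar> * V + V * B" by (simp add: distrib_right)
        also have "\<bar>h0 M u1 - h0 M u2\<bar> * V \<le> (?H * ?n) * c3 M"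
          using b h0_const_pos by (intro mult_mono[OF dh]) auto
        finally show "\<bar>h0 M u1\<bar> * V \<le> ?H * c3 M * ?n + Q * ?n" using VB by (simp add: mult_ac)
      qed
    next
      assume u: "u1 \<in> H1 M \<and> u2 \<in> H1 M"
      then have "\<not> abrupt_nucleation M (H1 M)" using na nuc by (auto simp: abruptly_separated_def)
      note V = F2[OF this p] and b = Bl[rule_format, OF conjI[OF p conjunct2[OF u]]]
      have h1: "h0 M u1 \<le> wMcr M" using u1 u by (auto simp: elastic_data_def nucleates_def)
      have "V * h0 M u2 \<le> F * (h0 M u2 - wMcr M)" using V u by blast
      also have "\<dots> \<le> F * (?H * ?n)" using F dh h1 by (intro mult_left_mono) auto
      finally have Vh: "V * h0 M u2 \<le> F * ?H * ?n" by simp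
      have "B * (V * h0 M u2) \<le> B * (F * ?H * ?n)" using Vh B0 by (intro mult_left_mono)
      also have "\<dots> = (B * (F * ?H)) * ?n" by simp
      also have "\<dots> \<le> Q * ?n" using Q by (intro mult_right_mono) auto
      finally have VB: "V * (B * h0 M u2) \<le> Q * ?n" by (simp add: mult_ac)
      show ?thesis
      proof (rule fin)
        show "0 \<le> V" "V \<le> c3 M" using b by auto
        show "fst up = c1 M * (h0 M u2 - snd up)" using b by blast
        show "c3 M \<le> c1 M" using c_pos by simp
        show "V * norm um \<le> Q * ?n" using VB b mult_left_mono[of "norm um" "B * h0 M u2" V] by linarith
        show "V * norm up \<le> Q * ?n"
          using VB b mult_left_mono[of "norm up" "B * h0 M u2" V] by linarith
        have "\<bar>h0 M u1\<bar> * V \<le> (1 + wM M) * V"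
          using elastic_low_bounds(1)[OF u1] u b by (intro mult_right_mono) auto
        also have "\<dots> = (1 + wM M) / wMcr M * (V * wMcr M)" using crit by simp
        also have "\<dots> \<le> (1 + wM M) / wMcr M * (V * h0 M u2)"
          using b crit strain_pos by (intro mult_left_mono) auto
        also have "\<dots> \<le> (1 + wM M) / wMcr M * (F * ?H * ?n)"
          using Vh crit strain_pos by (intro mult_left_mono) auto
        also have "\<dots> = ((1 + wM M) / wMcr M * (F * ?H)) * ?n" by simp
        also have "\<dots> \<le> Q * ?n" using Q by (intro mult_right_mono) auto
        also have "\<dots> \<le> ?H * c3 M * ?n + Q * ?n" using h0_const_pos c_pos by simp
        finally show "\<bar>h0 M u1\<bar> * V \<le> ?H * c3 M * ?n + Q * ?n" .
      qed
    qed
  qed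
  then show ?thesis using C(1) by blast
qed

lemma phase_boundary_speed:
  assumes "phase_boundary_states M u um up V"
  shows "0 \<le> V" "V \<le> c3 M" "V \<le> outer_speed M u"
proof -
  have "0 \<le> V \<and> V \<le> c3 M"
    using phase_boundary_cases[OF assms] slow_wave_of_states(1)[OF assms] fast_wave_of_states(1)[OF assms]
    by (fastforce simp: slow_wave_def fast_wave_def)
  then show "0 \<le> V" "V \<le> c3 M" "V \<le> outer_speed M u" using c_pos by (auto simp: outer_speed_def)
qed

lemma crossing_bound:
  "\<exists>C\<ge>0. \<forall>u um up V u' um' up' V'. phase_boundary_states M u um up V \<and> phase_boundary_states M u' um' up' V' \<and>
    outer_speed M u = outer_speed M u' \<and> V < V' \<longrightarrow> norm (up - um') * (V' - V) \<le> C * norm (u - u')"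
proof -
  obtain B where B0: "0 \<le> B"
    and Bh: "\<forall>u0 um up V. phase_boundary_states M u0 um up V \<and> u0 \<in> H3 M \<longrightarrow> 0 \<le> V \<and> V \<le> c3 M \<and>
      0 \<le> h0 M u0 \<and> h0 M u0 \<le> B \<and> norm um \<le> B \<and> (V < c3 M \<longrightarrow> norm up \<le> B)"
    and Bl: "\<forall>u0 um up V. phase_boundary_states M u0 um up V \<and> u0 \<in> H1 M \<longrightarrow> 0 \<le> V \<and> V < c3 M \<and>
      wMcr M < h0 M u0 \<and> norm um \<le> B * h0 M u0 \<and> norm up \<le> B * h0 M u0 \<and>
      \<bar>snd up\<bar> \<le> wM M \<and> fst um = 0 \<and> fst up = c1 M * (h0 M u0 - snd up) \<and>
      h0 M u0 * (c3 M - V) \<le> B \<and> \<bar>snd um - h0 M u0 * c1 M / c3 M\<bar> \<le> B"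
    using phase_boundary_bounds by (elim exE conjE) (rule that)
  obtain K where K: "0 \<le> K" "\<And>u um up V u' um' up' V'. phase_boundary_states M u um up V \<Longrightarrow>
    phase_boundary_states M u' um' up' V' \<Longrightarrow>
    norm (um - um') \<le> K * norm (u - u') \<and> \<bar>V - V'\<bar> \<le> K * norm (u - u') \<and>
    (V < outer_speed M u \<and> V' < outer_speed M u' \<longrightarrow> norm (up - up') \<le> K * norm (u - u'))"
    using phase_boundary_lipschitz by meson
  obtain F where F: "0 \<le> F" and F2: "\<And>h1 z1 w1 V1 h2 z2 w2 V2. fast_wave M h1 z1 w1 V1 \<Longrightarrow>
    fast_wave M h2 z2 w2 V2 \<Longrightarrow> V1 \<le> V2 \<Longrightarrow> h1 * (V2 - V1) \<le> F * (h2 - h1)"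
    using fast_speed by meson
  define C where "C = 2 * B * K + 2 * B * F * h0_const + K * c3 M"
  have C0: "0 \<le> 2 * B * K" "0 \<le> 2 * B * F * h0_const" "0 \<le> K * c3 M"
    using B0 K(1) F h0_const_pos c_pos by simp_all
  have C: "0 \<le> C" "2 * B * K \<le> C" "2 * B * F * h0_const + K * c3 M \<le> C"
    using C0 by (simp_all add: C_def)
  have "norm (up - um') * (V' - V) \<le> C * norm (u - u')"
    if p: "phase_boundary_states M u um up V" "phase_boundary_states M u' um' up' V'"
      and o: "outer_speed M u = outer_speed M u'" and V: "V < V'" for u um up V u' um' up' V'
  proof -
    let ?n = "norm (u - u')"
    note l = K(2)[OF p]
    have "u \<in> H1 M \<or> u \<in> H3 M" "u' \<in> H1 M \<or> u' \<in> H3 M"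
      using p by (auto simp: phase_boundary_states_def)
    then have "u \<in> H3 M \<and> u' \<in> H3 M \<or> u \<in> H1 M \<and> u' \<in> H1 M"
      using o c_pos(2) by (auto simp: outer_speed_simps)
    then show ?thesis
    proof
      assume u: "u \<in> H3 M \<and> u' \<in> H3 M"
      note b = Bh[rule_format, OF conjI[OF p(1) conjunct1[OF u]]] and b' = Bh[rule_format, OF conjI[OF p(2) conjunct2[OF u]]]
      have "norm (up - um') \<le> 2 * B" using norm_triangle_ineq4[of up um'] b b' V by linarith
      then have "norm (up - um') * (V' - V) \<le> 2 * B * (K * ?n)"
        using l V B0 by (intro mult_mono) auto
      also have "\<dots> = (2 * B * K) * ?n" by simp
      also have "\<dots> \<le> C * ?n" using C by (intro mult_right_mono) auto
      finally show ?thesis .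
    next
      assume u: "u \<in> H1 M \<and> u' \<in> H1 M"
      note b = Bl[rule_format, OF conjI[OF p(1) conjunct1[OF u]]] and b' = Bl[rule_format, OF conjI[OF p(2) conjunct2[OF u]]]
      \<comment> \<open>\<open>um'\<close> is replaced by \<open>um\<close>, so that the growth is
        measured by \<open>h0 M u\<close>, the weight that \<open>fast_speed\<close> puts on the
        slower boundary.\<close>
      have "norm (up - um') \<le> norm up + norm um + norm (um - um')"
        using norm_triangle_ineq4[of up um'] norm_triangle_ineq2[of um' um] by (simp add: norm_minus_commute)
      then have "norm (up - um') \<le> 2 * B * h0 M u + K * ?n" using b l by linarith
      then have "norm (up - um') * (V' - V) \<le> (2 * B * h0 M u + K * ?n) * (V' - V)"
        using V by (intro mult_right_mono) auto
      also have "\<dots> = 2 * B * (h0 M u * (V' - V)) + K * ?n * (V' - V)" by (simp add: distrib_right)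
      also have "\<dots> \<le> 2 * B * (F * (h0_const * ?n)) + K * ?n * c3 M"
      proof (intro add_mono mult_left_mono)
        have "h0 M u * (V' - V) \<le> F * (h0 M u' - h0 M u)"
          using F2[OF fast_wave_of_states(1)[OF p(1)] fast_wave_of_states(1)[OF p(2)]] u V by simp
        also have "\<dots> \<le> F * (h0_const * ?n)" using F h0_lipschitz[OF o] by (intro mult_left_mono) auto
        finally show "h0 M u * (V' - V) \<le> F * (h0_const * ?n)" .
        show "V' - V \<le> c3 M" using b b' by linarith
      qed (use B0 K(1) in auto)
      also have "\<dots> = (2 * B * F * h0_const + K * c3 M) * ?n" by (simp add: distrib_right)
      also have "\<dots> \<le> C * ?n" using C by (intro mult_right_mono) auto
      finally show ?thesis .
    qed
  qed
  then show ?thesis using C(1) by blast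
qed

lemma abruptly_separated_commute: "abruptly_separated M u u' \<longleftrightarrow> abruptly_separated M u' u"
  by (auto simp: abruptly_separated_def)

lemma same_phase_stability:
  "\<exists>C\<ge>0. \<forall>u0 u0' u u' A B t. riemann_solution M u0 u \<and> riemann_solution M u0' u' \<and>
    outer_speed M u0 = outer_speed M u0' \<and> \<not> abruptly_separated M u0 u0' \<and> 0 < A \<and> A < B \<and> 0 \<le> t \<longrightarrow>
    integral {A..B} (\<lambda>x. norm (u t x - u' t x)) \<le> C * (B + c1 M * t - max 0 (A - c1 M * t)) * norm (u0 - u0')"
proof -
  obtain L where L: "0 \<le> L" "\<And>u um up V u' um' up' V'. phase_boundary_states M u um up V \<Longrightarrow>
    phase_boundary_states M u' um' up' V' \<Longrightarrow>
    norm (um - um') \<le> L * norm (u - u') \<and> \<bar>V - V'\<bar> \<le> L * norm (u - u') \<and>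
    (V < outer_speed M u \<and> V' < outer_speed M u' \<longrightarrow> norm (up - up') \<le> L * norm (u - u'))"
    using phase_boundary_lipschitz by meson
  obtain P where P: "0 \<le> P" "\<And>u um up V u' um' up' V'. phase_boundary_states M u um up V \<Longrightarrow>
    phase_boundary_states M u' um' up' V' \<Longrightarrow> outer_speed M u = outer_speed M u' \<Longrightarrow> V < V' \<Longrightarrow>
    norm (up - um') * (V' - V) \<le> P * norm (u - u')"
    using crossing_bound by meson
  obtain N where N: "0 \<le> N" "\<And>u1 u2 um up V. u1 \<in> elastic_data M \<Longrightarrow> phase_boundary_states M u2 um up V \<Longrightarrow>
    outer_speed M u1 = outer_speed M u2 \<Longrightarrow> \<not> abruptly_separated M u1 u2 \<Longrightarrow>
    (V < outer_speed M u2 \<longrightarrow> norm (u_star M u1 - up) \<le> N * norm (u1 - u2)) \<and>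
    norm (u_star M u1 - um) * V \<le> N * norm (u1 - u2)"
    using nucleation_onset by meson
  define K where "K = L + P + N + h0_const + 1"
  have K: "0 \<le> K" "1 \<le> K" "L \<le> K" "P \<le> K" "N \<le> K" "h0_const \<le> K"
    using L(1) P(1) N(1) h0_const_pos by (simp_all add: K_def)
  have le: "x \<le> K * norm n" if "x \<le> X * norm n" "X \<le> K" for x X and n :: state
    using that mult_right_mono[OF that(2) norm_ge_zero[of n]] by linarith
  \<comment> \<open>A form symmetric in the two solutions, so that the order of the speeds required
    by \<open>profile_stability\<close> can always be arranged.\<close>
  define I where "I u0 u u0' u' \<longleftrightarrow> (\<forall>A B t. 0 < A \<and> A < B \<and> 0 \<le> t \<longrightarrow>
    integral {A..B} (\<lambda>x. norm (u t x - u' t x)) \<le> (K * norm (u0 - u0') + K * norm (u0 - u0') / c1 M) *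
      (B + c1 M * t - max 0 (A - c1 M * t)))" for u0 u0' :: state and u u' :: "real \<Rightarrow> real \<Rightarrow> state"
  have I_commute: "I u0 u u0' u'" if "I u0' u' u0 u" for u0 u0' u u'
    using that unfolding I_def by (simp add: norm_minus_commute)
  have elastic: "I u0 u u0' u'" if "u0 \<in> elastic_data M" "u0' \<in> elastic_data M"
    "\<And>um. profile u um (u_star M u0) u0 0 (outer_speed M u0)"
    "\<And>um. profile u' um (u_star M u0') u0' 0 (outer_speed M u0')"
    "outer_speed M u0 = outer_speed M u0'" for u0 u0' u u'
  proof -
    have d: "norm (u_star M u0 - u_star M u0') \<le> K * norm (u0 - u0')"
      using le[OF h0_lipschitz[OF that(5)] K(6)] by (simp add: u_star_def)
    have "0 \<le> outer_speed M u0'" using c_pos by (simp add: outer_speed_def)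
    then show ?thesis
      unfolding I_def using d K c_pos le[of _ 1]
      by (intro allI impI profile_stability[OF that(3)[unfolded that(5), of 0] that(4)[of 0]]) auto
  qed
  have onset: "I u0 u u0' u'" if "u0 \<in> elastic_data M" "phase_boundary_states M u0' um up V"
    "\<And>um. profile u um (u_star M u0) u0 0 (outer_speed M u0)" "profile u' um up u0' V (outer_speed M u0')"
    "outer_speed M u0 = outer_speed M u0'" "\<not> abruptly_separated M u0 u0'" for u0 u0' u u' um up V
  proof -
    note n = N(2)[OF that(1,2,5,6)]
    show ?thesis
      \<comment> \<open>The free inner state of the single-wave profile is taken to be
        \<open>um\<close>, which makes the innermost comparison trivial; the sector up to
        \<open>V * t\<close> then contributes the jump from \<open>u_star\<close> to
        \<open>um\<close>.\<close>
      unfolding I_def using n K c_pos phase_boundary_speed[OF that(2)] le[of _ 1] le[of _ N]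
      by (intro allI impI profile_stability[OF that(3)[unfolded that(5), of um] that(4)]) auto
  qed
  have fronts: "I u0 u u0' u'" if "phase_boundary_states M u0 um up V" "phase_boundary_states M u0' um' up' V'"
    "profile u um up u0 V (outer_speed M u0)" "profile u' um' up' u0' V' (outer_speed M u0')"
    "outer_speed M u0 = outer_speed M u0'" "V \<le> V'" for u0 u0' u u' um up V um' up' V'
  proof -
    note l = L(2)[OF that(1,2)]
    show ?thesis
      unfolding I_def
    proof (intro allI impI profile_stability[OF that(3)[unfolded that(5)] that(4)])
      show "norm (up - um') * (V' - V) \<le> K * norm (u0 - u0')" if "V < V'"
        using le[OF P(2)[OF \<open>phase_boundary_states M u0 um up V\<close> \<open>phase_boundary_states M u0' um' up' V'\<close>
          \<open>outer_speed M u0 = outer_speed M u0'\<close> that] K(4)] .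
    qed (use l K c_pos phase_boundary_speed[OF that(2)] that(5,6) le[of _ 1] le[of _ L] in auto)
  qed
  have I: "I u0 u u0' u'" if r: "riemann_solution M u0 u" "riemann_solution M u0' u'"
    and o: "outer_speed M u0 = outer_speed M u0'" and a: "\<not> abruptly_separated M u0 u0'" for u0 u u0' u'
  proof (rule riemann_solution_cases[OF r(1)]; rule riemann_solution_cases[OF r(2)])
    assume e: "u0 \<in> elastic_data M" "\<And>um. profile u um (u_star M u0) u0 0 (outer_speed M u0)"
    show ?thesis if "u0' \<in> elastic_data M" "\<And>um. profile u' um (u_star M u0') u0' 0 (outer_speed M u0')"
      by (rule elastic[OF e(1) that(1) e(2) that(2) o])
    show ?thesis if "phase_boundary_states M u0' um up V" "profile u' um up u0' V (outer_speed M u0')" for um up V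
      by (rule onset[OF e(1) that(1) e(2) that(2) o a])
  next
    fix um up V assume p: "phase_boundary_states M u0 um up V" "profile u um up u0 V (outer_speed M u0)"
    show ?thesis if "u0' \<in> elastic_data M" "\<And>um. profile u' um (u_star M u0') u0' 0 (outer_speed M u0')"
    proof -
      have "\<not> abruptly_separated M u0' u0" using a abruptly_separated_commute by simp
      from onset[OF that(1) p(1) that(2) p(2) o[symmetric] this] show ?thesis by (rule I_commute)
    qed
    show ?thesis if q: "phase_boundary_states M u0' um' up' V'" "profile u' um' up' u0' V' (outer_speed M u0')" for um' up' V'
    proof (cases "V \<le> V'")
      case True
      then show ?thesis by (rule fronts[OF p(1) q(1) p(2) q(2) o])
    next
      case False
      then have "V' \<le> V" by simp
      then show ?thesis by (rule I_commute[OF fronts[OF q(1) p(1) q(2) p(2) o[symmetric]]])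
    qed
  qed
  show ?thesis
  proof (intro exI[of _ "K + K / c1 M"] conjI allI impI; (elim conjE)?)
    show "0 \<le> K + K / c1 M" using K c_pos by simp
    fix u0 u0' u u' and A B t :: real
    assume r: "riemann_solution M u0 u" "riemann_solution M u0' u'" "outer_speed M u0 = outer_speed M u0'"
      "\<not> abruptly_separated M u0 u0'" and A: "0 < A" "A < B" "0 \<le> t"
    have eq: "(K * n + K * n / c1 M) * X = (K + K / c1 M) * X * n" for n X by (simp add: algebra_simps)
    show "integral {A..B} (\<lambda>x. norm (u t x - u' t x))
        \<le> (K + K / c1 M) * (B + c1 M * t - max 0 (A - c1 M * t)) * norm (u0 - u0')"
      using I[OF r, unfolded I_def, rule_format, OF conjI[OF A(1) conjI[OF A(2,3)]]] unfolding eq .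
  qed
qed

end

section \<open>Comparison of data in different phases\<close>

text \<open>Up to an error that is bounded in \<open>L\<^sup>\<infinity>\<close>, except on the sector \<open>V t < x < c\<^sub>3 t\<close>, this profile
  describes the solutions for data of large velocity in both phases.\<close>
definition far_profile :: "bar \<Rightarrow> state \<Rightarrow> real \<Rightarrow> real \<Rightarrow> state" where
  "far_profile M u0 t x = (if x < c3 M * t then (0, fst u0 / c3 M) else (fst u0, 0))"

context bar_model
begin

text \<open>Both profiles jump on the ray of speed \<open>c3 M\<close>, whatever the phases of the
  data, so no sector of disagreement arises.\<close>

lemma far_profile_lipschitz: "norm (far_profile M u t x - far_profile M u' t x) \<le> h0_const * norm (u - u')"
proof -
  have "norm (far_profile M u t x - far_profile M u' t x) \<le> h0_const * \<bar>fst u - fst u'\<bar>"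
  proof (cases "x < c3 M * t")
    case True
    then have "norm (far_profile M u t x - far_profile M u' t x) = \<bar>fst u - fst u'\<bar> / c3 M"
      using c_pos by (simp add: far_profile_def flip: diff_divide_distrib)
    then show ?thesis by (simp add: h0_const_def distrib_right)
  next
    case False
    then have "norm (far_profile M u t x - far_profile M u' t x) = \<bar>fst u - fst u'\<bar>"
      by (simp add: far_profile_def)
    then show ?thesis using mult_right_mono[OF h0_const_pos(2), of "\<bar>fst u - fst u'\<bar>"] by simp
  qed
  also have "\<dots> \<le> h0_const * norm (u - u')"
    using state_diff_le(1) h0_const_pos by (intro mult_left_mono) auto
  finally show ?thesis .
qed

text \<open>Here \<open>fst u0 / c3 M\<close> equals \<open>h0 M u0 - snd u0\<close>, so the elastic
  solution misses the profile by the strain \<open>snd u0\<close> only. After nucleation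
  \<open>h0\<close> and all inner states are bounded.\<close>

lemma high_far_profile:
  "\<exists>K\<ge>0. \<forall>u0 u. u0 \<in> H3 M \<and> riemann_solution M u0 u \<longrightarrow>
    (\<forall>t\<ge>0. \<exists>S. finite S \<and> (\<forall>x>0. x \<notin> S \<longrightarrow> norm (u t x - far_profile M u0 t x) \<le> K + K * \<bar>snd u0\<bar>))"
proof -
  obtain B where B0: "0 \<le> B"
    and Bh: "\<forall>u0 um up V. phase_boundary_states M u0 um up V \<and> u0 \<in> H3 M \<longrightarrow> 0 \<le> V \<and> V \<le> c3 M \<and>
      0 \<le> h0 M u0 \<and> h0 M u0 \<le> B \<and> norm um \<le> B \<and> (V < c3 M \<longrightarrow> norm up \<le> B)"
    using phase_boundary_bounds by (elim exE conjE) (rule that)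
  have "\<exists>S. finite S \<and> (\<forall>x>0. x \<notin> S \<longrightarrow> norm (u t x - far_profile M u0 t x) \<le> (2 * B + 1) + (2 * B + 1) * \<bar>snd u0\<bar>)"
    if u0: "u0 \<in> H3 M" and r: "riemann_solution M u0 u" and t: "0 \<le> t" for u0 u t
  proof -
    let ?K = "(2 * B + 1) + (2 * B + 1) * \<bar>snd u0\<bar>"
    have s: "outer_speed M u0 = c3 M" using u0 by (simp add: outer_speed_simps)
    have v: "fst u0 / c3 M = h0 M u0 - snd u0" using h0_high[OF u0] c_pos by simp
    have K: "\<bar>snd u0\<bar> \<le> ?K" "2 * B + \<bar>snd u0\<bar> \<le> ?K" using B0 by (simp_all add: algebra_simps)
    have out: "norm (u t x - far_profile M u0 t x) \<le> ?K" if "u t x = u0" "c3 M * t < x" for x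
      using that K norm_Pair_diff_le[of u0 "(fst u0, 0)"] by (simp add: far_profile_def)
    show ?thesis
    proof (rule riemann_solution_cases[OF r])
      assume "\<And>um. profile u um (u_star M u0) u0 0 (outer_speed M u0)"
      then have p: "profile u 0 (u_star M u0) u0 0 (c3 M)" by (simp add: s)
      show ?thesis
      proof (intro exI[of _ "{c3 M * t}"] conjI allI impI)
        fix x assume x: "0 < x" "x \<notin> {c3 M * t}"
        note p = p[unfolded profile_def, rule_format, OF t x(1)]
        show "norm (u t x - far_profile M u0 t x) \<le> ?K"
        proof (cases "x < c3 M * t")
          case True
          then have "u t x - far_profile M u0 t x = (0, snd u0)"
            using p x by (simp add: far_profile_def v u_star_def)
          then show ?thesis using K by simp
        next
          case False
          then show ?thesis using p x by (intro out) auto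
        qed
      qed simp
    next
      fix um up V assume q: "phase_boundary_states M u0 um up V"
        and "profile u um up u0 V (outer_speed M u0)"
      then have p: "profile u um up u0 V (c3 M)" by (simp add: s)
      note b = Bh[rule_format, OF conjI[OF q u0]]
      show ?thesis
      proof (intro exI[of _ "{V * t, c3 M * t}"] conjI allI impI)
        fix x assume x: "0 < x" "x \<notin> {V * t, c3 M * t}"
        note p = p[unfolded profile_def, rule_format, OF t x(1)]
        show "norm (u t x - far_profile M u0 t x) \<le> ?K"
        proof (cases "x < c3 M * t")
          case True
          have "norm (u t x) \<le> B"
          proof (cases "x < V * t")
            case True
            then show ?thesis using p b by simp
          next
            case False
            then have Vx: "V * t < x" using x by auto
            then have "V < c3 M" using True t by (meson less_trans mult_right_less_imp_less)
            then show ?thesis using p Vx True b by simp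
          qed
          moreover have "0 \<le> h0 M u0" "h0 M u0 \<le> B" using b by blast+
          then have "\<bar>h0 M u0 - snd u0\<bar> \<le> B + \<bar>snd u0\<bar>" by linarith
          then have "norm (far_profile M u0 t x) \<le> B + \<bar>snd u0\<bar>"
            using True by (simp add: far_profile_def v)
          ultimately show ?thesis using norm_triangle_ineq4[of "u t x" "far_profile M u0 t x"] K by linarith
        next
          case False
          then show ?thesis using p x by (intro out) auto
        qed
      qed simp
    qed
  qed
  then show ?thesis using B0 by (intro exI[of _ "2 * B + 1"]) auto
qed

text \<open>Elastic data of this phase are bounded. After nucleation the wall strain is close to
  \<open>h0 M u0 * c1 M / c3 M\<close> and thus to \<open>fst u0 / c3 M\<close>, and beyond
  \<open>c3 M * t\<close> the velocity is close to \<open>fst u0\<close>. In between the error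
  \<open>K1\<close> may grow like \<open>h0\<close>, on a sector whose opening shrinks like
  \<open>1 / h0\<close>.\<close>

lemma low_far_profile:
  "\<exists>K\<ge>0. \<forall>u0 u. u0 \<in> H1 M \<and> riemann_solution M u0 u \<longrightarrow>
    (\<exists>V K1. 0 \<le> K1 \<and> V \<le> c3 M \<and> K1 * (c3 M - V) \<le> K \<and>
      (\<forall>t\<ge>0. \<exists>S. finite S \<and> (\<forall>x>0. x \<notin> S \<longrightarrow>
        norm (u t x - far_profile M u0 t x) \<le> K + (if V * t < x \<and> x < c3 M * t then K1 else 0))))"
proof -
  obtain B where B0: "0 \<le> B"
    and Bl: "\<forall>u0 um up V. phase_boundary_states M u0 um up V \<and> u0 \<in> H1 M \<longrightarrow> 0 \<le> V \<and> V < c3 M \<and>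
      wMcr M < h0 M u0 \<and> norm um \<le> B * h0 M u0 \<and> norm up \<le> B * h0 M u0 \<and>
      \<bar>snd up\<bar> \<le> wM M \<and> fst um = 0 \<and> fst up = c1 M * (h0 M u0 - snd up) \<and>
      h0 M u0 * (c3 M - V) \<le> B \<and> \<bar>snd um - h0 M u0 * c1 M / c3 M\<bar> \<le> B"
    using phase_boundary_bounds by (elim exE conjE) (rule that)
  let ?w = "1 + wM M"
  define E where "E = 2 * c1 M * ?w"
  define G where "G = B + c1 M * (1 + ?w / wMcr M) / c3 M"
  define K where "K = (2 * E + ?w + E / c3 M) + (B + c1 M * ?w / c3 M) + (c1 M * (2 * ?w) + ?w) + G * B"
  have nonneg: "0 \<le> E" "0 \<le> G" using c_pos strain_pos crit B0 by (simp_all add: E_def G_def)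
  then have parts: "0 \<le> 2 * E + ?w + E / c3 M" "0 \<le> B + c1 M * ?w / c3 M" "0 \<le> c1 M * (2 * ?w) + ?w" "0 \<le> G * B"
    using c_pos strain_pos B0 by simp_all
  then have K: "0 \<le> K" "2 * E + ?w + E / c3 M \<le> K" "B + c1 M * ?w / c3 M \<le> K" "c1 M * (2 * ?w) + ?w \<le> K" "G * B \<le> K"
    unfolding K_def by linarith+
  have "0 \<le> c1 M * (2 * ?w)" using c_pos strain_pos by simp
  then have w: "?w \<le> K" using K(4) by linarith
  have main: "\<exists>V K1. 0 \<le> K1 \<and> V \<le> c3 M \<and> K1 * (c3 M - V) \<le> K \<and>
      (\<forall>t\<ge>0. \<exists>S. finite S \<and> (\<forall>x>0. x \<notin> S \<longrightarrow>
        norm (u t x - far_profile M u0 t x) \<le> K + (if V * t < x \<and> x < c3 M * t then K1 else 0)))"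
    if u0: "u0 \<in> H1 M" and r: "riemann_solution M u0 u" for u0 u
  proof -
    have s: "outer_speed M u0 = c1 M" using u0 by (simp add: outer_speed_simps)
    have w0: "\<bar>snd u0\<bar> \<le> ?w" by (rule low_strain_bound[OF u0])
    show ?thesis
    proof (rule riemann_solution_cases[OF r])
      assume e: "u0 \<in> elastic_data M" and "\<And>um. profile u um (u_star M u0) u0 0 (outer_speed M u0)"
      then have p: "profile u 0 (u_star M u0) u0 0 (c1 M)" by (simp add: s)
      have v: "\<bar>fst u0\<bar> \<le> E" and h: "\<bar>h0 M u0\<bar> \<le> ?w"
        using elastic_low_bounds[OF e u0] unfolding E_def by auto
      show ?thesis
      \<comment> \<open>With \<open>V = c3 M\<close> the exceptional sector is empty.\<close>
      proof (rule exI[of _ "c3 M"], rule exI[of _ 0], intro conjI allI impI)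
        fix t :: real assume t: "0 \<le> t"
        show "\<exists>S. finite S \<and> (\<forall>x>0. x \<notin> S \<longrightarrow>
          norm (u t x - far_profile M u0 t x) \<le> K + (if c3 M * t < x \<and> x < c3 M * t then 0 else 0))"
        proof (intro exI[of _ "{c1 M * t}"] conjI allI impI)
          fix x assume x: "0 < x" "x \<notin> {c1 M * t}"
          note p = p[unfolded profile_def, rule_format, OF t x(1)]
          have "u t x = u_star M u0 \<or> u t x = u0" using p x by (cases "x < c1 M * t") auto
          then have "norm (u t x) \<le> E + ?w"
            using norm_Pair_diff_le[of u0 0] v w0 h nonneg by (auto simp: u_star_def)
          moreover have "norm (far_profile M u0 t x) \<le> E + E / c3 M"
          proof -
            have "0 \<le> E / c3 M" using nonneg c_pos by simp
            moreover have "\<bar>fst u0\<bar> / c3 M \<le> E / c3 M" using v c_pos by (simp add: divide_right_mono)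
            moreover have "norm (far_profile M u0 t x) \<le> max (\<bar>fst u0\<bar>) (\<bar>fst u0\<bar> / c3 M)"
              using c_pos by (simp add: far_profile_def)
            ultimately show ?thesis using v nonneg(1) by linarith
          qed
          ultimately show "norm (u t x - far_profile M u0 t x) \<le> K + (if c3 M * t < x \<and> x < c3 M * t then 0 else 0)"
            using norm_triangle_ineq4[of "u t x" "far_profile M u0 t x"] K(2) by simp
        qed simp
      qed (use K in auto)
    next
      fix um up V assume q: "phase_boundary_states M u0 um up V"
        and "profile u um up u0 V (outer_speed M u0)"
      then have p: "profile u um up u0 V (c1 M)" by (simp add: s)
      note b = Bl[rule_format, OF conjI[OF q u0]]
      let ?h = "h0 M u0"
      have h: "0 < ?h" using b crit by linarith
      define K1 where "K1 = norm up + \<bar>fst u0\<bar> / c3 M"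
      have "\<bar>fst u0\<bar> = c1 M * \<bar>?h - snd u0\<bar>" unfolding h0_low[OF u0] using c_pos by (simp add: abs_mult)
      also have "\<dots> \<le> c1 M * (?h + ?w)" using w0 h c_pos by (intro mult_left_mono) auto
      also have "?w = ?w / wMcr M * wMcr M" using crit by simp
      also have "?w / wMcr M * wMcr M \<le> ?w / wMcr M * ?h"
        using b crit strain_pos by (intro mult_left_mono) auto
      finally have "\<bar>fst u0\<bar> \<le> c1 M * (1 + ?w / wMcr M) * ?h"
        using c_pos by (simp add: algebra_simps)
      from divide_right_mono[OF this, of "c3 M"] have "K1 \<le> G * ?h"
        using b c_pos by (simp add: K1_def G_def distrib_right)
      then have "K1 * (c3 M - V) \<le> G * ?h * (c3 M - V)" using b by (intro mult_right_mono) auto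
      also have "\<dots> \<le> G * B" using b nonneg mult_left_mono[of "?h * (c3 M - V)" B G] by (simp add: mult.assoc)
      finally have K1: "K1 * (c3 M - V) \<le> K" "0 \<le> K1" using K c_pos by (simp_all add: K1_def)
      show ?thesis
      proof (rule exI[of _ V], rule exI[of _ K1], intro conjI allI impI)
        fix t :: real assume t: "0 \<le> t"
        have ct: "V * t \<le> c3 M * t" "c3 M * t \<le> c1 M * t"
          using b c_pos t by (auto intro!: mult_right_mono)
        show "\<exists>S. finite S \<and> (\<forall>x>0. x \<notin> S \<longrightarrow>
          norm (u t x - far_profile M u0 t x) \<le> K + (if V * t < x \<and> x < c3 M * t then K1 else 0))"
        proof (intro exI[of _ "{V * t, c3 M * t, c1 M * t}"] conjI allI impI)
          fix x assume x: "0 < x" "x \<notin> {V * t, c3 M * t, c1 M * t}"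
          note p = p[unfolded profile_def, rule_format, OF t x(1)]
          consider "x < V * t" | "V * t < x" "x < c3 M * t" | "c3 M * t < x" "x < c1 M * t" | "c1 M * t < x"
            using x by fastforce
          then show "norm (u t x - far_profile M u0 t x) \<le> K + (if V * t < x \<and> x < c3 M * t then K1 else 0)"
          proof cases
            case 1
            have "fst u0 / c3 M = ?h * c1 M / c3 M - c1 M * snd u0 / c3 M"
              unfolding h0_low[OF u0] by (simp add: diff_divide_distrib right_diff_distrib mult.commute)
            moreover have "\<bar>c1 M * snd u0 / c3 M\<bar> \<le> c1 M * ?w / c3 M"
              using w0 c_pos by (simp add: abs_mult divide_right_mono mult_left_mono)
            ultimately have "\<bar>snd um - fst u0 / c3 M\<bar> \<le> B + c1 M * ?w / c3 M" using b by linarith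
            moreover have "norm (um - (0, fst u0 / c3 M)) \<le> \<bar>snd um - fst u0 / c3 M\<bar>"
              using norm_Pair_diff_le[of um "(0, fst u0 / c3 M)"] b by simp
            ultimately show ?thesis using 1 ct p K(3) by (simp add: far_profile_def)
          next
            case 2
            have "norm (up - (0, fst u0 / c3 M)) \<le> K1"
              using norm_triangle_ineq4[of up "(0, fst u0 / c3 M)"] c_pos by (simp add: K1_def)
            then show ?thesis using 2 ct p K(1) by (simp add: far_profile_def)
          next
            case 3
            have "fst up - fst u0 = c1 M * (snd u0 - snd up)"
              using b unfolding h0_low[OF u0] by (simp add: algebra_simps)
            then have "\<bar>fst up - fst u0\<bar> \<le> c1 M * (2 * ?w)"
              using b w0 c_pos by (auto simp: abs_mult intro!: mult_left_mono)
            then have "norm (up - (fst u0, 0)) \<le> c1 M * (2 * ?w) + ?w"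
              using norm_Pair_diff_le[of up "(fst u0, 0)"] b by simp
            then show ?thesis using 3 ct p K(4) by (simp add: far_profile_def)
          next
            case 4
            have "norm (u0 - (fst u0, 0)) \<le> ?w"
              using norm_Pair_diff_le[of u0 "(fst u0, 0)"] w0 by simp
            then show ?thesis using 4 ct p w by (simp add: far_profile_def)
          qed
        qed simp
      qed (use K1 b in auto)
    qed
  qed
  then show ?thesis using K(1) by blast
qed

lemma cross_phase_stability:
  "\<exists>C\<ge>0. \<forall>u0 u0' u u' A B t. riemann_solution M u0 u \<and> riemann_solution M u0' u' \<and>
    u0 \<in> H1 M \<and> u0' \<in> H3 M \<and> 0 < A \<and> A < B \<and> 0 \<le> t \<longrightarrow>
    integral {A..B} (\<lambda>x. norm (u t x - u' t x)) \<le> C * (B + c1 M * t - max 0 (A - c1 M * t)) * norm (u0 - u0')"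
proof -
  obtain P where P: "0 \<le> P" and low: "\<forall>u0 u. u0 \<in> H1 M \<and> riemann_solution M u0 u \<longrightarrow>
    (\<exists>V K1. 0 \<le> K1 \<and> V \<le> c3 M \<and> K1 * (c3 M - V) \<le> P \<and>
      (\<forall>t\<ge>0. \<exists>S. finite S \<and> (\<forall>x>0. x \<notin> S \<longrightarrow>
        norm (u t x - far_profile M u0 t x) \<le> P + (if V * t < x \<and> x < c3 M * t then K1 else 0))))"
    using low_far_profile by (elim exE conjE) (rule that)
  obtain Q where Q: "0 \<le> Q" and high: "\<forall>u0 u. u0 \<in> H3 M \<and> riemann_solution M u0 u \<longrightarrow>
    (\<forall>t\<ge>0. \<exists>S. finite S \<and> (\<forall>x>0. x \<notin> S \<longrightarrow> norm (u t x - far_profile M u0 t x) \<le> Q + Q * \<bar>snd u0\<bar>))"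
    using high_far_profile by (elim exE conjE) (rule that)
  let ?d = "wm M - wM M"
  define G where "G = (1 + wM M) / ?d + 1"
  define D where "D = (P + Q) / ?d + Q * G + h0_const"
  define C where "C = D + P / ?d / c1 M"
  have G: "0 \<le> G" using strain_pos by (simp add: G_def)
  have D: "0 \<le> D" using P Q G strain_pos h0_const_pos by (simp add: D_def)
  have C: "0 \<le> C" using D P strain_pos c_pos by (simp add: C_def)
  have "integral {A..B} (\<lambda>x. norm (u t x - u' t x)) \<le> C * (B + c1 M * t - max 0 (A - c1 M * t)) * norm (u0 - u0')"
    if r: "riemann_solution M u0 u" "riemann_solution M u0' u'" and u: "u0 \<in> H1 M" "u0' \<in> H3 M"
      and A: "0 < A" "A < B" "0 \<le> t" for u0 u0' u u' A B t
  proof -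
    let ?n = "norm (u0 - u0')" and ?X = "B + c1 M * t - max 0 (A - c1 M * t)"
    have n: "x \<le> x / ?d * ?n" if "0 \<le> x" for x
      using mult_left_mono[OF phase_distance[OF u] that] by simp
    obtain V K1 where V: "0 \<le> K1" "V \<le> c3 M" "K1 * (c3 M - V) \<le> P" and l: "\<exists>S. finite S \<and> (\<forall>x>0. x \<notin> S \<longrightarrow>
        norm (u t x - far_profile M u0 t x) \<le> P + (if V * t < x \<and> x < c3 M * t then K1 else 0))"
      using low[rule_format, OF conjI[OF u(1) r(1)]] A(3) by blast
    obtain S where S: "finite S" "\<And>x. 0 < x \<Longrightarrow> x \<notin> S \<Longrightarrow>
        norm (u t x - far_profile M u0 t x) \<le> P + (if V * t < x \<and> x < c3 M * t then K1 else 0)"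
      using l by blast
    obtain S' where S': "finite S'" "\<And>x. 0 < x \<Longrightarrow> x \<notin> S' \<Longrightarrow>
        norm (u' t x - far_profile M u0' t x) \<le> Q + Q * \<bar>snd u0'\<bar>"
      using high[rule_format, OF conjI[OF u(2) r(2)] A(3)] by blast
    \<comment> \<open>The high strain is not bounded, but is of the order of the distance of the
      data because the other strain is bounded.\<close>
    have "Q * \<bar>snd u0'\<bar> \<le> Q * (G * ?n)"
      using cross_bounds(1)[OF u] Q by (intro mult_left_mono) (simp_all add: G_def)
    then have const: "P + (Q + Q * \<bar>snd u0'\<bar>) + h0_const * ?n \<le> D * ?n"
      using n[of "P + Q"] P Q by (simp add: D_def distrib_right)
    have total: "integral {A..B} (\<lambda>x. norm (u t x - u' t x)) \<le> D * ?n * (B - A) + K1 * max 0 (c3 M * t - V * t)"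
    proof (rule integral_le_step[where S = "S \<union> S'"])
      fix x assume "x \<in> {A..B} - (S \<union> S')"
      then have x: "0 < x" "x \<notin> S" "x \<notin> S'" using A by auto
      have "norm (u t x - u' t x) \<le> norm (u t x - far_profile M u0 t x) +
          norm (far_profile M u0 t x - far_profile M u0' t x) + norm (u' t x - far_profile M u0' t x)"
        by norm
      then show "norm (u t x - u' t x) \<le> D * ?n + (if V * t < x \<and> x < c3 M * t then K1 else 0)"
        using S(2)[OF x(1,2)] S'(2)[OF x(1,3)] far_profile_lipschitz[of u0 t x u0'] const by linarith
    qed (use S(1) S'(1) A D V in auto)
    have "K1 * max 0 (c3 M * t - V * t) = K1 * (c3 M - V) * t"
      using V A by (simp add: left_diff_distrib mult_right_mono)
    also have "\<dots> \<le> P * t" by (rule mult_right_mono[OF V(3) A(3)])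
    \<comment> \<open>The opening of the sector has already compensated the size of
      \<open>K1\<close>; the strain gap turns the remaining \<open>P\<close> into a multiple of the
      distance.\<close>
    also have "\<dots> \<le> P / ?d * ?n * t" using n[OF P] A by (intro mult_right_mono) auto
    also have "\<dots> = P / ?d / c1 M * ?n * (c1 M * t)" using c_pos by simp
    finally have sector: "K1 * max 0 (c3 M * t - V * t) \<le> P / ?d / c1 M * ?n * (c1 M * t)" .
    have "0 \<le> c1 M * t" using c_pos A by simp
    then have X: "B - A \<le> ?X" "c1 M * t \<le> ?X" using A by auto
    have "D * ?n * (B - A) + P / ?d / c1 M * ?n * (c1 M * t) \<le> D * ?n * ?X + P / ?d / c1 M * ?n * ?X"
      using X D P strain_pos c_pos by (intro add_mono mult_left_mono) auto
    also have "\<dots> = C * ?X * ?n"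
    proof -
      have "D * n * X + R * n * X = (D + R) * X * n" for R n X by (simp add: algebra_simps)
      then show ?thesis unfolding C_def by blast
    qed
    finally show ?thesis using total sector by linarith
  qed
  then show ?thesis using C by blast
qed

section \<open>Uniform and pairwise estimates\<close>

lemma riemann_solution_phase: "riemann_solution M u0 u \<Longrightarrow> u0 \<in> H1 M \<or> u0 \<in> H3 M"
  by (auto simp: riemann_solution_def elastic_data_def HH_def phase_boundary_states_def)

lemma uniform_stability:
  "\<exists>C. \<forall>u0' u0'' u' u''. riemann_solution M u0' u' \<and> riemann_solution M u0'' u'' \<and>
    \<not> abruptly_separated M u0' u0'' \<longrightarrow>
    (\<forall>A B t. 0 < A \<and> A < B \<and> 0 \<le> t \<longrightarrow>
      integral {A..B} (\<lambda>x. norm (u' t x - u'' t x))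
        \<le> C * (B + c1 M * t - max 0 (A - c1 M * t)) * norm (u0' - u0''))"
proof -
  obtain S where S: "\<And>u0 u0' u u' A B t. riemann_solution M u0 u \<Longrightarrow> riemann_solution M u0' u' \<Longrightarrow>
    outer_speed M u0 = outer_speed M u0' \<Longrightarrow> \<not> abruptly_separated M u0 u0' \<Longrightarrow> 0 < A \<Longrightarrow> A < B \<Longrightarrow> 0 \<le> t \<Longrightarrow>
    integral {A..B} (\<lambda>x. norm (u t x - u' t x)) \<le> S * (B + c1 M * t - max 0 (A - c1 M * t)) * norm (u0 - u0')"
    using same_phase_stability by meson
  obtain C where C: "\<And>u0 u0' u u' A B t. riemann_solution M u0 u \<Longrightarrow> riemann_solution M u0' u' \<Longrightarrow>
    u0 \<in> H1 M \<Longrightarrow> u0' \<in> H3 M \<Longrightarrow> 0 < A \<Longrightarrow> A < B \<Longrightarrow> 0 \<le> t \<Longrightarrow>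
    integral {A..B} (\<lambda>x. norm (u t x - u' t x)) \<le> C * (B + c1 M * t - max 0 (A - c1 M * t)) * norm (u0 - u0')"
    using cross_phase_stability by meson
  show ?thesis
  proof (intro exI[of _ "max S C"] allI impI; elim conjE)
    fix u0 u0' u u' and A B t :: real
    assume r: "riemann_solution M u0 u" "riemann_solution M u0' u'" "\<not> abruptly_separated M u0 u0'"
      and A: "0 < A" "A < B" "0 \<le> t"
    let ?X = "B + c1 M * t - max 0 (A - c1 M * t)"
    have "0 \<le> c1 M * t" using c_pos A by simp
    moreover from this have "max 0 (A - c1 M * t) \<le> A" using A by simp
    ultimately have X: "0 \<le> ?X" using A by linarith
    have "S * ?X * norm (u0 - u0') \<le> max S C * ?X * norm (u0 - u0')"
      "C * ?X * norm (u0 - u0') \<le> max S C * ?X * norm (u0 - u0')"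
      using X by (auto intro!: mult_right_mono)
    then show "integral {A..B} (\<lambda>x. norm (u t x - u' t x)) \<le> max S C * ?X * norm (u0 - u0')"
      using riemann_solution_phase[OF r(1)] riemann_solution_phase[OF r(2)]
        S[OF r(1,2) _ r(3) A] C[OF r(1,2) _ _ A] C[OF r(2,1) _ _ A]
      by (elim disjE) (force simp: outer_speed_simps norm_minus_commute)+
  qed
qed

lemma riemann_solution_bounded:
  assumes "riemann_solution M u0 u"
  shows "\<exists>K\<ge>0. \<forall>t\<ge>0. \<exists>S. finite S \<and> (\<forall>x>0. x \<notin> S \<longrightarrow> norm (u t x) \<le> K)"
proof -
  obtain um up V s where p: "profile u um up u0 V s"
    using riemann_solution_cases[OF assms] by metis
  show ?thesis
  proof (intro exI[of _ "norm um + norm up + norm u0"] conjI allI impI)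
    fix t :: real assume t: "0 \<le> t"
    have "norm (u t x) \<le> norm um + norm up + norm u0" if x: "0 < x" "x \<notin> {V * t, s * t}" for x
      using p[unfolded profile_def, rule_format, OF t x(1)] x(2) norm_ge_zero[of um] norm_ge_zero[of up] norm_ge_zero[of u0]
      by (cases "x < V * t"; cases "x < s * t") auto
    then show "\<exists>S. finite S \<and> (\<forall>x>0. x \<notin> S \<longrightarrow> norm (u t x) \<le> norm um + norm up + norm u0)"
      by (intro exI[of _ "{V * t, s * t}"]) auto
  qed simp
qed

text \<open>Each solution is bounded, so for distinct data division by their distance gives a
  constant depending on the pair. Equal data are never abruptly separated and fall under the uniform
  estimate.\<close>

lemma pairwise_stability:
  assumes r: "riemann_solution M u0' u'" "riemann_solution M u0'' u''"
  shows "\<exists>C. \<forall>A B t. 0 < A \<and> A < B \<and> 0 \<le> t \<longrightarrow>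
    integral {A..B} (\<lambda>x. norm (u' t x - u'' t x))
      \<le> C * (B + c1 M * t - max 0 (A - c1 M * t)) * norm (u0' - u0'')"
proof (cases "u0' = u0''")
  case True
  then have "\<not> abruptly_separated M u0' u0''" by (simp add: abruptly_separated_def)
  then show ?thesis using uniform_stability r by blast
next
  case False
  let ?n = "norm (u0' - u0'')"
  obtain K' where K': "0 \<le> K'" "\<forall>t\<ge>0. \<exists>S. finite S \<and> (\<forall>x>0. x \<notin> S \<longrightarrow> norm (u' t x) \<le> K')"
    using riemann_solution_bounded[OF r(1)] by blast
  obtain K'' where K'': "0 \<le> K''" "\<forall>t\<ge>0. \<exists>S. finite S \<and> (\<forall>x>0. x \<notin> S \<longrightarrow> norm (u'' t x) \<le> K'')"
    using riemann_solution_bounded[OF r(2)] by blast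
  show ?thesis
  proof (intro exI[of _ "(K' + K'') / ?n"] allI impI; elim conjE)
    fix A B t :: real assume A: "0 < A" "A < B" "0 \<le> t"
    let ?X = "B + c1 M * t - max 0 (A - c1 M * t)"
    have "0 \<le> c1 M * t" using c_pos A by simp
    then have X: "B - A \<le> ?X" using A by auto
    obtain S' where S': "finite S'" "\<And>x. 0 < x \<Longrightarrow> x \<notin> S' \<Longrightarrow> norm (u' t x) \<le> K'"
      using K'(2) A(3) by blast
    obtain S'' where S'': "finite S''" "\<And>x. 0 < x \<Longrightarrow> x \<notin> S'' \<Longrightarrow> norm (u'' t x) \<le> K''"
      using K''(2) A(3) by blast
    have "integral {A..B} (\<lambda>x. norm (u' t x - u'' t x)) \<le> (K' + K'') * (B - A) + 0 * max 0 (0 - 0)"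
    proof (rule integral_le_step[where S = "S' \<union> S''"])
      fix x assume "x \<in> {A..B} - (S' \<union> S'')"
      then have x: "0 < x" "x \<notin> S'" "x \<notin> S''" using A by auto
      show "norm (u' t x - u'' t x) \<le> K' + K'' + (if 0 < x \<and> x < 0 then 0 else 0)"
        using norm_triangle_ineq4[of "u' t x" "u'' t x"] S'(2)[OF x(1,2)] S''(2)[OF x(1,3)] by simp
    qed (use S'(1) S''(1) A K'(1) K''(1) in auto)
    also have "\<dots> \<le> (K' + K'') * ?X" using X K'(1) K''(1) by (simp add: mult_left_mono)
    also have "\<dots> = (K' + K'') / ?n * ?X * ?n" using False by simp
    finally show "integral {A..B} (\<lambda>x. norm (u' t x - u'' t x)) \<le> (K' + K'') / ?n * ?X * ?n" .
  qed
qed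

end

theorem theorem2p2:
  fixes M :: bar
  assumes "admissible_bar M"
  shows
    "(\<exists>L. L-lipschitz_on (HH M) (outer_speed M)) \<and>
     (\<exists>L. L-lipschitz_on (elastic_data M) (u_star M)) \<and>
     (\<exists>L Um Up Vs.
        L-lipschitz_on (phase_boundary_data M) (Um :: state \<Rightarrow> state) \<and>
        L-lipschitz_on (phase_boundary_data M) (Up :: state \<Rightarrow> state) \<and>
        L-lipschitz_on (phase_boundary_data M) (Vs :: state \<Rightarrow> real) \<and>
        (\<forall>u0 um up V. phase_boundary_states M u0 um up V \<longrightarrow>
           um = Um u0 \<and> V = Vs u0 \<and> (V < outer_speed M u0 \<longrightarrow> up = Up u0))) \<and>
     (\<exists>C. \<forall>u0' u0'' u' u''.
        riemann_solution M u0' u' \<and> riemann_solution M u0'' u'' \<and>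
        \<not> abruptly_separated M u0' u0'' \<longrightarrow>
        (\<forall>A B t. 0 < A \<and> A < B \<and> 0 \<le> t \<longrightarrow>
           integral {A..B} (\<lambda>x. norm (u' t x - u'' t x))
             \<le> C * (B + c1 M * t - max 0 (A - c1 M * t)) * norm (u0' - u0''))) \<and>
     (\<forall>u0' u0'' u' u''.
        riemann_solution M u0' u' \<and> riemann_solution M u0'' u'' \<longrightarrow>
        (\<exists>C. \<forall>A B t. 0 < A \<and> A < B \<and> 0 \<le> t \<longrightarrow>
           integral {A..B} (\<lambda>x. norm (u' t x - u'' t x))
             \<le> C * (B + c1 M * t - max 0 (A - c1 M * t)) * norm (u0' - u0'')))"
proof -
  interpret bar_model M using assms by unfold_locales
  show ?thesis
    using outer_speed_lipschitz u_star_lipschitz phase_boundary_selection uniform_stability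
      pairwise_stability
    by (intro conjI allI impI) (assumption | blast)+
qed

end
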